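(* Every tame automorphism of $\mathrm{SL}_2(\mathbb{C})$ is an element of $\mathcal{A}$; that is, every tame automorphism of the affine variety $\mathrm{SL}_2(\mathbb{C})$ admits a sequence of elementary reductions to an element of $\mathrm{O}_4(\mathbb{C})$.
   Context: Let $q = x_1x_4-x_2x_3\in\mathbb{C}[x_1,x_2,x_3,x_4]$ and view $\mathrm{SL}_2(\mathbb{C})=\{q=1\}\subset\mathbb{A}^4$ as an affine variety, with points written $\begin{pmatrix} x_1&x_2\\ x_3&x_4\end{pmatrix}$ and coordinate ring $\mathbb{C}[\mathrm{SL}_2(\mathbb{C})]=\mathbb{C}[x_1,x_2,x_3,x_4]/(q-1)$. An automorphism $F$ of this variety (not necessarily a group homomorphism) is written $F=\begin{pmatrix} f_1&f_2\\ f_3&f_4\end{pmatrix}$ with $f_i\in\mathbb{C}[\mathrm{SL}_2(\mathbb{C})]$ its coordinate functions; $\mathrm{Aut}(\mathrm{SL}_2(\mathbb{C}))$ is the group of these automorphisms, with composition of maps: $(E\circ F)(x)=E(F(x))$. Elementary automorphisms: $\mathcal{E}=\mathcal{E}^{12}\cup\mathcal{E}_{34}\cup\mathcal{E}^2_4\cup\mathcal{E}^1_3$, where (with $a,b\in\mathbb{C}^*$ and $h$ any polynomial in the two indicated variables) - $\mathcal{E}_{34}$: all $\begin{pmatrix} x_1/a & x_2/b\\ bx_3+bx_1h(x_1,x_2) & ax_4+ax_2h(x_1,x_2)\end{pmatrix}$; - $\mathcal{E}^{12}$: all $\begin{pmatrix} ax_1+ax_3h(x_3,x_4) & bx_2+bx_4h(x_3,x_4)\\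 x_3/b & x_4/a\end{pmatrix}$; - $\mathcal{E}^2_4$: all $\begin{pmatrix} x_1/a & bx_2+bx_1h(x_1,x_3)\\ x_3/b & ax_4+ax_3h(x_1,x_3)\end{pmatrix}$; - $\mathcal{E}^1_3$: all $\begin{pmatrix} ax_1+ax_2h(x_2,x_4) & x_2/b\\ bx_3+bx_4h(x_2,x_4) & x_4/a\end{pmatrix}$. $\mathrm{O}_4(\mathbb{C})$ denotes the group of automorphisms of $\mathrm{SL}_2(\mathbb{C})$ induced by linear maps of $\mathbb{A}^4$ preserving the quadratic form $q$. The tame subgroup of $\mathrm{Aut}(\mathrm{SL}_2(\mathbb{C}))$ is the subgroup generated by $\mathcal{E}$ and $\mathrm{O}_4(\mathbb{C})$; its elements are called tame. Degree: on $\mathbb{C}[x_1,\dots,x_4]$ let $\deg_{\mathbb{C}^4}$ be the $\mathbb{N}^3$-valued weighted degree with $\deg_{\mathbb{C}^4}x_1=(1,0,0)$, $\deg_{\mathbb{C}^4}x_2=(0,1,0)$, $\deg_{\mathbb{C}^4}x_3=(1,0,1)$, $\deg_{\mathbb{C}^4}x_4=(0,1,1)$, where $\mathbb{N}^3$ carries the graded lexicographic order (compare first the sums of coordinates, then lexicographically), the degree of a nonzero polynomial is the maximum of the degrees of its monomials, and $\deg 0=-\infty$. For $f\in\mathbb{C}[\mathrm{SL}_2(\mathbb{C})]$ set $\deg f=\min\{\deg_{\mathbb{C}^4}g:\ g\in\mathbb{C}[x_1,\dots,x_4]\text{ restricts to }f\}$. For $F=\begin{pmatrix} f_1&f_2\\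 f_3&f_4\end{pmatrix}\in\mathrm{Aut}(\mathrm{SL}_2(\mathbb{C}))$ set $\deg F=\sum_{i=1}^4\deg f_i$. $E\circ F$ is an elementary reduction of $F$ if $E\in\mathcal{E}$ and $\deg(E\circ F)<\deg F$. $\mathcal{A}$ is the set of tame automorphisms $F$ that admit a finite (possibly empty) sequence of elementary reductions to an element of $\mathrm{O}_4(\mathbb{C})$: there are $F=F_0,F_1,\dots,F_m$ with $F_m\in\mathrm{O}_4(\mathbb{C})$ and each $F_{i+1}$ an elementary reduction of $F_i$. *)

theory Defs
  imports
    "HOL-Library.Poly_Mapping"
    "HOL-Library.Numeral_Type"
    "HOL-Library.FuncSet"
    "HOL-Analysis.Cartesian_Space"
    "HOL-Computational_Algebra.Polynomial"
    "HOL-Algebra.Generated_Groups"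
begin

section \<open>Polynomials in finitely many variables over the complex numbers\<close>

text \<open>Polynomials are the formal objects of the monoid algebra, with variables indexed by a type.\<close>

type_synonym 'v cpoly = "('v \<Rightarrow>\<^sub>0 nat) \<Rightarrow>\<^sub>0 complex"

definition mon_eval :: "('v::finite \<Rightarrow>\<^sub>0 nat) \<Rightarrow> complex ^ 'v \<Rightarrow> complex" where
  "mon_eval m x = (\<Prod>i\<in>UNIV. (x $ i) ^ Poly_Mapping.lookup m i)"

definition cpoly_eval :: "'v::finite cpoly \<Rightarrow> complex ^ 'v \<Rightarrow> complex" where
  "cpoly_eval p x = (\<Sum>m\<in>Poly_Mapping.keys p. Poly_Mapping.lookup p m * mon_eval m x)"

definition Var :: "'v \<Rightarrow> 'v cpoly" where
  "Var i = Poly_Mapping.single (Poly_Mapping.single i 1) 1"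

lemma cpoly_eval_superset:
  assumes "finite S" "Poly_Mapping.keys p \<subseteq> S"
  shows "cpoly_eval p x = (\<Sum>m\<in>S. Poly_Mapping.lookup p m * mon_eval m x)"
  unfolding cpoly_eval_def using assms
  by (intro sum.mono_neutral_left) (auto simp: in_keys_iff)

lemma cpoly_eval_zero [simp]: "cpoly_eval 0 x = 0"
  by (simp add: cpoly_eval_def)

lemma cpoly_eval_single [simp]:
  "cpoly_eval (Poly_Mapping.single m c) x = c * mon_eval m x"
  by (simp add: cpoly_eval_superset[of "{m}"])

lemma cpoly_eval_add [simp]: "cpoly_eval (p + q) x = cpoly_eval p x + cpoly_eval q x"
proof -
  let ?S = "Poly_Mapping.keys p \<union> Poly_Mapping.keys q"
  have "cpoly_eval (p + q) x = (\<Sum>m\<in>?S. Poly_Mapping.lookup (p + q) m * mon_eval m x)"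
    by (intro cpoly_eval_superset) (auto dest: subsetD[OF keys_add])
  also have "\<dots> = (\<Sum>m\<in>?S. Poly_Mapping.lookup p m * mon_eval m x) + (\<Sum>m\<in>?S. Poly_Mapping.lookup q m * mon_eval m x)"
    by (simp add: lookup_add algebra_simps sum.distrib)
  also have "\<dots> = cpoly_eval p x + cpoly_eval q x"
    by (simp add: cpoly_eval_superset[of ?S, symmetric])
  finally show ?thesis .
qed

lemma cpoly_induct [case_names zero single add]:
  assumes "P 0" "\<And>m c. P (Poly_Mapping.single m c)"
    and "\<And>p q. P p \<Longrightarrow> P q \<Longrightarrow> P (p + q)"
  shows "P (p :: 'v cpoly)"
proof (induction p rule: update_induct)
  case const
  then show ?case by (rule assms(1))
next
  case (update f m c)
  have "Poly_Mapping.update m c f = f + Poly_Mapping.single m c"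
    using update by (intro poly_mapping_eqI)
      (auto simp: lookup_update lookup_add lookup_single when_def in_keys_iff)
  then show ?case using assms(2,3) update by metis
qed

lemma mon_eval_add [simp]: "mon_eval (m + n) x = mon_eval m x * mon_eval n x"
  by (simp add: mon_eval_def lookup_add power_add prod.distrib)

lemma cpoly_eval_mult [simp]: "cpoly_eval (p * q) x = cpoly_eval p x * cpoly_eval q x"
proof (induction p rule: cpoly_induct)
  case (single m c)
  show ?case
    by (induction q rule: cpoly_induct) (simp_all add: mult_single algebra_simps)
qed (simp_all add: algebra_simps)

lemma mon_eval_0 [simp]: "mon_eval 0 x = 1"
  by (simp add: mon_eval_def)

lemma cpoly_eval_1 [simp]: "cpoly_eval 1 x = 1"
  by (simp flip: single_one)

lemma cpoly_eval_Var [simp]: "cpoly_eval (Var i) x = x $ i"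
proof -
  have "(\<Prod>j\<in>UNIV. (x $ j) ^ (1 when i = j)) = (\<Prod>j\<in>{i}. (x $ j) ^ (1 when i = j))"
    by (intro prod.mono_neutral_right) (auto simp: when_def)
  then show ?thesis
    by (simp add: Var_def mon_eval_def lookup_single)
qed

lemma cpoly_eval_uminus [simp]: "cpoly_eval (- p) x = - cpoly_eval p x"
  using cpoly_eval_add[of p "- p" x] by (simp add: eq_neg_iff_add_eq_0 add.commute)

lemma cpoly_eval_diff [simp]: "cpoly_eval (p - q) x = cpoly_eval p x - cpoly_eval q x"
  using cpoly_eval_add[of p "- q" x] by simp

lemma cpoly_eval_power [simp]: "cpoly_eval (p ^ n) x = cpoly_eval p x ^ n"
  by (induction n) simp_all


section \<open>The variety and its automorphism group\<close>

lemma vector_4 [simp]: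
  "(vector [a, b, c, d] :: 'a::zero ^ 4) $ 1 = a"
  "(vector [a, b, c, d] :: 'a ^ 4) $ 2 = b"
  "(vector [a, b, c, d] :: 'a ^ 4) $ 3 = c"
  "(vector [a, b, c, d] :: 'a ^ 4) $ 4 = d"
  unfolding vector_def by simp_all

text \<open>A matrix with rows \<open>(x\<^sub>1, x\<^sub>2)\<close> and \<open>(x\<^sub>3, x\<^sub>4)\<close> is the vector \<open>vector [x\<^sub>1, x\<^sub>2, x\<^sub>3, x\<^sub>4]\<close>.\<close>

lemma prod_4: "prod f (UNIV :: 4 set) = f 1 * f 2 * f 3 * f 4"
  unfolding UNIV_4 by (simp add: mult.assoc)

lemma mon_eval_4:
  fixes m :: "4 \<Rightarrow>\<^sub>0 nat"
  shows "mon_eval m x = x$1 ^ Poly_Mapping.lookup m 1 * x$2 ^ Poly_Mapping.lookup m 2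
     * x$3 ^ Poly_Mapping.lookup m 3 * x$4 ^ Poly_Mapping.lookup m 4"
  unfolding mon_eval_def prod_4 ..

definition qform :: "complex ^ 4 \<Rightarrow> complex" where
  "qform x = x $ 1 * x $ 4 - x $ 2 * x $ 3"

definition SL2 :: "(complex ^ 4) set" where
  "SL2 = {x. qform x = 1}"

text \<open>Functions on the variety are taken extensional, so that equality is equality on the variety.\<close>

definition coord_ring :: "(complex ^ 4 \<Rightarrow> complex) set" where
  "coord_ring = {restrict (cpoly_eval g) SL2 | g :: 4 cpoly. True}"

text \<open>
  The functions above are those of \<open>\<complex>[x\<^sub>1,x\<^sub>2,x\<^sub>3,x\<^sub>4]/(q-1)\<close>: the lemma \<open>restrict_eq_iff\<close> below shows
  that two polynomials restrict to the same function iff they differ by a multiple of \<open>q_poly - 1\<close>.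
\<close>

lemma cpoly_eq_0:
  fixes p :: "4 cpoly"
  assumes "\<And>x. cpoly_eval p x = 0"
  shows "p = 0"
proof -
  let ?K = "Poly_Mapping.keys p"
  define N where "N = Suc (Max (insert 0 ((\<lambda>(m, i). Poly_Mapping.lookup m i) ` (?K \<times> UNIV))))"
  have N: "Poly_Mapping.lookup m i < N" if "m \<in> ?K" for m i
    unfolding N_def less_Suc_eq_le using that by (intro Max_ge) force+
  define e where "e m = Poly_Mapping.lookup m 1 + N * (Poly_Mapping.lookup m 2
    + N * (Poly_Mapping.lookup m 3 + N * Poly_Mapping.lookup m 4))" for m :: "4 \<Rightarrow>\<^sub>0 nat"
  have digit: "a = a' \<and> b = b'" if "a + N * b = a' + N * b'" "a < N" "a' < N" for a a' b b'
  proof -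
    have "(a + N * b) mod N = (a' + N * b') mod N" "(a + N * b) div N = (a' + N * b') div N"
      using that(1) by simp_all
    then show ?thesis using that(2,3) by simp
  qed
  have inj: "m = m'" if "m \<in> ?K" "m' \<in> ?K" "e m = e m'" for m m'
  proof -
    note d1 = digit[OF that(3)[unfolded e_def] N[OF that(1)] N[OF that(2)]]
    note d2 = digit[OF conjunct2[OF d1] N[OF that(1)] N[OF that(2)]]
    note d3 = digit[OF conjunct2[OF d2] N[OF that(1)] N[OF that(2)]]
    have "\<forall>i. Poly_Mapping.lookup m i = Poly_Mapping.lookup m' i"
      unfolding forall_4 using d1 d2 d3 by blast
    then show ?thesis by (intro poly_mapping_eqI) simp
  qed
  define P where "P = (\<Sum>m\<in>?K. monom (Poly_Mapping.lookup p m) (e m))"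
  have "poly P t = 0" for t
  proof -
    have "mon_eval m (vector [t, t ^ N, t ^ (N * N), t ^ (N * N * N)]) = t ^ e m" for m
    proof -
      have "e m = Poly_Mapping.lookup m 1 + N * Poly_Mapping.lookup m 2
          + N * N * Poly_Mapping.lookup m 3 + N * N * N * Poly_Mapping.lookup m 4"
        by (simp only: e_def distrib_left mult.assoc add.assoc)
      then show ?thesis
        by (simp add: mon_eval_4 power_add power_mult)
    qed
    then have "poly P t = cpoly_eval p (vector [t, t ^ N, t ^ (N * N), t ^ (N * N * N)])"
      by (simp add: P_def cpoly_eval_def poly_sum poly_monom)
    then show ?thesis using assms by simp
  qed
  then have "P = 0" using poly_all_0_iff_0 by blast
  have "Poly_Mapping.lookup p m = 0" for m
  proof (rule ccontr)
    assume "Poly_Mapping.lookup p m \<noteq> 0"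
    then have m: "m \<in> ?K" by (simp add: in_keys_iff)
    have "coeff P (e m) = (\<Sum>m'\<in>?K. if m' = m then Poly_Mapping.lookup p m' else 0)"
      unfolding P_def coeff_sum by (intro sum.cong) (auto dest: inj[OF _ m])
    also have "\<dots> = Poly_Mapping.lookup p m" using m by simp
    finally show False using \<open>P = 0\<close> \<open>Poly_Mapping.lookup p m \<noteq> 0\<close> by simp
  qed
  then show ?thesis by (intro poly_mapping_eqI) simp
qed

lemma cpoly_eqI:
  fixes p r :: "4 cpoly"
  assumes "\<And>x. cpoly_eval p x = cpoly_eval r x"
  shows "p = r"
  using cpoly_eq_0[of "p - r"] assms by simp

definition q_poly :: "4 cpoly" where
  "q_poly = Var 1 * Var 4 - Var 2 * Var 3"

lemma cpoly_eval_q_poly [simp]: "cpoly_eval q_poly x = qform x"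
  by (simp add: q_poly_def qform_def)

lemma cpoly_no_zero_divisors:
  fixes p r :: "4 cpoly"
  assumes "p * r = 0" shows "p = 0 \<or> r = 0"
  using assms by simp

lemma clear_x4:
  "\<exists>n h. (\<forall>x t. cpoly_eval h (vector [x$1, x$2, x$3, t]) = cpoly_eval h x) \<and>
     q_poly - 1 dvd Var 1 ^ n * g - (h :: 4 cpoly)"
proof (induction g rule: cpoly_induct)
  case zero
  show ?case by (rule exI[of _ 0], rule exI[of _ 0], simp)
next
  case (single m c)
  let ?l = "Poly_Mapping.lookup m"
  let ?C = "Poly_Mapping.single 0 c * Var 1 ^ ?l 1 * Var 2 ^ ?l 2 * Var 3 ^ ?l 3 :: 4 cpoly"
  let ?h = "?C * (1 + Var 2 * Var 3) ^ ?l 4"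
  have "Poly_Mapping.single m c = ?C * Var 4 ^ ?l 4"
    by (rule cpoly_eqI) (simp add: mon_eval_4[of m] mult.assoc)
  then have "Var 1 ^ ?l 4 * Poly_Mapping.single m c - ?h
      = ?C * ((Var 1 * Var 4) ^ ?l 4 - (1 + Var 2 * Var 3) ^ ?l 4)"
    by (simp add: power_mult_distrib algebra_simps)
  moreover have "Var 1 * Var 4 - (1 + Var 2 * Var 3) dvd
      (Var 1 * Var 4 :: 4 cpoly) ^ ?l 4 - (1 + Var 2 * Var 3) ^ ?l 4"
    by (simp add: power_diff_sumr2)
  moreover have "Var 1 * Var 4 - (1 + Var 2 * Var 3) = q_poly - 1"
    by (simp add: q_poly_def)
  ultimately have "q_poly - 1 dvd Var 1 ^ ?l 4 * Poly_Mapping.single m c - ?h"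
    by simp
  then show ?case
    by (intro exI[of _ "?l 4"] exI[of _ ?h]) simp
next
  case (add p r)
  then obtain n h n' h' where
    h: "\<And>x t. cpoly_eval h (vector [x$1, x$2, x$3, t]) = cpoly_eval h x"
       "q_poly - 1 dvd Var 1 ^ n * p - h"
    and h': "\<And>x t. cpoly_eval h' (vector [x$1, x$2, x$3, t]) = cpoly_eval h' x"
       "q_poly - 1 dvd Var 1 ^ n' * r - h'"
    by blast
  have "Var 1 ^ (n + n') * (p + r) - (Var 1 ^ n' * h + Var 1 ^ n * h')
    = Var 1 ^ n' * (Var 1 ^ n * p - h) + Var 1 ^ n * (Var 1 ^ n' * r - h')"
    by (simp add: algebra_simps power_add)
  then have "q_poly - 1 dvd Var 1 ^ (n + n') * (p + r) - (Var 1 ^ n' * h + Var 1 ^ n * h')"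
    using h(2) h'(2) by simp
  then show ?case
    by (intro exI[of _ "n + n'"] exI[of _ "Var 1 ^ n' * h + Var 1 ^ n * h'"]) (simp add: h h')
qed

lemma split_x1:
  "\<exists>k0 k'. g = k0 + Var 1 * k' \<and>
     (\<forall>x t. cpoly_eval k0 (vector [t, x$2, x$3, x$4]) = cpoly_eval (k0 :: 4 cpoly) x)"
proof (induction g rule: cpoly_induct)
  case zero
  show ?case by (rule exI[of _ 0], rule exI[of _ 0], simp)
next
  case (single m c)
  show ?case
  proof (cases "Poly_Mapping.lookup m 1")
    case 0
    then show ?thesis
      by (intro exI[of _ "Poly_Mapping.single m c"] exI[of _ "0 :: 4 cpoly"]) (simp add: mon_eval_4)
  next
    case (Suc n)
    define m' where "m' = m - Poly_Mapping.single 1 1"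
    have "m = Poly_Mapping.single 1 1 + m'"
      using Suc by (intro poly_mapping_eqI)
        (auto simp: m'_def lookup_add lookup_minus lookup_single when_def)
    then have "Poly_Mapping.single m c = Var 1 * Poly_Mapping.single m' c"
      by (simp add: Var_def mult_single)
    then show ?thesis by (intro exI[of _ "0 :: 4 cpoly"] exI[of _ "Poly_Mapping.single m' c"]) simp
  qed
next
  case (add p r)
  then obtain k0 k' l0 l' where
    "p = k0 + Var 1 * k'" "\<And>x t. cpoly_eval k0 (vector [t, x$2, x$3, x$4]) = cpoly_eval k0 x"
    "r = l0 + Var 1 * l'" "\<And>x t. cpoly_eval l0 (vector [t, x$2, x$3, x$4]) = cpoly_eval l0 x"
    by blast
  then show ?case
    by (intro exI[of _ "k0 + l0"] exI[of _ "k' + l'"]) (simp add: algebra_simps)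
qed

lemma cancel_x1:
  assumes "q_poly - 1 dvd Var 1 * g"
  shows "q_poly - 1 dvd g"
proof -
  obtain k where k: "Var 1 * g = (q_poly - 1) * k" using assms by (elim dvdE)
  obtain k0 k' where k0: "k = k0 + Var 1 * k'"
    "\<And>x t. cpoly_eval k0 (vector [t, x$2, x$3, x$4]) = cpoly_eval k0 x"
    using split_x1 by blast
  have "cpoly_eval ((Var 2 * Var 3 + 1) * k0) x = cpoly_eval 0 x" for x
  proof -
    let ?y = "vector [0, x$2, x$3, x$4] :: complex ^ 4"
    have "(qform ?y - 1) * cpoly_eval k ?y = 0"
      using arg_cong[OF k, of "\<lambda>p. cpoly_eval p ?y"] by simp
    moreover have "qform ?y - 1 = - (x$2 * x$3 + 1)" by (simp add: qform_def)
    moreover have "cpoly_eval k ?y = cpoly_eval k0 x"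
      using k0(2)[where t = 0 and x = x] by (simp add: k0(1))
    ultimately have "(x$2 * x$3 + 1) * cpoly_eval k0 x = 0" by (metis mult_minus_left neg_equal_0_iff_equal)
    then show ?thesis by (simp del: mult_eq_0_iff)
  qed
  then have "(Var 2 * Var 3 + 1) * k0 = 0" by (rule cpoly_eqI)
  moreover have "cpoly_eval (Var 2 * Var 3 + 1) 0 \<noteq> cpoly_eval 0 0" by simp
  then have "Var 2 * Var 3 + (1 :: 4 cpoly) \<noteq> 0" by metis
  ultimately have "k0 = 0" using cpoly_no_zero_divisors by blast
  then have "Var 1 * (g - (q_poly - 1) * k') = 0"
    using k k0(1) by (simp add: algebra_simps)
  moreover have "cpoly_eval (Var 1 :: 4 cpoly) 1 \<noteq> cpoly_eval 0 1"
    by simp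
  then have "Var 1 \<noteq> (0 :: 4 cpoly)" by metis
  ultimately have "g = (q_poly - 1) * k'" using cpoly_no_zero_divisors by fastforce
  then show ?thesis by simp
qed

lemma vanishes_on_SL2_iff:
  "(\<forall>x\<in>SL2. cpoly_eval g x = 0) \<longleftrightarrow> q_poly - 1 dvd g"
proof
  assume "q_poly - 1 dvd g"
  then show "\<forall>x\<in>SL2. cpoly_eval g x = 0"
    by (auto simp: SL2_def elim!: dvdE)
next
  assume g: "\<forall>x\<in>SL2. cpoly_eval g x = 0"
  obtain n h where h: "\<And>x t. cpoly_eval h (vector [x$1, x$2, x$3, t]) = cpoly_eval h x"
    "q_poly - 1 dvd Var 1 ^ n * g - h"
    using clear_x4 by blast
  obtain k where k: "Var 1 ^ n * g - h = (q_poly - 1) * k" using h(2) by (elim dvdE)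
  have "cpoly_eval (Var 1 * h) x = cpoly_eval 0 x" for x
  proof (cases "x $ 1 = 0")
    case False
    let ?y = "vector [x$1, x$2, x$3, (1 + x$2 * x$3) / x$1] :: complex ^ 4"
    have "qform ?y = 1" using False by (simp add: qform_def)
    then have "cpoly_eval h ?y = 0"
      using g arg_cong[OF k, of "\<lambda>p. cpoly_eval p ?y"] by (simp add: SL2_def)
    then show ?thesis using h(1) by simp
  qed simp
  then have "Var 1 * h = 0" by (rule cpoly_eqI)
  then have "Var 1 * (Var 1 ^ n * g) = (q_poly - 1) * (Var 1 * k)"
    using k by (metis (no_types, lifting) diff_zero mult.left_commute right_diff_distrib)
  then have "q_poly - 1 dvd Var 1 * (Var 1 ^ n * g)"
    by (rule dvdI)
  then have "q_poly - 1 dvd Var 1 ^ n * g"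
    by (rule cancel_x1)
  then show "q_poly - 1 dvd g"
  proof (induction n)
    case (Suc n)
    have "Var 1 ^ Suc n * g = Var 1 * (Var 1 ^ n * g)"
      by (simp only: power_Suc mult.assoc)
    then show ?case using Suc.prems by (metis Suc.IH cancel_x1)
  qed simp
qed

lemma restrict_eq_iff:
  "restrict (cpoly_eval g) SL2 = restrict (cpoly_eval g') SL2 \<longleftrightarrow> q_poly - 1 dvd g - g'"
  unfolding vanishes_on_SL2_iff[symmetric] by (auto simp: restrict_def fun_eq_iff)

definition coord :: "(complex ^ 4 \<Rightarrow> complex ^ 4) \<Rightarrow> 4 \<Rightarrow> complex ^ 4 \<Rightarrow> complex" where
  "coord F i = restrict (\<lambda>x. F x $ i) SL2"

definition regular_maps :: "(complex ^ 4 \<Rightarrow> complex ^ 4) set" where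
  "regular_maps = {F \<in> SL2 \<rightarrow>\<^sub>E SL2. \<forall>i. coord F i \<in> coord_ring}"

definition Aut_SL2 :: "(complex ^ 4 \<Rightarrow> complex ^ 4) set" where
  "Aut_SL2 = {F \<in> regular_maps. \<exists>G\<in>regular_maps.
      compose SL2 F G = (\<lambda>x\<in>SL2. x) \<and> compose SL2 G F = (\<lambda>x\<in>SL2. x)}"

definition Aut_group :: "(complex ^ 4 \<Rightarrow> complex ^ 4) monoid" where
  "Aut_group = \<lparr>carrier = Aut_SL2, mult = compose SL2, one = (\<lambda>x\<in>SL2. x)\<rparr>"

definition subst_poly :: "('v::finite \<Rightarrow> 'w cpoly) \<Rightarrow> 'v cpoly \<Rightarrow> 'w cpoly" where
  "subst_poly s p = (\<Sum>m\<in>Poly_Mapping.keys p.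
     Poly_Mapping.single 0 (Poly_Mapping.lookup p m) * (\<Prod>i\<in>UNIV. s i ^ Poly_Mapping.lookup m i))"

lemma cpoly_eval_sum [simp]: "cpoly_eval (sum f A) x = (\<Sum>a\<in>A. cpoly_eval (f a) x)"
  by (induction A rule: infinite_finite_induct) simp_all

lemma cpoly_eval_prod [simp]: "cpoly_eval (prod f A) x = (\<Prod>a\<in>A. cpoly_eval (f a) x)"
  by (induction A rule: infinite_finite_induct) simp_all

lemma cpoly_eval_subst:
  "cpoly_eval (subst_poly s p) x = cpoly_eval p (\<chi> i. cpoly_eval (s i) x)"
  by (simp add: subst_poly_def cpoly_eval_def[of p] mon_eval_def[of _ "\<chi> i. _ i"])

lemma compose_regular_maps:
  assumes "F \<in> regular_maps" "G \<in> regular_maps"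
  shows "compose SL2 F G \<in> regular_maps"
proof -
  have F: "F \<in> SL2 \<rightarrow>\<^sub>E SL2" and G: "G \<in> SL2 \<rightarrow>\<^sub>E SL2"
    using assms by (auto simp: regular_maps_def)
  have "\<exists>g :: 4 cpoly. \<forall>x\<in>SL2. F x $ i = cpoly_eval g x" for i
    using assms(1) unfolding regular_maps_def coord_def coord_ring_def
    by (auto simp: restrict_def fun_eq_iff) metis
  then obtain f :: "4 \<Rightarrow> 4 cpoly" where f: "\<And>i x. x \<in> SL2 \<Longrightarrow> F x $ i = cpoly_eval (f i) x"
    by metis
  have "\<exists>g :: 4 cpoly. \<forall>x\<in>SL2. G x $ i = cpoly_eval g x" for i
    using assms(2) unfolding regular_maps_def coord_def coord_ring_def
    by (auto simp: restrict_def fun_eq_iff) metis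
  then obtain g :: "4 \<Rightarrow> 4 cpoly" where g: "\<And>i x. x \<in> SL2 \<Longrightarrow> G x $ i = cpoly_eval (g i) x"
    by metis
  have G_eq: "G x = (\<chi> i. cpoly_eval (g i) x)" if "x \<in> SL2" for x
    using g[OF that] by (simp add: vec_eq_iff)
  have "coord (compose SL2 F G) i = restrict (cpoly_eval (subst_poly g (f i))) SL2" for i
  proof (unfold coord_def, rule restrict_ext)
    fix x assume x: "x \<in> SL2"
    then have "G x \<in> SL2" using G by auto
    then show "compose SL2 F G x $ i = cpoly_eval (subst_poly g (f i)) x"
      using x f[of "G x" i] by (simp add: compose_def cpoly_eval_subst G_eq)
  qed
  moreover have "compose SL2 F G \<in> SL2 \<rightarrow>\<^sub>E SL2"
    using F G by (auto simp: compose_def)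
  ultimately show ?thesis
    by (auto simp: regular_maps_def coord_ring_def)
qed

lemma id_regular_maps: "(\<lambda>x\<in>SL2. x) \<in> regular_maps"
proof -
  have "coord (\<lambda>x\<in>SL2. x) i = restrict (cpoly_eval (Var i)) SL2" for i
    by (auto simp: coord_def)
  then show ?thesis by (auto simp: regular_maps_def coord_ring_def)
qed

lemma group_Aut_group: "group Aut_group"
proof (rule groupI)
  have ext: "F \<in> extensional SL2" "F \<in> SL2 \<rightarrow> SL2" if "F \<in> regular_maps" for F
    using that by (auto simp: regular_maps_def PiE_def)
  have PM: "F \<in> regular_maps" if "F \<in> Aut_SL2" for F
    using that by (simp add: Aut_SL2_def)
  show "\<one>\<^bsub>Aut_group\<^esub> \<in> carrier Aut_group"
    using id_regular_maps by (auto simp: Aut_group_def Aut_SL2_def compose_def fun_eq_iff intro!: bexI[of _ "\<lambda>x\<in>SL2. x"])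
  fix F G H
  assume "F \<in> carrier Aut_group" then have F: "F \<in> Aut_SL2" by (simp add: Aut_group_def)
  obtain F' where F': "F' \<in> regular_maps" "compose SL2 F F' = (\<lambda>x\<in>SL2. x)" "compose SL2 F' F = (\<lambda>x\<in>SL2. x)"
    using F by (auto simp: Aut_SL2_def)
  show "\<one>\<^bsub>Aut_group\<^esub> \<otimes>\<^bsub>Aut_group\<^esub> F = F"
    using ext[OF PM[OF F]] by (simp add: Aut_group_def Id_compose)
  show "\<exists>y\<in>carrier Aut_group. y \<otimes>\<^bsub>Aut_group\<^esub> F = \<one>\<^bsub>Aut_group\<^esub>"
    using F F' by (auto simp: Aut_group_def Aut_SL2_def)
  assume "G \<in> carrier Aut_group" then have G: "G \<in> Aut_SL2" by (simp add: Aut_group_def)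
  obtain G' where G': "G' \<in> regular_maps" "compose SL2 G G' = (\<lambda>x\<in>SL2. x)" "compose SL2 G' G = (\<lambda>x\<in>SL2. x)"
    using G by (auto simp: Aut_SL2_def)
  have 1: "compose SL2 (compose SL2 F G) (compose SL2 G' F') x = (\<lambda>x\<in>SL2. x) x"
    and 2: "compose SL2 (compose SL2 G' F') (compose SL2 F G) x = (\<lambda>x\<in>SL2. x) x" for x
    using fun_cong[OF F'(2), of x] fun_cong[OF G'(2), of "F' x"] ext(2)[OF F'(1)] ext(2)[OF G'(1)]
      fun_cong[OF G'(3), of x] fun_cong[OF F'(3), of "G x"]
      ext(2)[OF PM[OF F]] ext(2)[OF PM[OF G]]
    by (auto simp: compose_def Pi_iff split: if_splits)
  show "F \<otimes>\<^bsub>Aut_group\<^esub> G \<in> carrier Aut_group"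
    using compose_regular_maps[OF PM[OF F] PM[OF G]] compose_regular_maps[OF G'(1) F'(1)] 1 2
    unfolding Aut_group_def Aut_SL2_def by (auto simp: fun_eq_iff intro!: bexI[of _ "compose SL2 G' F'"])
  assume "H \<in> carrier Aut_group" then have H: "H \<in> Aut_SL2" by (simp add: Aut_group_def)
  show "F \<otimes>\<^bsub>Aut_group\<^esub> G \<otimes>\<^bsub>Aut_group\<^esub> H = F \<otimes>\<^bsub>Aut_group\<^esub> (G \<otimes>\<^bsub>Aut_group\<^esub> H)"
    using ext(2)[OF PM[OF H]] by (auto simp: Aut_group_def compose_def fun_eq_iff Pi_iff)
qed


section \<open>Tame automorphisms\<close>

definition E34 :: "(complex ^ 4 \<Rightarrow> complex ^ 4) set" where
  "E34 = {\<lambda>x\<in>SL2. vector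
      [x$1 / a, x$2 / b,
       b * x$3 + b * x$1 * cpoly_eval h (vector [x$1, x$2]),
       a * x$4 + a * x$2 * cpoly_eval h (vector [x$1, x$2])]
    | a b (h :: 2 cpoly). a \<noteq> 0 \<and> b \<noteq> 0}"

definition E12 :: "(complex ^ 4 \<Rightarrow> complex ^ 4) set" where
  "E12 = {\<lambda>x\<in>SL2. vector
      [a * x$1 + a * x$3 * cpoly_eval h (vector [x$3, x$4]),
       b * x$2 + b * x$4 * cpoly_eval h (vector [x$3, x$4]),
       x$3 / b, x$4 / a]
    | a b (h :: 2 cpoly). a \<noteq> 0 \<and> b \<noteq> 0}"

definition E24 :: "(complex ^ 4 \<Rightarrow> complex ^ 4) set" where
  "E24 = {\<lambda>x\<in>SL2. vector
      [x$1 / a, b * x$2 + b * x$1 * cpoly_eval h (vector [x$1, x$3]),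
       x$3 / b, a * x$4 + a * x$3 * cpoly_eval h (vector [x$1, x$3])]
    | a b (h :: 2 cpoly). a \<noteq> 0 \<and> b \<noteq> 0}"

definition E13 :: "(complex ^ 4 \<Rightarrow> complex ^ 4) set" where
  "E13 = {\<lambda>x\<in>SL2. vector
      [a * x$1 + a * x$2 * cpoly_eval h (vector [x$2, x$4]), x$2 / b,
       b * x$3 + b * x$4 * cpoly_eval h (vector [x$2, x$4]), x$4 / a]
    | a b (h :: 2 cpoly). a \<noteq> 0 \<and> b \<noteq> 0}"

definition elementary :: "(complex ^ 4 \<Rightarrow> complex ^ 4) set" where
  "elementary = E12 \<union> E34 \<union> E24 \<union> E13"

definition O4 :: "(complex ^ 4 \<Rightarrow> complex ^ 4) set" where
  "O4 = {restrict ((*v) A) SL2 | A :: complex ^ 4 ^ 4. \<forall>x. qform (A *v x) = qform x}"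

definition tame :: "(complex ^ 4 \<Rightarrow> complex ^ 4) set" where
  "tame = generate Aut_group (elementary \<union> O4)"


section \<open>Degrees\<close>

datatype mdeg = MInf | MDeg nat nat nat

instantiation mdeg :: linorder
begin

fun less_eq_mdeg :: "mdeg \<Rightarrow> mdeg \<Rightarrow> bool" where
  "MInf \<le> d \<longleftrightarrow> True"
| "MDeg a b c \<le> MInf \<longleftrightarrow> False"
| "MDeg a b c \<le> MDeg a' b' c' \<longleftrightarrow>
     a + b + c < a' + b' + c' \<or>
     a + b + c = a' + b' + c' \<and> (a < a' \<or> a = a' \<and> (b < b' \<or> b = b' \<and> c \<le> c'))"

definition less_mdeg :: "mdeg \<Rightarrow> mdeg \<Rightarrow> bool" where
  "d < e \<longleftrightarrow> d \<le> e \<and> \<not> e \<le> (d :: mdeg)"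

instance
proof
  fix x y z :: mdeg
  show "x < y \<longleftrightarrow> x \<le> y \<and> \<not> y \<le> x" by (rule less_mdeg_def)
  show "x \<le> x" by (cases x) auto
  show "x \<le> y \<Longrightarrow> y \<le> z \<Longrightarrow> x \<le> z" by (cases x; cases y; cases z) auto
  show "x \<le> y \<Longrightarrow> y \<le> x \<Longrightarrow> x = y" by (cases x; cases y) auto
  show "x \<le> y \<or> y \<le> x" by (cases x; cases y) auto
qed

end

instance mdeg :: wellorder
proof (intro_classes)
  fix P :: "mdeg \<Rightarrow> bool" and d
  assume step: "\<And>x. (\<And>y. y < x \<Longrightarrow> P y) \<Longrightarrow> P x"
  define r where "r = inv_image (less_than <*lex*> less_than <*lex*> less_than <*lex*> less_than)
    (case_mdeg (0, 0, 0, 0) (\<lambda>a b c. (Suc (a + b + c), a, b, c)))"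
  have wf: "wf r" unfolding r_def by (intro wf_inv_image wf_lex_prod wf_less_than)
  have lt: "(y, x) \<in> r" if "y < x" for x y :: mdeg
    using that by (cases x; cases y) (auto simp: r_def less_mdeg_def)
  show "P d"
    using wf by (induction d rule: wf_induct_rule) (use step lt in blast)
qed

instantiation mdeg :: ordered_comm_monoid_add
begin

definition zero_mdeg :: mdeg where "0 = MDeg 0 0 0"

fun plus_mdeg :: "mdeg \<Rightarrow> mdeg \<Rightarrow> mdeg" where
  "MInf + d = MInf"
| "MDeg a b c + MInf = MInf"
| "MDeg a b c + MDeg a' b' c' = MDeg (a + a') (b + b') (c + c')"

instance
proof
  fix x y z :: mdeg
  show "x + y + z = x + (y + z)" by (cases x; cases y; cases z) auto
  show "x + y = y + x" by (cases x; cases y) auto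
  show "0 + x = x" by (cases x) (auto simp: zero_mdeg_def)
  show "x \<le> y \<Longrightarrow> z + x \<le> z + y" by (cases x; cases y; cases z) auto
qed

end

text \<open>The weights of the four variables are \<open>(1,0,0)\<close>, \<open>(0,1,0)\<close>, \<open>(1,0,1)\<close>, \<open>(0,1,1)\<close>.\<close>

definition mon_deg :: "(4 \<Rightarrow>\<^sub>0 nat) \<Rightarrow> mdeg" where
  "mon_deg m = MDeg (Poly_Mapping.lookup m 1 + Poly_Mapping.lookup m 3) (Poly_Mapping.lookup m 2 + Poly_Mapping.lookup m 4) (Poly_Mapping.lookup m 3 + Poly_Mapping.lookup m 4)"

definition deg_C4 :: "4 cpoly \<Rightarrow> mdeg" where
  "deg_C4 g = (if g = 0 then MInf else Max (mon_deg ` Poly_Mapping.keys g))"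

definition deg_SL2 :: "(complex ^ 4 \<Rightarrow> complex) \<Rightarrow> mdeg" where
  "deg_SL2 f = (LEAST d. \<exists>g. restrict (cpoly_eval g) SL2 = f \<and> d = deg_C4 g)"

definition deg_aut :: "(complex ^ 4 \<Rightarrow> complex ^ 4) \<Rightarrow> mdeg" where
  "deg_aut F = (\<Sum>i\<in>UNIV. deg_SL2 (coord F i))"


section \<open>Elementary reductions\<close>

definition elem_reduction ::
  "(complex ^ 4 \<Rightarrow> complex ^ 4) \<Rightarrow> (complex ^ 4 \<Rightarrow> complex ^ 4) \<Rightarrow> bool" where
  "elem_reduction F F' \<longleftrightarrow> (\<exists>E\<in>elementary. F' = compose SL2 E F \<and> deg_aut F' < deg_aut F)"

definition reducible :: "(complex ^ 4 \<Rightarrow> complex ^ 4) set" where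
  "reducible = {F \<in> tame. \<exists>F'\<in>O4. elem_reduction\<^sup>*\<^sup>* F F'}"

end

theory Submission
  imports Defs
begin

text \<open>
  An automorphism \<open>F\<close> is regarded as a 2 by 2 matrix of regular functions \<open>f\<^sub>1, f\<^sub>2, f\<^sub>3, f\<^sub>4\<close> of determinant 1, on which
  elementary automorphisms act by row and column operations. The point is that the set of matrices reducible to
  linear ones by degree-lowering operations is stable under all elementary operations (\<open>reduces_estep\<close>). It is
  also stable under the orthogonal group, because orthogonal substitutions are products of operations
  with constant multipliers, rescalings and symmetries of the matrix (\<open>similitude_preserves_reducing\<close>); induction
  on a word in the generators then gives the theorem.

  Stability is proved by induction on the degree. Let \<open>E\<close> be an elementary operation and \<open>E'\<close> the first
  step of a sequence of reductions of \<open>F\<close>. If \<open>E\<close> raises the degree, its inverse is a reduction of \<open>E \<circ> F\<close>. If \<open>E\<close> and \<open>E'\<close> have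
  the same type, \<open>E \<circ> F\<close> arises from \<open>E' \<circ> F\<close> by an operation of that type. If they act on opposite rows or
  columns, the multipliers are constants and a computation with two rows suffices. If \<open>F\<close> is linear and has no first
  step, only constant multipliers do not raise the degree. The serious case
  is that \<open>E\<close> adds \<open>f\<^sub>1 u\<close> to \<open>f\<^sub>3\<close> with \<open>u \<in> \<complex>[f\<^sub>1, f\<^sub>2]\<close> and \<open>E'\<close> adds \<open>f\<^sub>1 h\<close> to \<open>f\<^sub>2\<close> with \<open>h \<in> \<complex>[f\<^sub>1, f\<^sub>3]\<close>. When \<open>u\<close> or \<open>h\<close> lies in \<open>\<complex>[f\<^sub>1]\<close>
  the two operations commute (\<open>reduces_estep_diamond\<close>). This can be arranged if the degree of \<open>f\<^sub>2\<close> or \<open>f\<^sub>3\<close> is a multiple of that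
  of \<open>f\<^sub>1\<close>, since subtracting a multiple of a power of \<open>f\<^sub>1\<close> is then a reduction. In the remaining case the key inequality
  (\<open>ldeg_subalg_gt\<close>) says that \<open>f\<^sub>1 h\<close> has larger degree than \<open>f\<^sub>3\<close> and \<open>f\<^sub>1 u\<close> larger degree than \<open>f\<^sub>2\<close>. But \<open>f\<^sub>1 h\<close> has the degree of \<open>f\<^sub>2\<close>,
  and \<open>f\<^sub>1 u\<close> at most the degree of \<open>f\<^sub>3\<close>: a contradiction.

  The key inequality bounds the cancellation in a polynomial expression in \<open>p\<close> and \<open>r\<close>. Solving for \<open>x\<^sub>4\<close> turns
  regular functions into Laurent polynomials whose monomials have distinct weights, so a leading term is
  determined by the degree up to a constant. The top-degree part of an expression is therefore governed by a
  complex polynomial in one variable, and cancellation means that the leading coefficient of \<open>r\<close>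
  is a root of it. The multiplicity of this root is the number of derivatives with respect to \<open>r\<close> after which the
  cancellation is gone. Each derivative is realised by a Jacobian bracket with \<open>p\<close>, which changes degrees
  in a controlled way; and the multiplicity is at most half the degree of the polynomial, because the exponents that
  occur lie in an arithmetic progression of step at least 2.
\<close>

section \<open>The degree on the group ring of an ordered group\<close>

text \<open>
  Elements of the group ring are finitely supported functions on an ordered abelian group; the degree is
  the largest exponent. The default value of \<open>ldeg 0\<close> is unspecified, so upper bounds are carried by
  \<open>below\<close>, which treats \<open>0\<close> correctly.
\<close>

definition below :: "('k::linorder \<Rightarrow>\<^sub>0 'a::zero) \<Rightarrow> 'k \<Rightarrow> bool" where
  "below f d \<longleftrightarrow> (\<forall>k\<in>Poly_Mapping.keys f. k \<le> d)"

definition ldeg :: "('k::linorder \<Rightarrow>\<^sub>0 'a::zero) \<Rightarrow> 'k" where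
  "ldeg f = Max (Poly_Mapping.keys f)"

definition const :: "'a \<Rightarrow> ('k::zero \<Rightarrow>\<^sub>0 'a::zero)" where
  "const c = Poly_Mapping.single 0 c"

lemma const_simps [simp]:
  "const (0::'a::comm_ring_1) = (0 :: 'k::comm_monoid_add \<Rightarrow>\<^sub>0 'a)"
  "const (1::'a) = (1 :: 'k \<Rightarrow>\<^sub>0 'a)"
  "const (a + b) = (const a + const b :: 'k \<Rightarrow>\<^sub>0 'a)"
  "const (a - b) = (const a - const b :: 'k \<Rightarrow>\<^sub>0 'a)"
  "const (- a) = (- const a :: 'k \<Rightarrow>\<^sub>0 'a)"
  "const (a * b) = (const a * const b :: 'k \<Rightarrow>\<^sub>0 'a)"
  "const (a ^ n) = (const a ^ n :: 'k \<Rightarrow>\<^sub>0 'a)"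
proof -
  show m: "const (a * b) = (const a * const b :: 'k \<Rightarrow>\<^sub>0 'a)" for a b
    by (simp add: const_def mult_single)
  show o: "const (1::'a) = (1 :: 'k \<Rightarrow>\<^sub>0 'a)" by (simp add: const_def)
  show "const (a ^ n) = (const a ^ n :: 'k \<Rightarrow>\<^sub>0 'a)"
    by (induction n) (simp_all add: o m)
qed (simp_all add: const_def single_add single_diff single_uminus)

lemma const_eq_iff [simp]: "const a = const b \<longleftrightarrow> a = b"
  by (metis const_def lookup_single_eq)

lemma const_eq_0_iff [simp]: "const a = (0 :: 'k::comm_monoid_add \<Rightarrow>\<^sub>0 'a::comm_ring_1) \<longleftrightarrow> a = 0"
  by (metis const_eq_iff const_simps(1))

lemma const_mult_eq_iff: "const a * const b = (1 :: 'k::comm_monoid_add \<Rightarrow>\<^sub>0 'a::comm_ring_1) \<longleftrightarrow> a * b = 1"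
  by (metis const_eq_iff const_simps(2) const_simps(6))

lemma poly_mapping_single_induct [case_names zero single add]:
  assumes "P 0" "\<And>m c. P (Poly_Mapping.single m c)"
    and "\<And>p q. P p \<Longrightarrow> P q \<Longrightarrow> P (p + q)"
  shows "P (p :: 'k \<Rightarrow>\<^sub>0 'a::monoid_add)"
proof (induction p rule: update_induct)
  case (update f m c)
  have "Poly_Mapping.update m c f = f + Poly_Mapping.single m c"
    using update by (intro poly_mapping_eqI)
      (auto simp: lookup_update lookup_add lookup_single when_def in_keys_iff)
  then show ?case using assms(2,3) update by metis
qed (fact assms(1))

lemma below_ldeg: "f \<noteq> 0 \<Longrightarrow> below f (ldeg f)"
  by (simp add: below_def ldeg_def)

lemma lookup_ldeg: "f \<noteq> 0 \<Longrightarrow> Poly_Mapping.lookup f (ldeg f) \<noteq> 0"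
  unfolding ldeg_def using Max_in[of "Poly_Mapping.keys f"] by (simp add: in_keys_iff)

lemma ldeg_eqI:
  assumes "below f d" "Poly_Mapping.lookup f d \<noteq> 0"
  shows "f \<noteq> 0" "ldeg f = d"
proof -
  show "f \<noteq> 0" using assms(2) by auto
  show "ldeg f = d"
    unfolding ldeg_def using assms by (intro Max_eqI) (simp_all add: below_def in_keys_iff)
qed

lemma ldeg_ge: "Poly_Mapping.lookup f d \<noteq> 0 \<Longrightarrow> d \<le> ldeg f"
  by (simp add: ldeg_def in_keys_iff)

lemma below_imp_ldeg_le: "below f d \<Longrightarrow> f \<noteq> 0 \<Longrightarrow> ldeg f \<le> d"
  by (simp add: below_def ldeg_def)

lemma ldeg_le_imp_below: "ldeg f \<le> d \<Longrightarrow> below f d"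
  unfolding below_def ldeg_def by (metis Max_ge finite_keys order.trans)

lemma below_add: "below f d \<Longrightarrow> below g d \<Longrightarrow> below (f + g) d"
  unfolding below_def using keys_add[of f g] by blast

lemma below_diff: "below (f :: 'k::linorder \<Rightarrow>\<^sub>0 'a::ab_group_add) d \<Longrightarrow> below g d \<Longrightarrow> below (f - g) d"
  using below_add[of f d "- g"] by (simp add: below_def)

lemma below_0 [simp]: "below 0 d"
  by (simp add: below_def)

lemma below_mono: "below f d \<Longrightarrow> d \<le> e \<Longrightarrow> below f e"
  by (auto simp: below_def)

lemma below_single: "k \<le> d \<Longrightarrow> below (Poly_Mapping.single k c) d"
  by (auto simp: below_def)

lemma below_mult:
  fixes f g :: "'k::linordered_ab_group_add \<Rightarrow>\<^sub>0 'a::comm_ring_1"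
  assumes "below f a" "below g b"
  shows "below (f * g) (a + b)"
  unfolding below_def
proof
  fix k assume "k \<in> Poly_Mapping.keys (f * g)"
  then obtain l m where "k = l + m" "l \<in> Poly_Mapping.keys f" "m \<in> Poly_Mapping.keys g"
    using keys_mult[of f g] by blast
  then show "k \<le> a + b" using assms by (auto simp: below_def intro: add_mono)
qed

lemma lookup_mult_single:
  fixes g :: "'k::ab_group_add \<Rightarrow>\<^sub>0 'a::comm_ring_1"
  shows "Poly_Mapping.lookup (Poly_Mapping.single k c * g) l = c * Poly_Mapping.lookup g (l - k)"
proof (induction g rule: poly_mapping_single_induct)
  case (single m d)
  have "k + m = l \<longleftrightarrow> m = l - k" by (auto simp: eq_diff_eq add.commute)
  then show ?case by (auto simp: mult_single lookup_single when_def)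
qed (simp_all add: lookup_add distrib_left)

text \<open>
  The coefficient at the sum of two upper bounds only sees the two top coefficients. This is what makes
  the degree additive and the leading coefficient multiplicative.
\<close>

lemma lookup_mult_top:
  fixes f g :: "'k::linordered_ab_group_add \<Rightarrow>\<^sub>0 'a::comm_ring_1"
  assumes "below f a" "below g b"
  shows "Poly_Mapping.lookup (f * g) (a + b) = Poly_Mapping.lookup f a * Poly_Mapping.lookup g b"
proof -
  define f' where "f' = f - Poly_Mapping.single a (Poly_Mapping.lookup f a)"
  have f': "k < a" if "k \<in> Poly_Mapping.keys f'" for k
    using that assms(1) unfolding f'_def below_def
    by (cases "k = a") (auto simp: in_keys_iff lookup_minus lookup_single when_def order_less_le)
  have "Poly_Mapping.lookup (f' * g) (a + b) = 0"
  proof (rule ccontr)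
    assume "\<not> ?thesis"
    then have "a + b \<in> Poly_Mapping.keys (f' * g)" by (simp add: in_keys_iff)
    then obtain k l where "k \<in> Poly_Mapping.keys f'" "l \<in> Poly_Mapping.keys g" "a + b = k + l"
      using keys_mult[of f' g] by auto
    then show False
      using f' assms(2) add_less_le_mono[of k a l b] by (auto simp: below_def)
  qed
  moreover have "f * g = Poly_Mapping.single a (Poly_Mapping.lookup f a) * g + f' * g"
    by (simp add: f'_def algebra_simps)
  ultimately show ?thesis by (simp add: lookup_add lookup_mult_single)
qed

lemma ldeg_mult:
  fixes f g :: "'k::linordered_ab_group_add \<Rightarrow>\<^sub>0 'a::idom"
  assumes "f \<noteq> 0" "g \<noteq> 0"
  shows "ldeg (f * g) = ldeg f + ldeg g"
  using assms by (intro ldeg_eqI) (simp_all add: below_mult below_ldeg lookup_mult_top lookup_ldeg)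

lemma below_power:
  fixes f :: "'k::linordered_idom \<Rightarrow>\<^sub>0 'a::comm_ring_1"
  assumes "below f a"
  shows "below (f ^ n) (of_nat n * a)" "Poly_Mapping.lookup (f ^ n) (of_nat n * a) = Poly_Mapping.lookup f a ^ n"
proof -
  have "below (f ^ n) (of_nat n * a) \<and> Poly_Mapping.lookup (f ^ n) (of_nat n * a) = Poly_Mapping.lookup f a ^ n"
  proof (induction n)
    case 0
    show ?case by (auto simp: below_def lookup_one)
  next
    case (Suc n)
    then show ?case
      using below_mult[OF assms, of "f ^ n" "of_nat n * a"] lookup_mult_top[OF assms, of "f ^ n" "of_nat n * a"]
      by (simp add: algebra_simps)
  qed
  then show "below (f ^ n) (of_nat n * a)" "Poly_Mapping.lookup (f ^ n) (of_nat n * a) = Poly_Mapping.lookup f a ^ n"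
    by auto
qed

lemma ldeg_power:
  fixes f :: "'k::linordered_idom \<Rightarrow>\<^sub>0 'a::idom"
  assumes "f \<noteq> 0"
  shows "ldeg (f ^ n) = of_nat n * ldeg f"
proof (rule ldeg_eqI(2))
  show "below (f ^ n) (of_nat n * ldeg f)"
    by (rule below_power) (rule below_ldeg[OF assms])
  show "Poly_Mapping.lookup (f ^ n) (of_nat n * ldeg f) \<noteq> 0"
    unfolding below_power(2)[OF below_ldeg[OF assms]] using lookup_ldeg[OF assms] by simp
qed

lemma ldeg_const [simp]: "c \<noteq> 0 \<Longrightarrow> ldeg (const c) = 0"
  by (simp add: ldeg_def const_def)

lemma below_const_mult:
  "below f d \<Longrightarrow> below (const c * f) d" for f :: "'k::linordered_ab_group_add \<Rightarrow>\<^sub>0 'a::comm_ring_1"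
  using below_mult[OF below_single[of 0 0 c], of f d] unfolding const_def by simp

lemma lookup_const_mult [simp]:
  fixes f :: "'k::ab_group_add \<Rightarrow>\<^sub>0 'a::comm_ring_1"
  shows "Poly_Mapping.lookup (const c * f) d = c * Poly_Mapping.lookup f d"
  by (simp add: const_def lookup_mult_single)

lemma ldeg_const_mult [simp]:
  fixes f :: "'k::linordered_ab_group_add \<Rightarrow>\<^sub>0 'a::idom"
  assumes "c \<noteq> 0"
  shows "ldeg (const c * f) = ldeg f"
proof (cases "f = 0")
  case False
  then show ?thesis using assms by (subst ldeg_mult) simp_all
qed simp

lemma ldeg_add_eq:
  fixes f g :: "'k::linordered_ab_group_add \<Rightarrow>\<^sub>0 'a::idom"
  assumes "f \<noteq> 0" "ldeg g < ldeg f \<or> g = 0"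
  shows "f + g \<noteq> 0" "ldeg (f + g) = ldeg f"
proof -
  have g1: "below g (ldeg f)" using assms(2) by (elim disjE) (simp_all add: ldeg_le_imp_below)
  have g2: "Poly_Mapping.lookup g (ldeg f) = 0"
    using assms(2) ldeg_ge[of g "ldeg f"] by (metis leD lookup_zero)
  have "below (f + g) (ldeg f)" using assms(1) g1 by (simp add: below_add below_ldeg)
  moreover have "Poly_Mapping.lookup (f + g) (ldeg f) \<noteq> 0"
    using assms(1) g2 by (simp add: lookup_add lookup_ldeg)
  ultimately show "f + g \<noteq> 0" "ldeg (f + g) = ldeg f"
    by (fact ldeg_eqI)+
qed

text \<open>
  Every degree carries a single leading monomial, so two elements of the same degree have proportional
  leading terms. All cancellation arguments below rest on this.
\<close>

lemma ldeg_cancel: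
  fixes f g :: "'k::linordered_ab_group_add \<Rightarrow>\<^sub>0 'a::field"
  assumes "f \<noteq> 0" "g \<noteq> 0" "ldeg f = ldeg g"
  obtains c where "c \<noteq> 0" "f - const c * g = 0 \<or> ldeg (f - const c * g) < ldeg f"
proof -
  define c where "c = Poly_Mapping.lookup f (ldeg f) / Poly_Mapping.lookup g (ldeg g)"
  let ?h = "f - const c * g"
  have c: "c \<noteq> 0" using assms lookup_ldeg[of f] lookup_ldeg[of g] by (simp add: c_def)
  have b: "below ?h (ldeg f)"
    using below_ldeg[OF assms(1)] below_ldeg[OF assms(2)] assms(3)
    by (auto intro!: below_diff below_const_mult)
  have z: "Poly_Mapping.lookup ?h (ldeg f) = 0"
    using assms lookup_ldeg[OF assms(2)] by (simp add: c_def lookup_minus)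
  have "ldeg ?h < ldeg f" if "?h \<noteq> 0"
    using below_imp_ldeg_le[OF b that] lookup_ldeg[OF that] z by (metis order_less_le)
  then show ?thesis using that c by blast
qed

section \<open>Degree bounds for polynomial expressions under cancellation\<close>

text \<open>
  If the exponents of \<open>t\<close> are congruent modulo \<open>s\<close>, then replacing \<open>X\<close> by \<open>z X\<close> for an \<open>s\<close>-th root of
  unity \<open>z \<noteq> 1\<close> only multiplies \<open>t\<close> by a constant. Hence \<open>b / z\<close> is a root of the same multiplicity as \<open>b\<close>,
  and the two roots together use up at most the degree.
\<close>

lemma order_le_half_degree:
  fixes t :: "complex poly"
  assumes t: "t \<noteq> 0" and b: "b \<noteq> 0" and s: "s \<ge> 2"
    and supp: "\<And>i j. coeff t i \<noteq> 0 \<Longrightarrow> coeff t j \<noteq> 0 \<Longrightarrow> i mod s = j mod s"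
  shows "2 * Polynomial.order b t \<le> degree t"
proof -
  define n where "n = Polynomial.order b t"
  define z where "z = cis (2 * pi / s)"
  define c where "c = b / z"
  have zs: "z ^ s = 1" using s by (simp add: z_def DeMoivre)
  have z0: "z \<noteq> 0" by (simp add: z_def)
  have "z \<noteq> 1"
  proof
    assume "z = 1"
    then have "cos (2 * pi / s) = 1" by (simp add: z_def cis.ctr complex_eq_iff)
    then obtain k :: int where k: "2 * pi / s = of_int k * 2 * pi" unfolding cos_one_2pi_int by auto
    then have "1 = of_int k * real s" using s by (simp add: field_simps)
    then have "1 = k * int s" by (metis of_int_eq_iff of_int_1 of_int_mult of_int_of_nat_eq)
    then have "int s dvd 1" by (metis dvd_triv_right)
    then show False using s by simp
  qed
  then have cb: "c \<noteq> b" using b z0 by (simp add: c_def field_simps)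
  have zmod: "z ^ i = z ^ (i mod s)" for i
  proof -
    have "z ^ i = z ^ (s * (i div s) + i mod s)" by simp
    also have "\<dots> = (z ^ s) ^ (i div s) * z ^ (i mod s)" by (simp only: power_add power_mult)
    finally show ?thesis by (simp add: zs)
  qed
  have "z ^ i * coeff t i = z ^ (degree t) * coeff t i" for i
  proof (cases "coeff t i = 0")
    case False
    moreover have "coeff t (degree t) \<noteq> 0" using t by simp
    ultimately have "i mod s = degree t mod s" by (rule supp)
    then show ?thesis using zmod[of i] zmod[of "degree t"] by simp
  qed simp
  then have tz: "pcompose t [:0, z:] = smult (z ^ degree t) t"
    by (intro poly_eqI) (simp add: coeff_pcompose_linear)
  obtain u where u: "t = [:- b, 1:] ^ n * u"
    using order_1[of b t] unfolding n_def by (elim dvdE)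
  have "[:- b, z:] ^ n dvd smult (z ^ degree t) t"
  proof -
    have pw: "pcompose (p ^ k) x = pcompose p x ^ k" for p x :: "complex poly" and k
      by (induction k) (simp_all add: pcompose_mult pcompose_1)
    have "pcompose t [:0, z:] = pcompose [:- b, 1:] [:0, z:] ^ n * pcompose u [:0, z:]"
      by (subst u) (simp add: pcompose_mult pw)
    then show ?thesis unfolding tz by (simp add: pcompose_pCons)
  qed
  moreover have "[:- b, z:] = smult z [:- c, 1:]" using z0 by (simp add: c_def)
  then have "[:- b, z:] ^ n = smult (z ^ n) ([:- c, 1:] ^ n)" by (simp only: smult_power)
  ultimately have "[:- c, 1:] ^ n dvd t"
    using z0 by (simp add: smult_dvd_iff dvd_smult_iff del: smult_power)
  then have "n \<le> Polynomial.order c t" using t by (simp add: order_divides)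
  also have "\<dots> = Polynomial.order c ([:- b, 1:] ^ n) + Polynomial.order c u"
    using t unfolding u by (rule order_mult)
  also have "Polynomial.order c ([:- b, 1:] ^ n) = 0"
    using cb by (intro order_0I) (simp add: poly_power)
  finally have "n \<le> degree u"
    using order_degree[of u c] t u by force
  moreover have "degree t = n + degree u"
    using t u by (simp add: degree_mult_eq degree_power_eq)
  ultimately show ?thesis by (simp add: n_def)
qed

lemma lookup_of_nat_mult:
  fixes f :: "'k::ab_group_add \<Rightarrow>\<^sub>0 'a::comm_ring_1"
  shows "Poly_Mapping.lookup (of_nat n * f) d = of_nat n * Poly_Mapping.lookup f d"
  by (induction n) (simp_all add: lookup_add algebra_simps)

text \<open>
  Give \<open>r\<close> the weight \<open>Q\<close>. When the terms of \<open>poly H r\<close> have weight at most \<open>W\<close>, the coefficient at \<open>W\<close> is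
  obtained by substituting the leading coefficient of \<open>r\<close> in this complex polynomial, so cancellation of
  the leading terms means that this number is a root.
\<close>

definition lead_form :: "('k::linordered_idom \<Rightarrow>\<^sub>0 complex) poly \<Rightarrow> 'k \<Rightarrow> 'k \<Rightarrow> complex poly" where
  "lead_form H Q W = (\<Sum>j\<le>degree H. monom (Poly_Mapping.lookup (coeff H j) (W - of_nat j * Q)) j)"

lemma coeff_lead_form: "coeff (lead_form H Q W) j = Poly_Mapping.lookup (coeff H j) (W - of_nat j * Q)"
  by (cases "j \<le> degree H") (auto simp: lead_form_def coeff_sum coeff_eq_0)

text \<open>
  Differentiating with respect to \<open>r\<close> lowers the multiplicity of that root by one at each step, until the
  degree is the expected one.
\<close>

lemma lead_form_pderiv: "lead_form (pderiv H) Q (W - Q) = pderiv (lead_form H Q W)"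
  by (intro poly_eqI) (simp only: coeff_lead_form coeff_pderiv lookup_of_nat_mult, simp add: algebra_simps)

definition weight_le :: "('k::linordered_idom \<Rightarrow>\<^sub>0 complex) poly \<Rightarrow> 'k \<Rightarrow> 'k \<Rightarrow> bool" where
  "weight_le H Q W \<longleftrightarrow> (\<forall>j. below (coeff H j) (W - of_nat j * Q))"

lemma weight_le_pderiv:
  assumes "weight_le H Q W"
  shows "weight_le (pderiv H) Q (W - Q)"
  unfolding weight_le_def
proof
  fix j
  have "below (coeff H (Suc j)) (W - of_nat (Suc j) * Q)"
    using assms by (simp only: weight_le_def)
  then have "below (of_nat (Suc j) * coeff H (Suc j)) (W - of_nat (Suc j) * Q)"
    unfolding below_def by (simp only: Ball_def in_keys_iff lookup_of_nat_mult) (metis mult_zero_right)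
  then show "below (coeff (pderiv H) j) (W - Q - of_nat j * Q)"
    unfolding coeff_pderiv by (simp add: algebra_simps)
qed

lemma lookup_poly_top:
  fixes r :: "'k::linordered_idom \<Rightarrow>\<^sub>0 complex"
  assumes "weight_le H Q W" "below r Q"
  shows "Poly_Mapping.lookup (poly H r) W = poly (lead_form H Q W) (Poly_Mapping.lookup r Q)"
proof -
  have summand: "Poly_Mapping.lookup (coeff H j * r ^ j) W = coeff (lead_form H Q W) j * Poly_Mapping.lookup r Q ^ j" for j
  proof -
    have "Poly_Mapping.lookup (coeff H j * r ^ j) ((W - of_nat j * Q) + of_nat j * Q)
        = Poly_Mapping.lookup (coeff H j) (W - of_nat j * Q) * Poly_Mapping.lookup (r ^ j) (of_nat j * Q)"
      using assms by (intro lookup_mult_top) (auto simp: weight_le_def below_power)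
    then show ?thesis using assms(2) by (simp add: coeff_lead_form below_power)
  qed
  have "degree (lead_form H Q W) \<le> degree H"
    by (intro degree_le) (simp add: coeff_lead_form coeff_eq_0)
  then have "poly (lead_form H Q W) x = (\<Sum>j\<le>degree H. coeff (lead_form H Q W) j * x ^ j)" for x
    unfolding poly_altdef[of "lead_form H Q W"] by (intro sum.mono_neutral_left) (auto simp: coeff_eq_0)
  then show ?thesis by (simp add: poly_altdef[of H] lookup_sum summand)
qed

lemma derivation_poly:
  fixes D :: "'a::idom \<Rightarrow> 'a"
  assumes add: "\<And>f g. D (f + g) = D f + D g" and mult: "\<And>f g. D (f * g) = f * D g + D f * g"
    and coeffs: "\<And>j. D (coeff H j) = 0"
  shows "D (poly H r) = poly (pderiv H) r * D r"
  using coeffs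
proof (induction H)
  case 0
  have "D 0 = 0" using add[of 0 0] by (metis add.right_neutral add_left_cancel)
  then show ?case by simp
next
  case (pCons a H)
  have "D a = 0" "\<And>j. D (coeff H j) = 0"
    using pCons.prems[of 0] pCons.prems[of "Suc _"] by simp_all
  then show ?case using pCons.IH by (simp add: add mult pderiv_pCons algebra_simps)
qed

text \<open>
  Here \<open>n\<close> counts the differentiations needed to remove the cancellation. Since
  \<open>D (poly H r) = poly (pderiv H) r * D r\<close> and \<open>D\<close> raises degrees by at most \<open>P - e\<close>, each of them costs at
  most \<open>P - e\<close>, and it lowers the weight by the degree of \<open>r\<close>.
\<close>

lemma ldeg_poly_ge_order:
  fixes r :: "'k::linordered_idom \<Rightarrow>\<^sub>0 complex"
  assumes add: "\<And>f g. D (f + g) = D f + D g" and mult: "\<And>f g. D (f * g) = f * D g + D f * g"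
    and bound: "\<And>f. D f \<noteq> 0 \<Longrightarrow> ldeg (D f) + e \<le> P + ldeg f"
    and r: "D r \<noteq> 0" "0 \<le> ldeg (D r)" "r \<noteq> 0"
    and "weight_le H (ldeg r) W" "\<And>j. D (coeff H j) = 0"
    and "lead_form H (ldeg r) W \<noteq> 0"
    and "Polynomial.order (Poly_Mapping.lookup r (ldeg r)) (lead_form H (ldeg r) W) = n"
  shows "poly H r \<noteq> 0 \<and> W \<le> ldeg (poly H r) + of_nat n * (ldeg r + P - e)"
  using assms(7-)
proof (induction n arbitrary: H W)
  case 0
  then have "poly (lead_form H (ldeg r) W) (Poly_Mapping.lookup r (ldeg r)) \<noteq> 0"
    using order_root by blast
  then have "Poly_Mapping.lookup (poly H r) W \<noteq> 0"
    using lookup_poly_top[OF 0(1) below_ldeg[OF r(3)]] by simp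
  then show ?case using ldeg_ge by fastforce
next
  case (Suc n)
  let ?b = "Poly_Mapping.lookup r (ldeg r)" and ?Q = "ldeg r"
  have D0: "D 0 = 0" using add[of 0 0] by simp
  have Dn: "D (of_nat m * f) = of_nat m * D f" for m f
    by (induction m) (simp_all add: D0 add algebra_simps)
  have t: "pderiv (lead_form H ?Q W) \<noteq> 0"
  proof
    assume "pderiv (lead_form H ?Q W) = 0"
    then have "degree (lead_form H ?Q W) = 0" by (simp add: pderiv_eq_0_iff)
    then show False using order_degree[OF Suc.prems(3)] Suc.prems(4) by (metis Suc_n_not_le_n le_0_eq not_less_eq_eq zero_le)
  qed
  have "Polynomial.order ?b (pderiv (lead_form H ?Q W)) = n"
    using order_pderiv[OF Suc.prems(3), of ?b] order_root[of "lead_form H ?Q W" ?b] Suc.prems(4) by simp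
  then have IH: "poly (pderiv H) r \<noteq> 0" "W - ?Q \<le> ldeg (poly (pderiv H) r) + of_nat n * (?Q + P - e)"
    using Suc.IH[of "pderiv H" "W - ?Q"] weight_le_pderiv[OF Suc.prems(1)] t Suc.prems(2)
    unfolding lead_form_pderiv by (simp_all only: coeff_pderiv Dn mult_zero_right simp_thms)
  have eq: "D (poly H r) = poly (pderiv H) r * D r"
    by (rule derivation_poly) (fact add mult Suc.prems(2))+
  then have nz: "D (poly H r) \<noteq> 0" using IH(1) r(1) by simp
  then have "poly H r \<noteq> 0" using D0 by auto
  moreover have "ldeg (poly (pderiv H) r) + ldeg (D r) + e \<le> P + ldeg (poly H r)"
    using bound[OF nz] unfolding eq ldeg_mult[OF IH(1) r(1)] .
  then have "W \<le> ldeg (poly H r) + of_nat (Suc n) * (?Q + P - e)"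
    using IH(2) r(2) by (simp add: algebra_simps)
  ultimately show ?case by blast
qed

text \<open>
  The key inequality. Without cancellation a polynomial of positive degree in \<open>r\<close> has degree at least that
  of \<open>r\<close>. With cancellation, let \<open>n\<close> be the multiplicity of the root. The exponents of the leading form
  satisfy \<open>(j - j') Q \<in> \<int> P\<close>, where \<open>Q\<close> is the degree of \<open>r\<close>; as \<open>Q\<close> is not a multiple of \<open>P\<close>, they are
  congruent modulo some \<open>d \<ge> 2\<close>, hence \<open>2 * n\<close> is at most the degree of the leading form and the weight
  is at least \<open>2 * n * Q\<close>. Losing \<open>n (Q + P - e)\<close> leaves at least \<open>n (Q - P + e)\<close>, and \<open>P\<close> more exceeds \<open>Q\<close>.
\<close>

theorem ldeg_poly_gt:
  fixes r :: "'k::linordered_idom \<Rightarrow>\<^sub>0 complex"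
  assumes add: "\<And>f g. D (f + g) = D f + D g" and mult: "\<And>f g. D (f * g) = f * D g + D f * g"
    and bound: "\<And>f. D f \<noteq> 0 \<Longrightarrow> ldeg (D f) + e \<le> P + ldeg f" and e: "0 < e"
    and r: "D r \<noteq> 0" "0 \<le> ldeg (D r)" "r \<noteq> 0"
    and P: "0 < P" "P \<le> ldeg r" "\<And>k. ldeg r \<noteq> of_nat k * P"
    and H: "\<And>j. D (coeff H j) = 0" "\<And>j. coeff H j \<noteq> 0 \<Longrightarrow> \<exists>k. ldeg (coeff H j) = of_nat k * P"
    and deg: "degree H > 0"
  shows "poly H r \<noteq> 0 \<and> ldeg r < P + ldeg (poly H r)"
proof -
  let ?Q = "ldeg r"
  let ?w = "\<lambda>j. ldeg (coeff H j) + of_nat j * ?Q"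
  define J where "J = {j. coeff H j \<noteq> 0}"
  have "J \<subseteq> {..degree H}" by (auto simp: J_def le_degree)
  then have fJ: "finite J" by (rule finite_subset) simp
  have dJ: "degree H \<in> J" using deg by (auto simp: J_def)
  define W where "W = Max (?w ` J)"
  have Wge: "?w j \<le> W" if "j \<in> J" for j unfolding W_def using fJ that by simp
  have "W \<in> ?w ` J" unfolding W_def using fJ dJ by (intro Max_in) auto
  then obtain j1 where j1: "j1 \<in> J" "W = ?w j1" by blast
  have wle: "weight_le H ?Q W"
    unfolding weight_le_def
  proof
    fix j
    show "below (coeff H j) (W - of_nat j * ?Q)"
    proof (cases "j \<in> J")
      case True
      then have "ldeg (coeff H j) \<le> W - of_nat j * ?Q" using Wge[of j] by (simp add: algebra_simps)
      then show ?thesis by (rule ldeg_le_imp_below)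
    qed (simp add: J_def)
  qed
  define t where "t = lead_form H ?Q W"
  have supp: "\<exists>k. W - of_nat j * ?Q = of_nat k * P" if "coeff t j \<noteq> 0" for j
  proof -
    have l: "Poly_Mapping.lookup (coeff H j) (W - of_nat j * ?Q) \<noteq> 0"
      using that by (simp add: t_def coeff_lead_form)
    then have "W - of_nat j * ?Q \<le> ldeg (coeff H j)" "coeff H j \<noteq> 0"
      by (auto intro: ldeg_ge)
    moreover have "ldeg (coeff H j) \<le> W - of_nat j * ?Q"
      using wle \<open>coeff H j \<noteq> 0\<close> below_imp_ldeg_le by (auto simp: weight_le_def)
    ultimately show ?thesis using H(2)[of j] by auto
  qed
  have "coeff t j1 \<noteq> 0" using j1 by (simp add: t_def coeff_lead_form J_def lookup_ldeg)
  then have t: "t \<noteq> 0" by auto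
  define b where "b = Poly_Mapping.lookup r ?Q"
  have b: "b \<noteq> 0" using lookup_ldeg[OF r(3)] by (simp add: b_def)
  define n where "n = Polynomial.order b t"
  have main: "poly H r \<noteq> 0" "W \<le> ldeg (poly H r) + of_nat n * (?Q + P - e)"
    using ldeg_poly_ge_order[OF add mult bound r wle H(1) t[unfolded t_def], of n]
    by (simp_all add: n_def b_def t_def)
  have Qpos: "0 < ?Q" using P by simp
  show ?thesis
  proof (cases "n = 0")
    case True
    have "\<exists>k. ldeg (coeff H (degree H)) = of_nat k * P"
      using H(2)[of "degree H"] dJ unfolding J_def by blast
    then have "0 \<le> ldeg (coeff H (degree H))" using P(1) by auto
    moreover have "1 * ?Q \<le> of_nat (degree H) * ?Q"
      using deg Qpos by (intro mult_right_mono) (auto simp: Suc_le_eq)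
    ultimately have "?Q \<le> W" using Wge[OF dJ] by simp
    then show ?thesis using main True P(1) by auto
  next
    case False
    have "\<exists>j2. coeff t j2 \<noteq> 0 \<and> j2 \<noteq> j1"
    proof (rule ccontr)
      assume "\<not> ?thesis"
      then have "t = monom (coeff t j1) j1" by (intro poly_eqI) auto
      then have "poly t b = coeff t j1 * b ^ j1" by (metis poly_monom)
      then have "poly t b \<noteq> 0" using \<open>coeff t j1 \<noteq> 0\<close> b by simp
      then show False using False by (simp add: n_def order_0I)
    qed
    then obtain i j where ij: "coeff t i \<noteq> 0" "coeff t j \<noteq> 0" "i < j"
      using \<open>coeff t j1 \<noteq> 0\<close> by (metis linorder_neqE_nat)
    obtain k l where kl: "W - of_nat i * ?Q = of_nat k * P" "W - of_nat j * ?Q = of_nat l * P"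
      using supp ij by blast
    \<comment> \<open>In lowest terms the proportion reads \<open>d Q = m P\<close>; the denominator \<open>d\<close> cannot be 1.\<close>
    define d m where "d = (j - i) div gcd (j - i) (k - l)" and "m = (k - l) div gcd (j - i) (k - l)"
    have eq1: "of_nat (j - i) * ?Q = of_int (int k - int l) * P"
      using kl ij(3) by (simp add: of_nat_diff algebra_simps)
    have "l < k"
    proof (rule ccontr)
      assume "\<not> l < k"
      then have "of_int (int k - int l) * P \<le> 0" using P(1) by (intro mult_nonpos_nonneg) auto
      moreover have "0 < of_nat (j - i) * ?Q" using ij(3) Qpos by simp
      ultimately show False using eq1 by simp
    qed
    then have eq2: "of_nat (j - i) * ?Q = of_nat (k - l) * P"
      using eq1 by (simp add: of_nat_diff)
    have cop: "coprime d m" using ij(3) by (auto simp: d_def m_def intro: div_gcd_coprime)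
    define g where "g = gcd (j - i) (k - l)"
    have g: "j - i = g * d" "k - l = g * m" "g \<noteq> 0"
      using ij(3) by (simp_all add: d_def m_def g_def)
    then have eq3: "of_nat d * ?Q = of_nat m * P"
      using eq2 by (simp add: mult.assoc)
    have "d \<noteq> 0" using g(1) ij(3) by (cases "d = 0") auto
    moreover have "d \<noteq> 1" using eq3 P(3)[of m] by auto
    ultimately have d2: "d \<ge> 2" by simp
    have "i' mod d = j' mod d" if ij': "coeff t i' \<noteq> 0" "coeff t j' \<noteq> 0" for i' j'
    proof -
      obtain k' l' where kl': "W - of_nat i' * ?Q = of_nat k' * P" "W - of_nat j' * ?Q = of_nat l' * P"
        using supp ij' by blast
      have "(of_int (int j' - int i') :: 'k) * ?Q = of_int (int k' - int l') * P"
        using kl' by (simp add: algebra_simps)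
      then have "of_int (int j' - int i') * (of_nat d * ?Q) = of_int (int d * (int k' - int l')) * P"
        by (metis (no_types, lifting) mult.assoc mult.commute of_int_mult of_int_of_nat_eq)
      then have "of_int ((int j' - int i') * int m) * P = of_int (int d * (int k' - int l')) * P"
        unfolding eq3 by (simp add: mult.assoc)
      then have "(of_int ((int j' - int i') * int m) :: 'k) = of_int (int d * (int k' - int l'))"
        using P(1) by (metis mult_right_cancel order_less_irrefl)
      then have "(int j' - int i') * int m = int d * (int k' - int l')"
        by (simp only: of_int_eq_iff)
      then have "int d dvd (int j' - int i') * int m" by simp
      then have "int d dvd int j' - int i'"
        using cop by (simp add: coprime_dvd_mult_left_iff)
      then have "int j' mod int d = int i' mod int d" by (simp add: mod_eq_dvd_iff)
      then show ?thesis by (metis of_nat_eq_iff zmod_int)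
    qed
    then have half: "2 * n \<le> degree t"
      unfolding n_def using order_le_half_degree[OF t b d2] by blast
    have "\<exists>k. W - of_nat (degree t) * ?Q = of_nat k * P" using t by (intro supp) simp
    then obtain k where k: "W - of_nat (degree t) * ?Q = of_nat k * P" by blast
    have "0 \<le> W - of_nat (degree t) * ?Q" unfolding k using P(1) by simp
    moreover have "of_nat (2 * n) * ?Q \<le> of_nat (degree t) * ?Q"
      using half Qpos by (intro mult_right_mono) (simp_all only: of_nat_le_iff order_less_imp_le)
    ultimately have W2: "of_nat (2 * n) * ?Q \<le> W" by simp
    have "1 * (?Q - P + e) \<le> of_nat n * (?Q - P + e)"
      using False P(2) e by (intro mult_right_mono) auto
    then have "?Q < P + ldeg (poly H r)"
      using main(2) W2 e by (simp add: algebra_simps)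
    then show ?thesis using main(1) by blast
  qed
qed

section \<open>Laurent expansions of regular functions\<close>

text \<open>
  On the open set \<open>x\<^sub>1 \<noteq> 0\<close> one has \<open>x\<^sub>4 = (1 + x\<^sub>2 x\<^sub>3) / x\<^sub>1\<close>, so a regular function is a Laurent polynomial in
  \<open>x\<^sub>1, x\<^sub>2, x\<^sub>3\<close>. The weights of these three variables are linearly independent, and \<open>x\<^sub>2 x\<^sub>3 / x\<^sub>1\<close> has the weight of
  \<open>x\<^sub>4\<close>. So Laurent monomials can be indexed by their weights, and the degree of a regular function turns out
  to be the largest weight in its expansion. The ordered group of weights is realised inside the integer
  polynomials ordered by the sign of the leading coefficient: \<open>(a, b, c)\<close> becomes
  \<open>(a + b + c) X\<^sup>2 + a X + b\<close>, and the order becomes the graded lexicographic one. The value \<open>-1\<close> for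
  \<open>MInf\<close> lies below all of these.
\<close>

type_synonym laurent = "int poly \<Rightarrow>\<^sub>0 complex"

fun mdeg_poly :: "mdeg \<Rightarrow> int poly" where
  "mdeg_poly MInf = -1"
| "mdeg_poly (MDeg a b c) = [:int b, int a, int (a + b + c):]"

lemma pCons3_le_iff:
  "[:a, b, c:] \<le> [:a', b', c':] \<longleftrightarrow> c < c' \<or> c = c' \<and> (b < b' \<or> b = b' \<and> a \<le> (a' :: int))"
  by (auto simp: less_eq_poly_def pos_poly_pCons)

lemma pCons3_eq_iff: "[:a, b, c:] = [:a', b', c':] \<longleftrightarrow> a = a' \<and> b = b' \<and> c = (c' :: int)"
  by simp

lemma minus_one_pCons: "(-1 :: int poly) = [:-1, 0, 0:]"
  by (simp add: one_pCons)

lemma mdeg_poly_le_iff: "mdeg_poly d \<le> mdeg_poly e \<longleftrightarrow> d \<le> e"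
  by (cases d; cases e) (auto simp only: mdeg_poly.simps minus_one_pCons pCons3_le_iff less_eq_mdeg.simps)

lemma mdeg_poly_less_iff: "mdeg_poly d < mdeg_poly e \<longleftrightarrow> d < e"
  by (simp add: mdeg_poly_le_iff flip: not_le)

lemma mdeg_poly_add: "d \<noteq> MInf \<Longrightarrow> e \<noteq> MInf \<Longrightarrow> mdeg_poly (d + e) = mdeg_poly d + mdeg_poly e"
  by (cases d; cases e) simp_all

definition psub :: "('v::finite \<Rightarrow> ('k::comm_monoid_add \<Rightarrow>\<^sub>0 complex)) \<Rightarrow> 'v cpoly \<Rightarrow> ('k \<Rightarrow>\<^sub>0 complex)" where
  "psub s p = (\<Sum>m\<in>Poly_Mapping.keys p. const (Poly_Mapping.lookup p m) * (\<Prod>i\<in>UNIV. s i ^ Poly_Mapping.lookup m i))"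

lemma psub_superset:
  assumes "finite S" "Poly_Mapping.keys p \<subseteq> S"
  shows "psub s p = (\<Sum>m\<in>S. const (Poly_Mapping.lookup p m) * (\<Prod>i\<in>UNIV. s i ^ Poly_Mapping.lookup m i))"
  unfolding psub_def using assms by (intro sum.mono_neutral_left) (auto simp: in_keys_iff)

lemma psub_0 [simp]: "psub s 0 = 0"
  by (simp add: psub_def)

lemma psub_single: "psub s (Poly_Mapping.single m c) = const c * (\<Prod>i\<in>UNIV. s i ^ Poly_Mapping.lookup m i)"
  by (simp add: psub_superset[of "{m}"])

lemma psub_const [simp]: "psub s (const c) = const c"
  by (subst const_def) (simp add: psub_single)

lemma psub_add [simp]: "psub s (p + q) = psub s p + psub s q"
proof -
  let ?S = "Poly_Mapping.keys p \<union> Poly_Mapping.keys q"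
  have "psub s (p + q) = (\<Sum>m\<in>?S. const (Poly_Mapping.lookup (p + q) m) * (\<Prod>i\<in>UNIV. s i ^ Poly_Mapping.lookup m i))"
    by (intro psub_superset) (auto dest: subsetD[OF keys_add])
  also have "\<dots> = psub s p + psub s q"
    by (simp add: psub_superset[of ?S] lookup_add distrib_right sum.distrib)
  finally show ?thesis .
qed

lemma psub_uminus [simp]: "psub s (- p) = - psub s p"
  using psub_add[of s p "- p"] by (simp add: eq_neg_iff_add_eq_0 add.commute)

lemma psub_diff [simp]: "psub s (p - q) = psub s p - psub s q"
  using psub_add[of s p "- q"] by simp

lemma psub_mult [simp]: "psub s (p * q) = psub s p * psub s q"
proof (induction p rule: cpoly_induct)
  case (single m c)
  show ?case
  proof (induction q rule: cpoly_induct)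
    case (single n d)
    show ?case
      by (simp add: mult_single psub_single lookup_add power_add prod.distrib algebra_simps)
  qed (simp_all add: distrib_left)
qed (simp_all add: distrib_right)

lemma psub_1 [simp]: "psub s 1 = 1"
  by (metis const_simps(2) psub_const)

lemma psub_Var [simp]: "psub s (Var i) = s i"
proof -
  have "(\<Prod>j\<in>UNIV. s j ^ (1 when i = j)) = (\<Prod>j\<in>{i}. s j ^ (1 when i = j))"
    by (intro prod.mono_neutral_right) (auto simp: when_def)
  then show ?thesis by (simp add: Var_def psub_single lookup_single)
qed

definition xdeg :: "4 \<Rightarrow> int poly" where
  "xdeg i = (if i = 1 then [:0, 1, 1:] else if i = 2 then [:1, 0, 1:] else if i = 3 then [:0, 1, 2:] else [:1, 0, 2:])"

definition xi :: "4 \<Rightarrow> laurent" where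
  "xi i = (if i = 4 then Poly_Mapping.single (- xdeg 1) 1 + Poly_Mapping.single (xdeg 4) 1 else Poly_Mapping.single (xdeg i) 1)"

lemma xdeg_simps:
  "xdeg 1 = [:0, 1, 1:]" "xdeg 2 = [:1, 0, 1:]" "xdeg 3 = [:0, 1, 2:]" "xdeg 4 = [:1, 0, 2:]"
  by (simp_all add: xdeg_def)

lemma xi_simps:
  "xi 1 = Poly_Mapping.single (xdeg 1) 1" "xi 2 = Poly_Mapping.single (xdeg 2) 1"
  "xi 3 = Poly_Mapping.single (xdeg 3) 1"
  "xi 4 = Poly_Mapping.single (- xdeg 1) 1 + Poly_Mapping.single (xdeg 4) 1"
  by (simp_all add: xi_def)

lemma xi_det: "xi 1 * xi 4 - xi 2 * xi 3 = 1"
proof -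
  have "xdeg 1 + xdeg 4 = xdeg 2 + xdeg 3" by (simp add: xdeg_simps)
  then show ?thesis by (simp add: xi_simps distrib_left mult_single)
qed

definition expansion :: "4 cpoly \<Rightarrow> laurent" where
  "expansion = psub xi"

lemma expansion_simps [simp]:
  "expansion 0 = 0" "expansion 1 = 1" "expansion (const c) = const c" "expansion (Var i) = xi i" "expansion (- p) = - expansion p"
  "expansion (p + q) = expansion p + expansion q" "expansion (p - q) = expansion p - expansion q" "expansion (p * q) = expansion p * expansion q"
  by (simp_all add: expansion_def)

lemma expansion_q_poly: "expansion (q_poly - 1) = 0"
  using xi_det by (simp add: q_poly_def)

definition monom_deg :: "(4 \<Rightarrow>\<^sub>0 nat) \<Rightarrow> int poly" where
  "monom_deg m = mdeg_poly (mon_deg m)"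

lemma monom_deg_eq:
  "monom_deg m = [:int (Poly_Mapping.lookup m 2 + Poly_Mapping.lookup m 4), int (Poly_Mapping.lookup m 1 + Poly_Mapping.lookup m 3),
    int (Poly_Mapping.lookup m 1 + Poly_Mapping.lookup m 2 + 2 * Poly_Mapping.lookup m 3 + 2 * Poly_Mapping.lookup m 4):]"
  by (simp add: monom_deg_def mon_deg_def)

lemma monom_deg_sum:
  "monom_deg m = of_nat (Poly_Mapping.lookup m 1) * xdeg 1 + of_nat (Poly_Mapping.lookup m 2) * xdeg 2
    + of_nat (Poly_Mapping.lookup m 3) * xdeg 3 + of_nat (Poly_Mapping.lookup m 4) * xdeg 4"
  by (simp add: monom_deg_eq xdeg_simps of_nat_poly)

lemma xi_top: "below (xi i) (xdeg i)" "Poly_Mapping.lookup (xi i) (xdeg i) = 1"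
proof -
  have "- xdeg 1 \<le> xdeg 4" "- xdeg 1 \<noteq> xdeg 4"
    by (simp_all add: xdeg_simps pCons3_le_iff)
  then have "below (xi i) (xdeg i) \<and> Poly_Mapping.lookup (xi i) (xdeg i) = 1"
    by (auto simp: xi_def lookup_add lookup_single intro!: below_add below_single)
  then show "below (xi i) (xdeg i)" "Poly_Mapping.lookup (xi i) (xdeg i) = 1" by auto
qed

lemma expansion_single_top:
  "below (expansion (Poly_Mapping.single m c)) (monom_deg m)"
  "Poly_Mapping.lookup (expansion (Poly_Mapping.single m c)) (monom_deg m) = c"
proof -
  let ?p = "\<lambda>i. xi i ^ Poly_Mapping.lookup m i" and ?d = "\<lambda>i. of_nat (Poly_Mapping.lookup m i) * xdeg i"
  have b: "below (?p i) (?d i)" and l: "Poly_Mapping.lookup (?p i) (?d i) = 1" for i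
    using below_power[OF xi_top(1)] xi_top(2) by simp_all
  have b2: "below (?p 1 * ?p 2) (?d 1 + ?d 2)" and b3: "below (?p 1 * ?p 2 * ?p 3) (?d 1 + ?d 2 + ?d 3)"
    and b4: "below (?p 1 * ?p 2 * ?p 3 * ?p 4) (?d 1 + ?d 2 + ?d 3 + ?d 4)"
    by (intro below_mult b)+
  have eq: "expansion (Poly_Mapping.single m c) = const c * (?p 1 * ?p 2 * ?p 3 * ?p 4)"
    by (simp only: expansion_def psub_single prod_4)
  show "below (expansion (Poly_Mapping.single m c)) (monom_deg m)"
    unfolding eq monom_deg_sum by (rule below_const_mult[OF b4])
  have "Poly_Mapping.lookup (?p 1 * ?p 2 * ?p 3 * ?p 4) (?d 1 + ?d 2 + ?d 3 + ?d 4) = 1"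
    by (simp only: lookup_mult_top[OF b3 b] lookup_mult_top[OF b2 b] lookup_mult_top[OF b b] l mult_1)
  then show "Poly_Mapping.lookup (expansion (Poly_Mapping.single m c)) (monom_deg m) = c"
    unfolding eq monom_deg_sum by simp
qed

lemma expansion_sum: "expansion g = (\<Sum>m\<in>Poly_Mapping.keys g. expansion (Poly_Mapping.single m (Poly_Mapping.lookup g m)))"
  by (simp add: expansion_def psub_single psub_def[of _ g])

lemma deg_C4_max:
  assumes "g \<noteq> 0"
  shows "\<exists>m\<in>Poly_Mapping.keys g. mdeg_poly (deg_C4 g) = monom_deg m \<and> (\<forall>n\<in>Poly_Mapping.keys g. monom_deg n \<le> monom_deg m)"
proof -
  have "deg_C4 g \<in> mon_deg ` Poly_Mapping.keys g"
    using assms by (simp add: deg_C4_def)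
  then obtain m where m: "m \<in> Poly_Mapping.keys g" "deg_C4 g = mon_deg m" by auto
  moreover have "monom_deg n \<le> monom_deg m" if "n \<in> Poly_Mapping.keys g" for n
  proof -
    have "mon_deg n \<le> deg_C4 g" using assms that by (simp add: deg_C4_def)
    then show ?thesis unfolding monom_deg_def mdeg_poly_le_iff m(2) .
  qed
  ultimately show ?thesis by (auto simp: monom_deg_def)
qed

lemma expansion_below: "(\<And>m. m \<in> Poly_Mapping.keys g \<Longrightarrow> monom_deg m \<le> d) \<Longrightarrow> below (expansion g) d"
proof -
  assume *: "\<And>m. m \<in> Poly_Mapping.keys g \<Longrightarrow> monom_deg m \<le> d"
  have "below (\<Sum>m\<in>A. expansion (Poly_Mapping.single m (Poly_Mapping.lookup g m))) d"
    if "A \<subseteq> Poly_Mapping.keys g" "finite A" for A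
    using that(2,1) by (induction A) (auto intro!: below_add below_mono[OF expansion_single_top(1)] *)
  then show ?thesis by (subst expansion_sum) auto
qed

lemma ldeg_expansion_le:
  assumes "expansion g \<noteq> 0"
  shows "ldeg (expansion g) \<le> mdeg_poly (deg_C4 g)"
proof -
  have "g \<noteq> 0" using assms by auto
  then have "below (expansion g) (mdeg_poly (deg_C4 g))"
    using deg_C4_max by (metis expansion_below)
  then show ?thesis using assms by (rule below_imp_ldeg_le)
qed

text \<open>
  Modulo \<open>q - 1\<close> every product \<open>x\<^sub>1 x\<^sub>4\<close> can be replaced by \<open>1 + x\<^sub>2 x\<^sub>3\<close>. The remaining monomials have pairwise
  different weights, so no cancellation occurs among their leading terms.
\<close>

definition standard :: "4 cpoly \<Rightarrow> bool" where
  "standard g \<longleftrightarrow> (\<forall>m\<in>Poly_Mapping.keys g. Poly_Mapping.lookup m 1 = 0 \<or> Poly_Mapping.lookup m 4 = 0)"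

lemma standard_monom_deg_inj:
  assumes "standard g" "m \<in> Poly_Mapping.keys g" "n \<in> Poly_Mapping.keys g" "monom_deg m = monom_deg n"
  shows "m = n"
proof -
  have "Poly_Mapping.lookup m 1 = 0 \<or> Poly_Mapping.lookup m 4 = 0"
       "Poly_Mapping.lookup n 1 = 0 \<or> Poly_Mapping.lookup n 4 = 0"
    using assms by (auto simp: standard_def)
  moreover note assms(4)[unfolded monom_deg_eq pCons3_eq_iff]
  ultimately have "\<forall>i. Poly_Mapping.lookup m i = Poly_Mapping.lookup n i"
    unfolding forall_4 by linarith
  then show ?thesis by (intro poly_mapping_eqI) simp
qed

lemma ldeg_expansion_standard:
  assumes "standard g" "g \<noteq> 0"
  shows "expansion g \<noteq> 0" "ldeg (expansion g) = mdeg_poly (deg_C4 g)"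
proof -
  obtain m where m: "m \<in> Poly_Mapping.keys g" "mdeg_poly (deg_C4 g) = monom_deg m"
      "\<And>n. n \<in> Poly_Mapping.keys g \<Longrightarrow> monom_deg n \<le> monom_deg m"
    using deg_C4_max[OF assms(2)] by auto
  have "Poly_Mapping.lookup (expansion (Poly_Mapping.single n (Poly_Mapping.lookup g n))) (monom_deg m) = 0"
    if n: "n \<in> Poly_Mapping.keys g" "n \<noteq> m" for n
  proof -
    have "monom_deg n < monom_deg m" using m(3)[OF n(1)] standard_monom_deg_inj[OF assms(1) n(1) m(1)] n(2) by force
    moreover have "k \<le> monom_deg n" if "k \<in> Poly_Mapping.keys (expansion (Poly_Mapping.single n (Poly_Mapping.lookup g n)))" for k
      using expansion_single_top(1)[of n "Poly_Mapping.lookup g n"] that unfolding below_def by blast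
    ultimately show ?thesis unfolding in_keys_iff by (metis leD)
  qed
  then have "Poly_Mapping.lookup (expansion g) (monom_deg m) = Poly_Mapping.lookup g m"
    using m(1) by (subst expansion_sum) (simp add: lookup_sum lookup_add sum.remove[of _ m] expansion_single_top)
  then have "Poly_Mapping.lookup (expansion g) (monom_deg m) \<noteq> 0" using m(1) by (simp add: in_keys_iff)
  moreover have "below (expansion g) (monom_deg m)" using m(3) by (rule expansion_below)
  ultimately show "expansion g \<noteq> 0" "ldeg (expansion g) = mdeg_poly (deg_C4 g)"
    unfolding m(2) by (simp_all add: ldeg_eqI)
qed

lemma standard_add: "standard g \<Longrightarrow> standard h \<Longrightarrow> standard (g + h)"
  unfolding standard_def using keys_add[of g h] by (meson UnE subsetD)

lemma standard_Var_mult: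
  assumes "standard g" "i = 2 \<or> i = 3"
  shows "standard (Var i * g)"
  unfolding standard_def
proof
  fix m assume "m \<in> Poly_Mapping.keys (Var i * g)"
  then obtain n where "n \<in> Poly_Mapping.keys g" "m = Poly_Mapping.single i 1 + n"
    using keys_mult[of "Var i" g] by (auto simp: Var_def)
  then show "Poly_Mapping.lookup m 1 = 0 \<or> Poly_Mapping.lookup m 4 = 0"
    using assms by (auto simp: standard_def lookup_add lookup_single)
qed

lemma ex_standard: "\<exists>g'. standard g' \<and> q_poly - 1 dvd g - g'"
proof (induction g rule: cpoly_induct)
  case zero
  show ?case by (rule exI[of _ 0]) (simp add: standard_def)
next
  case (add p r)
  then obtain p' r' where *: "standard p'" "q_poly - 1 dvd p - p'" "standard r'" "q_poly - 1 dvd r - r'" by blast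
  have "p + r - (p' + r') = (p - p') + (r - r')" by simp
  then show ?case using * dvd_add standard_add by metis
next
  case (single m c)
  show ?case
  proof (induction "Poly_Mapping.lookup m 1" arbitrary: m)
    case 0
    then show ?case
      by (intro exI[of _ "Poly_Mapping.single m c"]) (auto simp: standard_def split: if_splits)
  next
    case (Suc k)
    show ?case
    proof (cases "Poly_Mapping.lookup m 4 = 0")
      case True
      then show ?thesis
        by (intro exI[of _ "Poly_Mapping.single m c"]) (auto simp: standard_def split: if_splits)
    next
      case False
      define m' where "m' = m - Poly_Mapping.single 1 1 - Poly_Mapping.single 4 1"
      have "\<forall>i. Poly_Mapping.lookup m i = Poly_Mapping.lookup (Poly_Mapping.single 1 1 + (Poly_Mapping.single 4 1 + m')) i"
        using False Suc(2) unfolding m'_def forall_4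
        by (simp add: lookup_add lookup_minus lookup_single)
      then have m: "m = Poly_Mapping.single 1 1 + (Poly_Mapping.single 4 1 + m')"
        by (intro poly_mapping_eqI) simp
      have "k = Poly_Mapping.lookup m' 1" using Suc(2) by (simp add: m lookup_add lookup_single)
      from Suc(1)[OF this] obtain g where g: "standard g" "q_poly - 1 dvd Poly_Mapping.single m' c - g" by blast
      have "Poly_Mapping.single m c = Var 1 * Var 4 * Poly_Mapping.single m' c"
        by (simp add: m Var_def mult_single add.assoc)
      then have "Poly_Mapping.single m c - (g + Var 2 * (Var 3 * g))
         = Var 1 * Var 4 * (Poly_Mapping.single m' c - g) + (q_poly - 1) * g"
        by (simp add: q_poly_def algebra_simps)
      then have "q_poly - 1 dvd Poly_Mapping.single m c - (g + Var 2 * (Var 3 * g))"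
        using g(2) by (metis dvd_add dvd_mult dvd_triv_left)
      then show ?thesis using standard_add[OF g(1) standard_Var_mult[OF standard_Var_mult[OF g(1)]]] by blast
    qed
  qed
qed

lemma expansion_cong: "q_poly - 1 dvd g - h \<Longrightarrow> expansion g = expansion h"
  using expansion_q_poly by (elim dvdE) (metis expansion_simps(7,8) diff_eq_diff_eq diff_self mult_zero_left)

text \<open>
  The kernel is the ideal of the variety, because a nonzero standard polynomial has a nonzero expansion.
\<close>

lemma expansion_eq_iff: "expansion g = expansion h \<longleftrightarrow> q_poly - 1 dvd g - h"
proof
  assume "expansion g = expansion h"
  obtain k where k: "standard k" "q_poly - 1 dvd (g - h) - k" using ex_standard by blast
  then have "expansion k = 0" using expansion_cong[OF k(2)] \<open>expansion g = expansion h\<close> by simp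
  then have "k = 0" using ldeg_expansion_standard(1)[OF k(1)] by blast
  then show "q_poly - 1 dvd g - h" using k(2) by simp
qed (fact expansion_cong)

definition regular :: "laurent set" where
  "regular = range expansion"

lemma regular_simps [intro, simp]:
  "const c \<in> regular" "xi i \<in> regular" "0 \<in> regular" "1 \<in> regular"
  "f \<in> regular \<Longrightarrow> g \<in> regular \<Longrightarrow> f + g \<in> regular"
  "f \<in> regular \<Longrightarrow> g \<in> regular \<Longrightarrow> f - g \<in> regular"
  "f \<in> regular \<Longrightarrow> g \<in> regular \<Longrightarrow> f * g \<in> regular"
  "f \<in> regular \<Longrightarrow> - f \<in> regular"
  unfolding regular_def
  by (metis expansion_simps rangeI, metis expansion_simps rangeI, metis expansion_simps rangeI, metis expansion_simps rangeI,
      force simp flip: expansion_simps, force simp flip: expansion_simps, force simp flip: expansion_simps, force simp flip: expansion_simps)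

lemma regular_induct [consumes 1, case_names const xi add mult]:
  assumes "f \<in> regular" "\<And>c. P (const c)" "\<And>i. P (xi i)"
    "\<And>f g. P f \<Longrightarrow> P g \<Longrightarrow> P (f + g)" "\<And>f g. P f \<Longrightarrow> P g \<Longrightarrow> P (f * g)"
  shows "P f"
proof -
  have pow: "P (xi i ^ n)" for i n
    by (induction n) (use assms(2)[of 1] assms(3,5) in simp_all)
  obtain g where "f = expansion g" using assms(1) by (auto simp: regular_def)
  moreover have "P (expansion g)"
  proof (induction g rule: cpoly_induct)
    case zero
    then show ?case using assms(2)[of 0] by simp
  next
    case (single m c)
    then show ?case by (simp only: expansion_def psub_single prod_4) (intro assms(2,5) pow)
  next
    case (add p q)
    then show ?case using assms(4) by simp
  qed
  ultimately show ?thesis by simp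
qed

lemma regular_standard:
  assumes "f \<in> regular"
  obtains g where "standard g" "f = expansion g"
  using assms ex_standard expansion_cong unfolding regular_def by (metis rangeE)

lemma regular_ldeg:
  assumes "f \<in> regular" "f \<noteq> 0"
  obtains d where "d \<noteq> MInf" "ldeg f = mdeg_poly d"
proof -
  obtain g where g: "standard g" "f = expansion g" using assms(1) by (rule regular_standard)
  then have "g \<noteq> 0" using assms(2) by auto
  then have "ldeg f = mdeg_poly (deg_C4 g)" "deg_C4 g \<noteq> MInf"
    using ldeg_expansion_standard[OF g(1)] g(2) deg_C4_max[of g]
    by (auto simp: monom_deg_eq minus_one_pCons dest!: arg_cong[of _ _ "\<lambda>p. coeff p 0"])
  then show ?thesis using that by blast
qed

lemma regular_ldeg_nonneg:
  assumes "f \<in> regular" "f \<noteq> 0"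
  shows "0 \<le> ldeg f"
proof -
  obtain d where "d \<noteq> MInf" "ldeg f = mdeg_poly d" using assms by (rule regular_ldeg)
  then show ?thesis using pCons3_le_iff[of 0 0 0] by (cases d) auto
qed

text \<open>
  The weight of \<open>x\<^sub>2\<close> is the smallest positive weight of a monomial.
\<close>

lemma regular_le_xdeg2:
  assumes "f \<in> regular" "ldeg f \<le> xdeg 2"
  shows "\<exists>a b. f = const a + const b * xi 2 \<and> (ldeg f < xdeg 2 \<longrightarrow> b = 0)"
proof (cases "f = 0")
  case True
  then show ?thesis by (intro exI[of _ 0]) simp
next
  case False
  obtain g where g: "standard g" "f = expansion g" using assms(1) by (rule regular_standard)
  then have "g \<noteq> 0" using False by auto
  then have le: "monom_deg m \<le> ldeg f" if "m \<in> Poly_Mapping.keys g" for m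
    using deg_C4_max[of g] ldeg_expansion_standard(2)[OF g(1)] g(2) that by auto
  have m: "m = 0 \<or> m = Poly_Mapping.single 2 1 \<and> \<not> ldeg f < xdeg 2" if "m \<in> Poly_Mapping.keys g" for m
  proof -
    have "monom_deg m \<le> xdeg 2" using le[OF that] assms(2) by simp
    then have "Poly_Mapping.lookup m 1 = 0" "Poly_Mapping.lookup m 3 = 0" "Poly_Mapping.lookup m 4 = 0"
       "Poly_Mapping.lookup m 2 \<le> 1"
      by (auto simp: monom_deg_eq xdeg_simps pCons3_le_iff)
    then have "(\<forall>i. Poly_Mapping.lookup m i = 0) \<or> (\<forall>i. Poly_Mapping.lookup m i = Poly_Mapping.lookup (Poly_Mapping.single 2 1) i)"
      unfolding forall_4 by (auto simp: lookup_single)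
    then have "m = 0 \<or> m = Poly_Mapping.single 2 1"
      by (auto intro!: poly_mapping_eqI)
    moreover have "monom_deg (Poly_Mapping.single 2 1) = xdeg 2"
      by (simp add: monom_deg_eq xdeg_simps lookup_single)
    ultimately show ?thesis using le[OF that] by auto
  qed
  define a b where "a = Poly_Mapping.lookup g 0" and "b = Poly_Mapping.lookup g (Poly_Mapping.single 2 1)"
  have ne: "Poly_Mapping.single (2::4) (1::nat) \<noteq> 0"
    by (metis lookup_single_eq lookup_zero zero_neq_one)
  have "g = const a + const b * Var 2"
  proof (rule poly_mapping_eqI)
    fix n
    have *: "(const a + const b * Var 2 :: 4 cpoly) = Poly_Mapping.single 0 a + Poly_Mapping.single (Poly_Mapping.single 2 1) b"
      by (simp add: const_def Var_def mult_single)
    show "Poly_Mapping.lookup g n = Poly_Mapping.lookup (const a + const b * Var 2) n"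
      using m[of n] ne unfolding * by (auto simp: lookup_add lookup_single a_def b_def in_keys_iff when_def)
  qed
  then have "f = const a + const b * xi 2" using g(2) by simp
  moreover have "b = 0" if "ldeg f < xdeg 2"
    using m[of "Poly_Mapping.single 2 1"] that ne by (auto simp: b_def in_keys_iff)
  ultimately show ?thesis by blast
qed

lemma xdeg_pos: "0 < xdeg i"
proof -
  have "\<not> [:a, b, c:] \<le> [:0, 0, 0:]" if "0 < c" for a b c :: int
    using that unfolding pCons3_le_iff by simp
  then show ?thesis by (auto simp: xdeg_def not_le)
qed

lemma regular_ldeg_0:
  assumes "f \<in> regular" "ldeg f \<le> 0"
  obtains a where "f = const a"
proof -
  have "ldeg f < xdeg 2" using assms(2) xdeg_pos[of 2] by (rule order_le_less_trans)
  then show ?thesis using regular_le_xdeg2[OF assms(1)] that by fastforce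
qed

text \<open>
  Expansions only depend on the values on the variety, so they may be attached to functions.
\<close>

definition represents :: "(complex ^ 4 \<Rightarrow> complex) \<Rightarrow> laurent \<Rightarrow> bool" where
  "represents \<phi> f \<longleftrightarrow> (\<exists>g. (\<forall>x\<in>SL2. \<phi> x = cpoly_eval g x) \<and> f = expansion g)"

lemma represents_regular: "represents \<phi> f \<Longrightarrow> f \<in> regular"
  by (auto simp: represents_def regular_def)

lemma cpoly_eval_const [simp]: "cpoly_eval (const c) x = c"
  by (simp add: const_def)

lemma represents_const: "represents (\<lambda>x. c) (const c)"
  unfolding represents_def by (rule exI[of _ "const c"]) simp

lemma represents_coord: "represents (\<lambda>x. x $ i) (xi i)"
  unfolding represents_def by (rule exI[of _ "Var i"]) simp

lemma represents_add: "represents \<phi> f \<Longrightarrow> represents \<psi> g \<Longrightarrow> represents (\<lambda>x. \<phi> x + \<psi> x) (f + g)"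
  unfolding represents_def by (metis cpoly_eval_add expansion_simps(6))

lemma represents_mult: "represents \<phi> f \<Longrightarrow> represents \<psi> g \<Longrightarrow> represents (\<lambda>x. \<phi> x * \<psi> x) (f * g)"
  unfolding represents_def by (metis cpoly_eval_mult expansion_simps(8))

lemma represents_power: "represents \<phi> f \<Longrightarrow> represents (\<lambda>x. \<phi> x ^ n) (f ^ n)"
  by (induction n) (use represents_const[of 1] in \<open>simp_all add: represents_mult\<close>)

lemma represents_unique:
  assumes "represents \<phi> f" "represents \<psi> g"
  shows "f = g \<longleftrightarrow> (\<forall>x\<in>SL2. \<phi> x = \<psi> x)"
proof -
  obtain p q where p: "\<And>x. x \<in> SL2 \<Longrightarrow> \<phi> x = cpoly_eval p x" "f = expansion p"
    and q: "\<And>x. x \<in> SL2 \<Longrightarrow> \<psi> x = cpoly_eval q x" "g = expansion q"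
    using assms by (auto simp: represents_def)
  have "f = g \<longleftrightarrow> (\<forall>x\<in>SL2. cpoly_eval (p - q) x = 0)"
    unfolding p(2) q(2) expansion_eq_iff vanishes_on_SL2_iff[symmetric] ..
  then show ?thesis using p(1) q(1) by auto
qed

lemma represents_coord_ring: "restrict \<phi> SL2 \<in> coord_ring \<longleftrightarrow> (\<exists>f. represents \<phi> f)"
proof
  assume "restrict \<phi> SL2 \<in> coord_ring"
  then obtain g where "restrict \<phi> SL2 = restrict (cpoly_eval g) SL2" by (auto simp: coord_ring_def)
  then have "\<forall>x\<in>SL2. \<phi> x = cpoly_eval g x" by (metis restrict_apply')
  then show "\<exists>f. represents \<phi> f" by (auto simp: represents_def)
next
  assume "\<exists>f. represents \<phi> f"
  then obtain g where "\<forall>x\<in>SL2. \<phi> x = cpoly_eval g x" by (auto simp: represents_def)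
  then have "restrict \<phi> SL2 = restrict (cpoly_eval g) SL2" by (intro restrict_ext) auto
  then show "restrict \<phi> SL2 \<in> coord_ring" by (auto simp: coord_ring_def)
qed

lemma represents_poly:
  assumes "\<And>i. represents (\<lambda>x. \<phi> x $ i) (s i)"
  shows "represents (\<lambda>x. cpoly_eval h (\<phi> x)) (psub s h)"
proof (induction h rule: cpoly_induct)
  case zero
  show ?case using represents_const[of 0] by simp
next
  case (single m c)
  have "represents (\<lambda>x. \<Prod>i\<in>A. \<phi> x $ i ^ Poly_Mapping.lookup m i) (\<Prod>i\<in>A. s i ^ Poly_Mapping.lookup m i)"
    if "finite A" for A
    using that by (induction A) (use represents_const[of 1] in \<open>simp_all add: represents_mult represents_power assms\<close>)
  then show ?case by (simp add: psub_single mon_eval_def represents_mult represents_const)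
next
  case (add p q)
  then show ?case by (simp add: represents_add)
qed

text \<open>
  A standard representative attains the minimum in the definition of the degree, since every representative
  bounds the degree of the common expansion from above.
\<close>

lemma deg_SL2_eq_ldeg:
  assumes "represents \<phi> f" "f \<noteq> 0"
  shows "mdeg_poly (deg_SL2 (restrict \<phi> SL2)) = ldeg f" "deg_SL2 (restrict \<phi> SL2) \<noteq> MInf"
proof -
  obtain g where g: "\<And>x. x \<in> SL2 \<Longrightarrow> \<phi> x = cpoly_eval g x" "f = expansion g"
    using assms(1) by (auto simp: represents_def)
  have r: "restrict \<phi> SL2 = restrict (cpoly_eval g) SL2" by (intro restrict_ext g)
  obtain k where k: "standard k" "q_poly - 1 dvd g - k" using ex_standard by blast
  have fk: "f = expansion k" using g(2) expansion_cong[OF k(2)] by simp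
  then have k0: "k \<noteq> 0" using assms(2) by auto
  have "deg_SL2 (restrict \<phi> SL2) = deg_C4 k"
    unfolding deg_SL2_def
  proof (rule Least_equality)
    show "\<exists>g. restrict (cpoly_eval g) SL2 = restrict \<phi> SL2 \<and> deg_C4 k = deg_C4 g"
      using k(2) unfolding r by (metis restrict_eq_iff)
  next
    fix d assume "\<exists>g. restrict (cpoly_eval g) SL2 = restrict \<phi> SL2 \<and> d = deg_C4 g"
    then obtain h where h: "q_poly - 1 dvd h - g" "d = deg_C4 h"
      unfolding r restrict_eq_iff by blast
    then have "expansion h = f" using expansion_cong g(2) by simp
    then show "deg_C4 k \<le> d"
      using ldeg_expansion_le[of h] ldeg_expansion_standard(2)[OF k(1) k0] assms(2) h(2) fk
      by (metis mdeg_poly_le_iff)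
  qed
  moreover have "mdeg_poly (deg_C4 k) = ldeg f" using ldeg_expansion_standard[OF k(1) k0] fk by simp
  moreover have "0 \<le> ldeg f"
    using regular_ldeg_nonneg[OF represents_regular[OF assms(1)] assms(2)] .
  ultimately show "mdeg_poly (deg_SL2 (restrict \<phi> SL2)) = ldeg f" "deg_SL2 (restrict \<phi> SL2) \<noteq> MInf"
    by auto
qed

section \<open>Brackets and the volume form\<close>

text \<open>
  Logarithmic derivations: an additive character \<open>c\<close> of the exponents gives the derivation multiplying the
  monomial of exponent \<open>k\<close> by \<open>c k\<close>. It does not raise degrees.
\<close>

definition theta :: "(int poly \<Rightarrow> int) \<Rightarrow> laurent \<Rightarrow> laurent" where
  "theta c f = Poly_Mapping.mapp (\<lambda>k x. of_int (c k) * x) f"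

lemma lookup_theta: "Poly_Mapping.lookup (theta c f) k = of_int (c k) * Poly_Mapping.lookup f k"
  by (simp add: theta_def lookup_mapp when_def in_keys_iff)

lemma theta_single: "theta c (Poly_Mapping.single k x) = Poly_Mapping.single k (of_int (c k) * x)"
  by (intro poly_mapping_eqI) (simp add: lookup_theta lookup_single when_def)

lemma theta_add: "theta c (f + g) = theta c f + theta c g"
  by (intro poly_mapping_eqI) (simp add: lookup_theta lookup_add distrib_left)

lemma theta_0 [simp]: "theta c 0 = 0"
  by (intro poly_mapping_eqI) (simp add: lookup_theta)

lemma single_eq_0_iff [simp]: "Poly_Mapping.single k v = 0 \<longleftrightarrow> v = 0"
  by (metis lookup_single_eq lookup_zero single_zero)

lemma theta_below: "below f d \<Longrightarrow> below (theta c f) d"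
  by (auto simp: below_def in_keys_iff lookup_theta)

lemma theta_mult:
  assumes "\<And>k l. c (k + l) = c k + c l"
  shows "theta c (f * g) = f * theta c g + theta c f * g"
proof (induction f rule: poly_mapping_single_induct)
  case (single m x)
  show ?case
  proof (induction g rule: poly_mapping_single_induct)
    case (single n y)
    show ?case by (simp add: theta_single mult_single assms algebra_simps flip: single_add)
  qed (simp_all add: theta_add distrib_left)
qed (simp_all add: theta_add distrib_right)

lemma theta_const:
  assumes "\<And>k l. c (k + l) = c k + c l"
  shows "theta c (const x) = 0"
  using assms[of 0 0] by (simp add: const_def theta_single)

text \<open>
  The exponents of \<open>x\<^sub>1, x\<^sub>2, x\<^sub>3\<close> in the monomial of weight \<open>k\<close>, so that \<open>lder i\<close> is \<open>x\<^sub>i \<partial>/\<partial>x\<^sub>i\<close>.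
\<close>

definition chi :: "nat \<Rightarrow> int poly \<Rightarrow> int" where
  "chi i k = (if i = 1 then 2 * coeff k 1 + coeff k 0 - coeff k 2
    else if i = 2 then coeff k 0 else coeff k 2 - coeff k 1 - coeff k 0)"

abbreviation lder :: "nat \<Rightarrow> laurent \<Rightarrow> laurent" where
  "lder i \<equiv> theta (chi i)"

lemma chi_add: "chi i (k + l) = chi i k + chi i l"
  by (simp add: chi_def)

lemmas lder_simps = theta_add theta_mult[OF chi_add] theta_const[OF chi_add]

text \<open>
  Up to sign this is \<open>df \<and> dg \<and> dx\<^sub>l\<close> divided by the volume form \<open>dx\<^sub>1 \<and> dx\<^sub>2 \<and> dx\<^sub>3 / x\<^sub>1\<close> of the variety. Hence it maps
  regular functions to regular functions, although this is not visible in Laurent coordinates, and its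
  degree falls short of the sum of the degrees of \<open>f\<close> and \<open>g\<close> by at least the weight of the coordinate opposite to \<open>x\<^sub>l\<close>, which is positive.
\<close>

definition bracket :: "nat \<Rightarrow> laurent \<Rightarrow> laurent \<Rightarrow> laurent" where
  "bracket l f g =
    (if l = 1 then Poly_Mapping.single (- xdeg 4) 1 * (lder 2 f * lder 3 g - lder 3 f * lder 2 g)
     else if l = 2 then Poly_Mapping.single (- xdeg 3) 1 * (lder 1 f * lder 3 g - lder 3 f * lder 1 g)
     else Poly_Mapping.single (- xdeg 2) 1 * (lder 1 f * lder 2 g - lder 2 f * lder 1 g))"

definition shift :: "nat \<Rightarrow> int poly" where
  "shift l = (if l = 1 then xdeg 4 else if l = 2 then xdeg 3 else xdeg 2)"

lemma bracket_simps:
  "bracket l f (g + h) = bracket l f g + bracket l f h"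
  "bracket l f (g * h) = g * bracket l f h + bracket l f g * h"
  "bracket l f (const c) = 0"
  "bracket l f f = 0"
  by (auto simp: bracket_def lder_simps algebra_simps)

lemma bracket_swap: "bracket l g f = - bracket l f g"
  by (auto simp: bracket_def algebra_simps)

lemma ldeg_bracket_le:
  assumes "bracket l f g \<noteq> 0"
  shows "ldeg (bracket l f g) + shift l \<le> ldeg f + ldeg g"
proof -
  have fg: "f \<noteq> 0" "g \<noteq> 0" using assms by (auto simp: bracket_def split: if_splits)
  have "below (lder i f * lder j g) (ldeg f + ldeg g)" for i j
    using fg by (intro below_mult theta_below below_ldeg)
  then have "below (lder i f * lder j g - lder j f * lder i g) (ldeg f + ldeg g)" for i j
    by (intro below_diff)
  then have "below (Poly_Mapping.single (- e) 1 * (lder i f * lder j g - lder j f * lder i g)) (- e + (ldeg f + ldeg g))" for i j e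
    by (intro below_mult[of "Poly_Mapping.single (- e) 1"] below_single) auto
  then have "below (bracket l f g) (- shift l + (ldeg f + ldeg g))"
    by (simp add: bracket_def shift_def)
  from below_imp_ldeg_le[OF this assms] show ?thesis by simp
qed

lemma bracket_xi:
  "bracket 1 (xi 1) (xi 2) = 0" "bracket 1 (xi 1) (xi 3) = 0" "bracket 1 (xi 1) (xi 4) = 0"
  "bracket 1 (xi 2) (xi 3) = xi 1" "bracket 1 (xi 2) (xi 4) = xi 2" "bracket 1 (xi 3) (xi 4) = - xi 3"
  "bracket 2 (xi 1) (xi 2) = 0" "bracket 2 (xi 1) (xi 3) = xi 1" "bracket 2 (xi 1) (xi 4) = xi 2"
  "bracket 2 (xi 2) (xi 3) = 0" "bracket 2 (xi 2) (xi 4) = 0" "bracket 2 (xi 3) (xi 4) = xi 4"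
  "bracket 3 (xi 1) (xi 2) = xi 1" "bracket 3 (xi 1) (xi 3) = 0" "bracket 3 (xi 1) (xi 4) = xi 3"
  "bracket 3 (xi 2) (xi 3) = 0" "bracket 3 (xi 2) (xi 4) = xi 4" "bracket 3 (xi 3) (xi 4) = 0"
  unfolding bracket_def xi_simps theta_add theta_single xdeg_simps
  by (simp_all add: chi_def mult_single distrib_left right_diff_distrib single_uminus numeral_2_eq_2)

lemma bracket_xi_regular:
  assumes "l \<in> {1, 2, 3}"
  shows "bracket l (xi i) (xi j) \<in> regular"
proof -
  note swaps = bracket_swap[of _ "xi 2" "xi 1"] bracket_swap[of _ "xi 3" "xi 1"] bracket_swap[of _ "xi 4" "xi 1"]
    bracket_swap[of _ "xi 3" "xi 2"] bracket_swap[of _ "xi 4" "xi 2"] bracket_swap[of _ "xi 4" "xi 3"]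
  have "\<forall>i j. bracket l (xi i) (xi j) \<in> regular"
    unfolding forall_4 using assms
    by (elim insertE) (simp_all add: bracket_xi bracket_simps swaps del: One_nat_def)
  then show ?thesis by blast
qed

lemma bracket_regular:
  assumes "f \<in> regular" "g \<in> regular" "l \<in> {1, 2, 3}"
  shows "bracket l f g \<in> regular"
proof -
  have 1: "h \<in> regular \<and> bracket l (xi i) h \<in> regular" if "h \<in> regular" for i h
    using that by (induction rule: regular_induct) (auto simp: bracket_simps bracket_xi_regular[OF assms(3)])
  have "f \<in> regular \<and> bracket l g f \<in> regular"
    using assms(1)
  proof (induction rule: regular_induct)
    case (xi i)
    show ?case using 1[OF assms(2), of i] bracket_swap[of l g "xi i"] by auto
  qed (auto simp: bracket_simps)
  then show ?thesis using bracket_swap[of l f g] by auto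
qed

text \<open>
  The coefficient of \<open>df \<and> dg \<and> dh\<close> with respect to the logarithmic differentials. Its nonvanishing
  expresses algebraic independence in a form that elementary operations visibly preserve.
\<close>

definition vol :: "laurent \<Rightarrow> laurent \<Rightarrow> laurent \<Rightarrow> laurent" where
  "vol f g h = lder 3 h * (lder 1 f * lder 2 g - lder 2 f * lder 1 g) - lder 2 h * (lder 1 f * lder 3 g - lder 3 f * lder 1 g)
     + lder 1 h * (lder 2 f * lder 3 g - lder 3 f * lder 2 g)"

lemma vol_simps:
  "vol f g (h + k) = vol f g h + vol f g k" "vol f g (h * k) = h * vol f g k + k * vol f g h"
  "vol f g (const c) = 0" "vol f g f = 0" "vol f g g = 0"
  by (simp_all add: vol_def lder_simps algebra_simps)

lemma vol_swap: "vol f h g = - vol f g h" "vol g f h = - vol f g h"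
  by (simp_all add: vol_def algebra_simps)

lemma vol_const: "vol (const c) g h = 0" "vol f (const c) h = 0"
  by (simp_all add: vol_def lder_simps)

lemma vol_xi: "vol (xi 1) (xi 2) (xi 3) \<noteq> 0"
proof -
  have "vol (xi 1) (xi 2) (xi 3) = xi 3 * (xi 1 * xi 2)"
    unfolding vol_def xi_simps theta_single xdeg_simps by (simp add: chi_def numeral_2_eq_2)
  then show ?thesis by (simp add: xi_simps)
qed

lemma vol_nonzero_imp_bracket:
  assumes "vol f g h \<noteq> 0"
  obtains l where "l \<in> {1, 2, 3}" "bracket l f g \<noteq> 0"
proof -
  have "\<exists>l\<in>{1, 2, 3}. bracket l f g \<noteq> 0"
  proof (rule ccontr)
    assume "\<not> ?thesis"
    then have "bracket 1 f g = 0" "bracket 2 f g = 0" "bracket 3 f g = 0" by auto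
    then have "lder 2 f * lder 3 g - lder 3 f * lder 2 g = 0" "lder 1 f * lder 3 g - lder 3 f * lder 1 g = 0"
      "lder 1 f * lder 2 g - lder 2 f * lder 1 g = 0"
      by (simp_all add: bracket_def)
    then show False using assms unfolding vol_def by simp
  qed
  then show ?thesis using that by blast
qed

section \<open>Generated subalgebras\<close>

inductive_set subalg :: "laurent set \<Rightarrow> laurent set" for S where
  const [intro, simp]: "const c \<in> subalg S"
| gen [intro]: "s \<in> S \<Longrightarrow> s \<in> subalg S"
| add [intro]: "f \<in> subalg S \<Longrightarrow> g \<in> subalg S \<Longrightarrow> f + g \<in> subalg S"
| mult [intro]: "f \<in> subalg S \<Longrightarrow> g \<in> subalg S \<Longrightarrow> f * g \<in> subalg S"

lemma subalg_0 [simp]: "0 \<in> subalg S" and subalg_1 [simp]: "1 \<in> subalg S"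
  using subalg.const[of 0] subalg.const[of 1] by simp_all

lemma subalg_uminus [intro]: "f \<in> subalg S \<Longrightarrow> - f \<in> subalg S"
  using subalg.mult[OF subalg.const[of "- 1"]] by simp

lemma subalg_diff [intro]: "f \<in> subalg S \<Longrightarrow> g \<in> subalg S \<Longrightarrow> f - g \<in> subalg S"
  using subalg.add[of f S "- g"] by auto

lemma subalg_power [intro]: "f \<in> subalg S \<Longrightarrow> f ^ n \<in> subalg S"
  by (induction n) auto

lemma subalg_sum: "(\<And>a. a \<in> A \<Longrightarrow> f a \<in> subalg S) \<Longrightarrow> sum f A \<in> subalg S"
  by (induction A rule: infinite_finite_induct) auto

lemma subalg_subset:
  assumes "S \<subseteq> subalg R"
  shows "subalg S \<subseteq> subalg R"
proof
  fix f assume "f \<in> subalg S"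
  then show "f \<in> subalg R" by induction (use assms in auto)
qed

lemma subalg_regular:
  assumes "S \<subseteq> regular" "f \<in> subalg S"
  shows "f \<in> regular"
  using assms(2) by induction (use assms(1) in auto)

lemma subalg_psub: "psub s h \<in> subalg (range s)"
proof (induction h rule: cpoly_induct)
  case (single m c)
  have "(\<Prod>i\<in>A. s i ^ Poly_Mapping.lookup m i) \<in> subalg (range s)" if "finite A" for A
    using that by (induction A) (auto intro!: subalg.mult subalg_power)
  then show ?case by (auto simp: psub_single)
qed auto

lemma subalg_range:
  fixes s :: "'v::finite \<Rightarrow> laurent"
  assumes "f \<in> subalg (range s)"
  shows "\<exists>h. f = psub s h"
  using assms
proof induction
  case (const c)
  show ?case by (metis psub_const)
next
  case (gen f)
  then show ?case by (metis psub_Var rangeE)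
next
  case (add f g)
  then show ?case by (metis psub_add)
next
  case (mult f g)
  then show ?case by (metis psub_mult)
qed

lemma bracket_subalg: "u \<in> subalg {p} \<Longrightarrow> bracket l p u = 0"
  by (induction rule: subalg.induct) (auto simp: bracket_simps)

lemma vol_subalg: "u \<in> subalg {p, r} \<Longrightarrow> vol p r u = 0"
  by (induction rule: subalg.induct) (auto simp: vol_simps)

lemma subalg_single_poly:
  assumes "u \<in> subalg {p}"
  shows "\<exists>c. u = poly (map_poly const c) p"
proof -
  let ?E = "\<lambda>c. poly (map_poly const c) p"
  have add: "?E (c + d) = ?E c + ?E d" for c d
  proof -
    have "map_poly const (c + d) = (map_poly const c + map_poly const d :: laurent poly)"
      by (intro poly_eqI) (simp add: coeff_map_poly)
    then show ?thesis by simp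
  qed
  have smult: "?E (smult a c) = const a * ?E c" for a c
  proof -
    have "map_poly const (smult a c) = (smult (const a) (map_poly const c) :: laurent poly)"
      by (intro poly_eqI) (simp add: coeff_map_poly)
    then show ?thesis by simp
  qed
  have mult: "?E (c * d) = ?E c * ?E d" for c d
  proof (induction c)
    case (pCons a c)
    have "?E (pCons a c * d) = ?E (smult a d) + ?E (pCons 0 (c * d))"
      unfolding mult_pCons_left by (rule add)
    also have "\<dots> = const a * ?E d + p * (?E c * ?E d)"
      by (simp add: smult map_poly_pCons pCons.IH)
    finally show ?case by (simp add: map_poly_pCons algebra_simps)
  qed simp
  show ?thesis
    using assms
  proof induction
    case (const c)
    show ?case by (intro exI[of _ "[:c:]"]) (simp add: map_poly_pCons)
  next
    case (gen s)
    then show ?case by (intro exI[of _ "[:0, 1:]"]) (simp add: map_poly_pCons)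
  next
    case (add f g)
    then show ?case by (metis \<open>\<And>d c. ?E (c + d) = ?E c + ?E d\<close>)
  next
    case (mult f g)
    then show ?case by (metis \<open>\<And>d c. ?E (c * d) = ?E c * ?E d\<close>)
  qed
qed

lemma below_poly:
  fixes r :: "'k::linordered_idom \<Rightarrow>\<^sub>0 complex"
  assumes "weight_le H Q W" "below r Q"
  shows "below (poly H r) W"
proof -
  have "below (coeff H j * r ^ j) ((W - of_nat j * Q) + of_nat j * Q)" for j
    using assms by (intro below_mult) (auto simp: weight_le_def below_power)
  then have b: "below (coeff H j * r ^ j) W" for j by simp
  have "below (\<Sum>j\<in>A. coeff H j * r ^ j) W" if "finite A" for A
    using that by induction (auto intro!: below_add b)
  then show ?thesis unfolding poly_altdef by simp
qed

lemma ldeg_subalg_single: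
  assumes "u \<in> subalg {p}" "u \<noteq> 0" "p \<noteq> 0" "0 < ldeg p"
  shows "\<exists>k. ldeg u = of_nat k * ldeg p"
proof -
  obtain c where c: "u = poly (map_poly const c) p" using subalg_single_poly[OF assms(1)] by blast
  then have c0: "c \<noteq> 0" using assms(2) by auto
  let ?H = "map_poly const c :: laurent poly" and ?W = "of_nat (degree c) * ldeg p"
  have co: "coeff ?H j = const (coeff c j)" for j by (simp add: coeff_map_poly)
  have w: "weight_le ?H (ldeg p) ?W"
    unfolding weight_le_def co
  proof
    fix j
    show "below (const (coeff c j)) (?W - of_nat j * ldeg p)"
    proof (cases "j \<le> degree c")
      case True
      then have "of_nat j * ldeg p \<le> ?W" using assms(4) by (intro mult_right_mono) auto
      then show ?thesis by (simp add: const_def below_single)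
    qed (simp add: coeff_eq_0)
  qed
  have "lead_form ?H (ldeg p) ?W = monom (lead_coeff c) (degree c)"
    by (intro poly_eqI) (use assms(4) in \<open>auto simp: coeff_lead_form co const_def lookup_single when_def\<close>)
  then have "Poly_Mapping.lookup u ?W \<noteq> 0"
    using lookup_poly_top[OF w below_ldeg[OF assms(3)]] lookup_ldeg[OF assms(3)] c0
    by (simp add: c poly_monom)
  moreover have "below u ?W" unfolding c by (rule below_poly[OF w below_ldeg[OF assms(3)]])
  ultimately show ?thesis using ldeg_eqI(2) by blast
qed

text \<open>
  The two-variable subalgebra is handled as one-variable polynomials in \<open>r\<close> with coefficients in the subalgebra
  of \<open>p\<close>, on which the bracket with \<open>p\<close> vanishes and degrees are multiples of that of \<open>p\<close>.
\<close>

lemma subalg_two_poly: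
  assumes "u \<in> subalg {p, r}"
  shows "\<exists>H. u = poly H r \<and> (\<forall>j. coeff H j \<in> subalg {p})"
  using assms
proof induction
  case (const c)
  show ?case by (intro exI[of _ "[:const c:]"]) (auto simp: coeff_pCons split: nat.split)
next
  case (gen s)
  then consider "s = p" | "s = r" by auto
  then show ?case
  proof cases
    case 1
    then show ?thesis by (intro exI[of _ "[:p:]"]) (auto simp: coeff_pCons split: nat.split)
  next
    case 2
    then show ?thesis by (intro exI[of _ "[:0, 1:]"]) (auto simp: coeff_pCons split: nat.split)
  qed
next
  case (add f g)
  then obtain H K where "f = poly H r" "\<forall>j. coeff H j \<in> subalg {p}" "g = poly K r" "\<forall>j. coeff K j \<in> subalg {p}"
    by blast
  then show ?case by (intro exI[of _ "H + K"]) auto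
next
  case (mult f g)
  then obtain H K where "f = poly H r" "\<forall>j. coeff H j \<in> subalg {p}" "g = poly K r" "\<forall>j. coeff K j \<in> subalg {p}"
    by blast
  then show ?case by (intro exI[of _ "H * K"]) (auto simp: coeff_mult intro!: subalg_sum)
qed

lemma ldeg_pos_of_vol:
  assumes "p \<in> regular" "vol p r h \<noteq> 0"
  shows "p \<noteq> 0" "0 < ldeg p"
proof -
  show p: "p \<noteq> 0" using assms(2) vol_const(1)[of 0] by auto
  show "0 < ldeg p"
  proof (rule ccontr)
    assume "\<not> 0 < ldeg p"
    then obtain a where "p = const a" using regular_ldeg_0[OF assms(1)] by auto
    then show False using assms(2) vol_const(1) by simp
  qed
qed

text \<open>
  The key inequality for regular functions, with the bracket with \<open>p\<close> as derivation. The value of that bracket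
  at \<open>r\<close> is a nonzero regular function, hence of nonnegative degree.
\<close>

theorem ldeg_subalg_gt:
  assumes reg: "p \<in> regular" "r \<in> regular" and vol: "vol p r h \<noteq> 0"
    and le: "ldeg p \<le> ldeg r" and ne: "\<And>k. ldeg r \<noteq> of_nat k * ldeg p"
    and u: "u \<in> subalg {p, r}" "u \<notin> subalg {p}"
  shows "u \<noteq> 0 \<and> ldeg r < ldeg p + ldeg u"
proof -
  obtain l where l: "l \<in> {1, 2, 3}" "bracket l p r \<noteq> 0" using vol by (rule vol_nonzero_imp_bracket)
  obtain H where H: "u = poly H r" "\<And>j. coeff H j \<in> subalg {p}" using subalg_two_poly[OF u(1)] by blast
  have "degree H > 0"
  proof (rule ccontr)
    assume "\<not> degree H > 0"
    then have "H = [:coeff H 0:]" by (metis degree_0_id gr0I)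
    then have "u = coeff H 0" unfolding H(1) by (metis mult_zero_right add.right_neutral poly_0 poly_pCons)
    then show False using H(2) u(2) by metis
  qed
  note p = ldeg_pos_of_vol[OF reg(1) vol]
  have "vol r p h \<noteq> 0" using vol vol_swap(2)[of r p h] by auto
  note r = ldeg_pos_of_vol[OF reg(2) this]
  have s: "0 < shift l" by (simp add: shift_def xdeg_pos)
  have nn: "0 \<le> ldeg (bracket l p r)"
    using bracket_regular[OF reg l(1)] l(2) by (rule regular_ldeg_nonneg)
  show ?thesis
    unfolding H(1)
    by (rule ldeg_poly_gt[where D = "bracket l p" and e = "shift l"])
      (use p r s l(2) nn le ne H(2) \<open>degree H > 0\<close> in
        \<open>auto simp: bracket_simps ldeg_bracket_le bracket_subalg intro!: ldeg_subalg_single\<close>)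
qed

section \<open>Matrices with constant determinant and elementary operations on them\<close>

text \<open>
  The quadruples \<open>(i, j, k, l)\<close> in which the positions of a 2 by 2 matrix can be arranged with \<open>i, l\<close> and \<open>j, k\<close>
  on the diagonals. They form one orbit of the symmetry group of the square, so that one case stands for
  all four types of elementary automorphisms.
\<close>

definition square :: "4 \<Rightarrow> 4 \<Rightarrow> 4 \<Rightarrow> 4 \<Rightarrow> bool" where
  "square i j k l \<longleftrightarrow> (i, j, k, l) \<in> {(1, 2, 3, 4), (2, 1, 4, 3), (3, 4, 1, 2), (4, 3, 2, 1),
     (1, 3, 2, 4), (3, 1, 4, 2), (2, 4, 1, 3), (4, 2, 3, 1)}"

lemma four_distinct:
  "(1::4) \<noteq> 2" "(1::4) \<noteq> 3" "(1::4) \<noteq> 4" "(2::4) \<noteq> 1" "(2::4) \<noteq> 3" "(2::4) \<noteq> 4"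
  "(3::4) \<noteq> 1" "(3::4) \<noteq> 2" "(3::4) \<noteq> 4" "(4::4) \<noteq> 1" "(4::4) \<noteq> 2" "(4::4) \<noteq> 3"
  by simp_all

lemma square_sym:
  assumes "square i j k l"
  shows "square j i l k" "square k l i j" "square l k j i" "square i k j l" "square k i l j"
    "square j l i k" "square l j k i"
proof -
  have "square j i l k \<and> square k l i j \<and> square l k j i \<and> square i k j l \<and> square k i l j
    \<and> square j l i k \<and> square l j k i"
    using assms unfolding square_def insert_iff empty_iff prod.inject
    by (elim disjE conjE FalseE; simp only: four_distinct simp_thms)
  then show "square j i l k" "square k l i j" "square l k j i" "square i k j l" "square k i l j"
    "square j l i k" "square l j k i" by simp_all
qed

lemma square_distinct:
  assumes "square i j k l"
  shows "i \<noteq> j" "i \<noteq> k" "i \<noteq> l" "j \<noteq> k" "j \<noteq> l" "k \<noteq> l" "UNIV = {i, j, k, l}"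
  using assms unfolding square_def UNIV_4 by auto

lemma square_orbit:
  assumes "square i j k l" "square i' j' k' l'"
  shows "(i', j', k', l') \<in> {(i, j, k, l), (j, i, l, k), (k, l, i, j), (l, k, j, i),
     (i, k, j, l), (k, i, l, j), (j, l, i, k), (l, j, k, i)}"
  using assms unfolding square_def insert_iff empty_iff prod.inject
  by (elim disjE conjE FalseE; simp only: four_distinct simp_thms)

type_synonym laurent_matrix = "4 \<Rightarrow> laurent"

text \<open>
  A multiple of the row or column \<open>(i, j)\<close> is added to the row or column \<open>(k, l)\<close>.
\<close>

definition estep :: "4 \<Rightarrow> 4 \<Rightarrow> 4 \<Rightarrow> 4 \<Rightarrow> laurent \<Rightarrow> laurent_matrix \<Rightarrow> laurent_matrix" where
  "estep i j k l u s = s(k := s k + s i * u, l := s l + s j * u)"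

text \<open>
  The determinant is allowed to be any nonzero constant, so that transposing the matrix or exchanging its rows,
  without signs, stays inside the class.
\<close>

definition admissible :: "laurent_matrix \<Rightarrow> bool" where
  "admissible s \<longleftrightarrow> (\<forall>i. s i \<in> regular) \<and> (\<forall>i j k l. square i j k l \<longrightarrow>
     (\<exists>c. c \<noteq> 0 \<and> s i * s l - s j * s k = const c) \<and> vol (s i) (s j) (s k) \<noteq> 0)"

definition sdeg :: "laurent_matrix \<Rightarrow> int poly" where
  "sdeg s = (\<Sum>i\<in>UNIV. ldeg (s i))"

definition linear_forms :: "laurent set" where
  "linear_forms = {f. \<exists>c. f = (\<Sum>j\<in>UNIV. const (c j) * xi j)}"

text \<open>
  Only operations without scalars are used as steps; scalars are absorbed by \<open>reduces_rescale\<close>.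
\<close>

inductive reduces :: "laurent_matrix \<Rightarrow> bool" where
  linear: "(\<And>i. s i \<in> linear_forms) \<Longrightarrow> reduces s"
| reduction: "square i j k l \<Longrightarrow> u \<in> subalg {s i, s j} \<Longrightarrow> sdeg (estep i j k l u s) < sdeg s \<Longrightarrow>
    reduces (estep i j k l u s) \<Longrightarrow> reduces s"

lemma estep_simps:
  assumes "square i j k l"
  shows "estep i j k l u s i = s i" "estep i j k l u s j = s j"
    "estep i j k l u s k = s k + s i * u" "estep i j k l u s l = s l + s j * u"
  using square_distinct[OF assms] by (auto simp: estep_def)

lemma square_eqI:
  assumes "square i j k l" "s i = t i" "s j = t j" "s k = t k" "s l = t l"
  shows "s = (t :: 4 \<Rightarrow> 'a)"
proof
  fix x
  have "x \<in> {i, j, k, l}" using square_distinct(7)[OF assms(1)] by blast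
  then show "s x = t x" using assms(2-) by (elim insertE emptyE) simp_all
qed

lemma estep_swap: "square i j k l \<Longrightarrow> estep j i l k u s = estep i j k l u s"
  using square_distinct[of i j k l] by (auto simp: estep_def fun_upd_twist)

lemma estep_estep:
  assumes "square i j k l"
  shows "estep i j k l v (estep i j k l u s) = estep i j k l (u + v) s"
  by (rule square_eqI[OF assms]) (simp_all add: estep_simps[OF assms] algebra_simps)

lemma estep_0 [simp]: "estep i j k l 0 s = s"
  by (simp add: estep_def)

lemma vol_nonzero_perm:
  assumes "vol f g h \<noteq> 0"
  shows "vol f h g \<noteq> 0" "vol g f h \<noteq> 0" "vol g h f \<noteq> 0" "vol h f g \<noteq> 0" "vol h g f \<noteq> 0"
proof -
  have "vol f h g = - vol f g h" "vol g f h = - vol f g h" "vol g h f = vol f g h"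
    "vol h f g = vol f g h" "vol h g f = - vol f g h"
    by (simp_all add: vol_def algebra_simps)
  then show "vol f h g \<noteq> 0" "vol g f h \<noteq> 0" "vol g h f \<noteq> 0" "vol h f g \<noteq> 0" "vol h g f \<noteq> 0"
    using assms by simp_all
qed

text \<open>
  Applying the derivation \<open>vol x y\<close> to the determinant relation shows that the volume forms of the triples of
  entries are proportional, with the entries as factors.
\<close>

lemma vol_transfer:
  assumes det: "a * d - b * c = const k" and vol: "vol a b c \<noteq> 0"
  shows "vol a b d \<noteq> 0" "vol a c d \<noteq> 0" "vol b c d \<noteq> 0"
proof -
  have nz: "a \<noteq> 0" "b \<noteq> 0" "c \<noteq> 0"
    using vol vol_const(1)[of 0] vol_const(2)[of _ 0] vol_simps(3)[of a b 0] by auto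
  have eq: "a * d = const k + b * c" using det by (simp add: algebra_simps)
  have 0: "vol x y (a * d) = vol x y (b * c)" for x y
    unfolding eq by (simp only: vol_simps add_0)
  have "a * vol a b d = b * vol a b c" using 0[of a b] by (simp add: vol_simps)
  then show d: "vol a b d \<noteq> 0" using nz vol by auto
  have "a * vol a c d = c * vol a c b" using 0[of a c] by (simp add: vol_simps)
  then show "vol a c d \<noteq> 0" using nz vol_nonzero_perm(1)[OF vol] by auto
  have "a * vol b c d + d * vol b c a = 0" using 0[of b c] by (simp add: vol_simps)
  moreover have "d \<noteq> 0" using d vol_simps(3)[of a b 0] by auto
  ultimately show "vol b c d \<noteq> 0" using vol_nonzero_perm(3)[OF vol] by auto
qed

lemma admissibleI:
  assumes "\<And>x. s x \<in> regular" and sq: "square i j k l" and c: "c \<noteq> 0" "s i * s l - s j * s k = const c"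
    and vol: "vol (s i) (s j) (s k) \<noteq> 0"
  shows "admissible s"
  unfolding admissible_def
proof (intro conjI allI impI)
  fix i' j' k' l' assume sq': "square i' j' k' l'"
  note orb = square_orbit[OF sq sq']
  note tr = vol_transfer[OF c(2) vol]
  have "s i' * s l' - s j' * s k' = s i * s l - s j * s k \<or> s i' * s l' - s j' * s k' = - (s i * s l - s j * s k)"
    using orb by (auto simp: algebra_simps)
  then have "s i' * s l' - s j' * s k' = const c \<or> s i' * s l' - s j' * s k' = const (- c)"
    unfolding c(2) by simp
  then show "\<exists>c. c \<noteq> 0 \<and> s i' * s l' - s j' * s k' = const c"
    using c(1) by (metis neg_equal_0_iff_equal)
  note p = vol_nonzero_perm[OF vol] vol_nonzero_perm[OF tr(1)] vol_nonzero_perm[OF tr(2)] vol_nonzero_perm[OF tr(3)]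
  show "vol (s i') (s j') (s k') \<noteq> 0"
    using orb
    by (elim insertE emptyE) (use vol tr p in \<open>simp_all\<close>)
qed (fact assms(1))

lemma admissible_regular [simp]: "admissible s \<Longrightarrow> s i \<in> regular"
  by (simp add: admissible_def)

lemma admissible_estep:
  assumes s: "admissible s" and sq: "square i j k l" and u: "u \<in> subalg {s i, s j}"
  shows "admissible (estep i j k l u s)"
proof -
  obtain c where c: "c \<noteq> 0" "s i * s l - s j * s k = const c" and v: "vol (s i) (s j) (s k) \<noteq> 0"
    using s sq unfolding admissible_def by blast
  have "u \<in> regular" using subalg_regular[OF _ u] s by auto
  then have "estep i j k l u s x \<in> regular" for x
    using s by (auto simp: estep_def)
  then show ?thesis
    by (rule admissibleI[OF _ sq c(1)])
      (use c(2) v in \<open>simp_all add: estep_simps[OF sq] vol_simps vol_subalg[OF u] algebra_simps\<close>)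
qed

lemma square_exists: "\<exists>j k l. square i j k l"
proof -
  have "\<forall>i. \<exists>j k l. square i j k l" unfolding forall_4 square_def by auto
  then show ?thesis by blast
qed

lemma admissible_pos:
  assumes "admissible s"
  shows "s i \<noteq> 0" "0 < ldeg (s i)"
proof -
  obtain j k l where "square i j k l" using square_exists by blast
  then have "vol (s i) (s j) (s k) \<noteq> 0" using assms by (auto simp: admissible_def)
  then show "s i \<noteq> 0" "0 < ldeg (s i)"
    using ldeg_pos_of_vol assms admissible_regular by blast+
qed

text \<open>
  All entries have positive degree, so the leading terms of the two products in the determinant must cancel.
\<close>

lemma admissible_ldeg_eq:
  assumes "admissible s" "square i j k l"
  shows "ldeg (s i) + ldeg (s l) = ldeg (s j) + ldeg (s k)"
proof (rule ccontr)
  assume ne: "\<not> ?thesis"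
  obtain c where c: "c \<noteq> 0" "s i * s l - s j * s k = const c"
    using assms unfolding admissible_def by blast
  note pos = admissible_pos[OF assms(1)]
  have d: "ldeg (s i * s l) = ldeg (s i) + ldeg (s l)" "ldeg (s j * s k) = ldeg (s j) + ldeg (s k)"
    using pos by (simp_all add: ldeg_mult)
  have "0 < ldeg (const c :: laurent)"
  proof (cases "ldeg (s j * s k) < ldeg (s i * s l)")
    case True
    then have "ldeg (s i * s l + - (s j * s k)) = ldeg (s i * s l)"
      using pos by (intro ldeg_add_eq) (auto simp: ldeg_def)
    then show ?thesis using c(2) d pos(2)[of i] pos(2)[of l] by simp
  next
    case False
    then have "ldeg (s i * s l) < ldeg (s j * s k)" using ne d by simp
    then have "ldeg (- (s j * s k) + s i * s l) = ldeg (- (s j * s k))"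
      using pos by (intro ldeg_add_eq) (auto simp: ldeg_def)
    then show ?thesis using c(2) d pos(2)[of j] pos(2)[of k] by (simp add: ldeg_def)
  qed
  then show False using c(1) by simp
qed

lemma sdeg_square:
  assumes "square i j k l"
  shows "sdeg s = ldeg (s i) + ldeg (s j) + ldeg (s k) + ldeg (s l)"
  unfolding sdeg_def
  by (subst square_distinct(7)[OF assms]) (use square_distinct(1-6)[OF assms] in \<open>simp add: add.assoc\<close>)

text \<open>
  By the preceding relation the two modified entries of an elementary operation go up or down together.
\<close>

lemma sdeg_less_iff:
  assumes "admissible s" "admissible t" and sq: "square i j k l" and "ldeg (t i) = ldeg (s i)" "ldeg (t j) = ldeg (s j)"
  shows "sdeg t < sdeg s \<longleftrightarrow> ldeg (t k) < ldeg (s k)"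
proof -
  have "ldeg (s l) = ldeg (s j) + ldeg (s k) - ldeg (s i)" "ldeg (t l) = ldeg (t j) + ldeg (t k) - ldeg (t i)"
    using admissible_ldeg_eq[OF assms(1) sq] admissible_ldeg_eq[OF assms(2) sq] by (simp_all add: algebra_simps)
  then show ?thesis unfolding sdeg_square[OF sq] using assms(4,5) by auto
qed

lemma admissible_sdeg:
  assumes "admissible s"
  obtains d where "mdeg_poly d = sdeg s" "d \<noteq> MInf"
proof -
  have "\<exists>d. d \<noteq> MInf \<and> ldeg (s i) = mdeg_poly d" for i
    using regular_ldeg[OF admissible_regular[OF assms] admissible_pos(1)[OF assms]] by metis
  then obtain e where e: "\<And>i. e i \<noteq> MInf" "\<And>i. ldeg (s i) = mdeg_poly (e i)" by metis
  have ni: "x + y \<noteq> MInf" if "x \<noteq> MInf" "y \<noteq> MInf" for x y using that by (cases x; cases y) auto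
  have "mdeg_poly (e 1 + e 2 + e 3 + e 4) = sdeg s"
    unfolding sdeg_def sum_4 by (simp add: mdeg_poly_add ni e)
  then show ?thesis using that ni e(1) by metis
qed

definition rescale :: "(4 \<Rightarrow> complex) \<Rightarrow> laurent_matrix \<Rightarrow> laurent_matrix" where
  "rescale c s = (\<lambda>i. const (c i) * s i)"

definition scaling :: "(4 \<Rightarrow> complex) \<Rightarrow> bool" where
  "scaling c \<longleftrightarrow> (\<forall>i. c i \<noteq> 0) \<and> (\<forall>i j k l. square i j k l \<longrightarrow> c i * c l = c j * c k)"

lemma scalingI:
  assumes "square i j k l" "c i \<noteq> 0" "c j \<noteq> 0" "c k \<noteq> 0" "c l \<noteq> 0" "c i * c l = c j * c k"
  shows "scaling c"
  unfolding scaling_def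
proof (intro conjI allI impI)
  fix x
  have "x \<in> {i, j, k, l}" using square_distinct(7)[OF assms(1)] by blast
  then show "c x \<noteq> 0" using assms(2-5) by (elim insertE emptyE) simp_all
next
  fix i' j' k' l' assume "square i' j' k' l'"
  from square_orbit[OF assms(1) this] show "c i' * c l' = c j' * c k'"
    using assms(6) by (auto simp: mult.commute)
qed

lemma sdeg_rescale: "scaling c \<Longrightarrow> sdeg (rescale c s) = sdeg s"
  by (simp add: sdeg_def rescale_def scaling_def)

lemma linear_forms_add: "f \<in> linear_forms \<Longrightarrow> g \<in> linear_forms \<Longrightarrow> f + g \<in> linear_forms"
  unfolding linear_forms_def
  by (clarsimp, rule_tac x = "\<lambda>j. c j + ca j" in exI) (simp add: distrib_right sum.distrib)

lemma linear_forms_const_mult: "f \<in> linear_forms \<Longrightarrow> const a * f \<in> linear_forms"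
  unfolding linear_forms_def
  by (clarsimp, rule_tac x = "\<lambda>j. a * c j" in exI) (simp add: sum_distrib_left mult.assoc)

lemma estep_rescale:
  assumes c: "scaling c" and sq: "square i j k l"
  shows "rescale c (estep i j k l u s) = estep i j k l (const (c k / c i) * u) (rescale c s)"
proof (rule square_eqI[OF sq])
  have nz: "c i \<noteq> 0" "c j \<noteq> 0" and eq: "c i * c l = c j * c k"
    using c sq unfolding scaling_def by blast+
  have 1: "c i * (c k / c i) = c k" "c j * (c k / c i) = c l"
    using nz eq by (simp_all add: field_simps)
  have e: "const (c i) * const (c k / c i) = (const (c k) :: laurent)"
    "const (c j) * const (c k / c i) = (const (c l) :: laurent)"
    unfolding const_simps(6)[symmetric] 1 by simp_all
  have assoc: "const x * y * (const z * u) = (const x * const z) * (y * u)" for x z and y :: laurent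
    by (simp only: mult_ac)
  show "rescale c (estep i j k l u s) k = estep i j k l (const (c k / c i) * u) (rescale c s) k"
    "rescale c (estep i j k l u s) l = estep i j k l (const (c k / c i) * u) (rescale c s) l"
    unfolding rescale_def estep_simps[OF sq] assoc e by (simp_all only: distrib_left)
qed (simp_all add: rescale_def estep_simps[OF sq])

lemma reduces_rescale:
  assumes "reduces s" "scaling c"
  shows "reduces (rescale c s)"
  using assms(1)
proof induction
  case (linear s)
  then show ?case by (intro reduces.linear) (simp add: rescale_def linear_forms_const_mult)
next
  case (reduction i j k l u s)
  have nz: "c x \<noteq> 0" for x using assms(2) by (simp add: scaling_def)
  have in': "s x \<in> subalg {rescale c s i, rescale c s j}" if "x = i \<or> x = j" for x
  proof -
    have "s x = const (1 / c x) * rescale c s x"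
      using nz[of x] by (simp add: rescale_def flip: mult.assoc const_simps(6))
    moreover have "rescale c s x \<in> subalg {rescale c s i, rescale c s j}" using that by auto
    ultimately show ?thesis by (metis subalg.const subalg.mult)
  qed
  then have "subalg {s i, s j} \<subseteq> subalg {rescale c s i, rescale c s j}"
    by (intro subalg_subset) auto
  then have u: "const (c k / c i) * u \<in> subalg {rescale c s i, rescale c s j}"
    using reduction.hyps(2) by (intro subalg.mult subalg.const) blast
  note eq = estep_rescale[OF assms(2) reduction.hyps(1)]
  show ?case
  proof (rule reduces.reduction[OF reduction.hyps(1) u])
    show "sdeg (estep i j k l (const (c k / c i) * u) (rescale c s)) < sdeg (rescale c s)"
      using reduction.hyps(3) unfolding eq[symmetric] sdeg_rescale[OF assms(2)] .
    show "reduces (estep i j k l (const (c k / c i) * u) (rescale c s))"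
      using reduction.IH unfolding eq[symmetric] .
  qed
qed

lemma reduces_perm:
  assumes "reduces s" and inv: "\<And>x. p (p x) = x"
    and sq: "\<And>i j k l. square i j k l \<Longrightarrow> square (p i) (p j) (p k) (p l)"
  shows "reduces (s \<circ> p)"
  using assms(1)
proof induction
  case (linear s)
  then show ?case by (intro reduces.linear) simp
next
  case (reduction i j k l u s)
  have bij: "bij p" using inv by (metis bijI')
  have sd: "sdeg (t \<circ> p) = sdeg t" for t
    unfolding sdeg_def using sum.reindex_bij_betw[OF bij, of "\<lambda>x. ldeg (t x)"] by simp
  note sq' = sq[OF reduction.hyps(1)]
  have eq: "estep i j k l u s \<circ> p = estep (p i) (p j) (p k) (p l) u (s \<circ> p)"
    by (rule square_eqI[OF sq']) (simp_all add: estep_simps[OF sq'] estep_simps[OF reduction.hyps(1)] inv)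
  show ?case
  proof (rule reduces.reduction[OF sq', of u])
    show "u \<in> subalg {(s \<circ> p) (p i), (s \<circ> p) (p j)}" using reduction.hyps(2) by (simp add: inv)
    show "sdeg (estep (p i) (p j) (p k) (p l) u (s \<circ> p)) < sdeg (s \<circ> p)"
      using reduction.hyps(3) unfolding eq[symmetric] sd .
    show "reduces (estep (p i) (p j) (p k) (p l) u (s \<circ> p))"
      using reduction.IH unfolding eq[symmetric] .
  qed
qed

section \<open>Elementary operations preserve reducibility\<close>

lemma ldeg_eq_of_cancellation:
  assumes "f + g * u \<noteq> 0" "ldeg (f + g * u) < ldeg f" "f \<noteq> 0" "g \<noteq> 0"
  shows "u \<noteq> 0" "ldeg g + ldeg u = ldeg (f :: laurent)"
proof -
  show u: "u \<noteq> 0" using assms(2) by auto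
  have "ldeg (- f + (f + g * u)) = ldeg (- f)"
    using assms by (intro ldeg_add_eq) (auto simp: ldeg_def)
  then have "ldeg (g * u) = ldeg f" by (simp add: ldeg_def)
  then show "ldeg g + ldeg u = ldeg f" using assms(4) u by (simp add: ldeg_mult)
qed

lemma ldeg_increment_le:
  assumes "ldeg (f + g * u) \<le> ldeg f" "f \<noteq> 0" "g \<noteq> 0" "u \<noteq> 0"
  shows "ldeg g + ldeg u \<le> ldeg (f :: laurent)"
proof (rule ccontr)
  assume "\<not> ?thesis"
  then have "ldeg f < ldeg (g * u)" using assms by (simp add: ldeg_mult)
  then have "ldeg (g * u + f) = ldeg (g * u)" using assms by (intro ldeg_add_eq) auto
  then show False using \<open>ldeg f < ldeg (g * u)\<close> assms(1) by (simp add: add.commute)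
qed

lemma subalg_in_regular:
  assumes "admissible s" "u \<in> subalg {s i, s j}"
  shows "u \<in> regular"
  using subalg_regular[OF _ assms(2)] assms(1) by auto

text \<open>
  Adding \<open>s i * u\<close> to \<open>s k\<close> and adding \<open>s i * h\<close> to \<open>s j\<close> commute as operations on the matrix. Both orders consist of
  elementary operations as soon as one of \<open>u\<close>, \<open>h\<close> involves \<open>s i\<close> only: then \<open>h\<close> is still a polynomial in the first
  column after the row operation, and \<open>u\<close> one in the first row after the column operation.
\<close>

lemma reduces_estep_diamond:
  assumes s: "admissible s" and sq: "square i j k l"
    and u: "u \<in> subalg {s i, s j}" and h: "h \<in> subalg {s i, s k}"
    and uh: "u \<in> subalg {s i} \<or> h \<in> subalg {s i}"
    and less: "sdeg (estep i k j l h s) < sdeg s"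
    and reduces: "\<And>v. v \<in> subalg {s i, s j + s i * h} \<Longrightarrow> reduces (estep i j k l v (estep i k j l h s))"
  shows "reduces (estep i j k l u s)"
proof -
  let ?s0 = "estep i k j l h s" and ?s1 = "estep i j k l u s"
  note sq2 = square_sym(4)[OF sq]
  note simps = estep_simps[OF sq] estep_simps[OF sq2]
  have "s j = (s j + s i * h) - s i * h" by simp
  moreover have "(s j + s i * h) - s i * h \<in> subalg {s i, s j + s i * h}" if "h \<in> subalg {s i}"
    using that subalg_subset[of "{s i}" "{s i, s j + s i * h}"] by (intro subalg_diff subalg.mult) auto
  ultimately have sj: "s j \<in> subalg {s i, s j + s i * h}" if "h \<in> subalg {s i}" using that by simp
  have u0: "u \<in> subalg {s i, s j + s i * h}"
  proof (cases "u \<in> subalg {s i}")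
    case True
    then show ?thesis using subalg_subset[of "{s i}" "{s i, s j + s i * h}"] by auto
  next
    case False
    then have "subalg {s i, s j} \<subseteq> subalg {s i, s j + s i * h}"
      using sj uh by (intro subalg_subset) auto
    then show ?thesis using u by blast
  qed
  have "s k = (s k + s i * u) - s i * u" by simp
  moreover have "(s k + s i * u) - s i * u \<in> subalg {s i, s k + s i * u}" if "u \<in> subalg {s i}"
    using that subalg_subset[of "{s i}" "{s i, s k + s i * u}"] by (intro subalg_diff subalg.mult) auto
  ultimately have sk: "s k \<in> subalg {s i, s k + s i * u}" if "u \<in> subalg {s i}" using that by simp
  have h1: "h \<in> subalg {s i, s k + s i * u}"
  proof (cases "h \<in> subalg {s i}")
    case True
    then show ?thesis using subalg_subset[of "{s i}" "{s i, s k + s i * u}"] by auto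
  next
    case False
    then have "subalg {s i, s k} \<subseteq> subalg {s i, s k + s i * u}"
      using sk uh by (intro subalg_subset) auto
    then show ?thesis using h by blast
  qed
  have comm: "estep i j k l u ?s0 = estep i k j l h ?s1"
    by (rule square_eqI[OF sq]) (simp_all add: simps algebra_simps)
  have v0: "admissible ?s0" and v1: "admissible ?s1" using admissible_estep[OF s sq2 h] admissible_estep[OF s sq u] .
  have v2: "admissible (estep i k j l h ?s1)"
    using h1 by (intro admissible_estep[OF v1 sq2]) (simp add: simps)
  have "ldeg (?s0 j) < ldeg (s j)"
    using less sdeg_less_iff[OF s v0 sq2] by (simp add: simps)
  then have "sdeg (estep i k j l h ?s1) < sdeg ?s1"
    using sdeg_less_iff[OF v1 v2 sq2] by (simp add: simps)
  moreover have "reduces (estep i k j l h ?s1)" using reduces[OF u0] unfolding comm .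
  ultimately show ?thesis using h1 by - (rule reduces.reduction[OF sq2, of h ?s1], simp_all add: simps)
qed

text \<open>
  A row operation that does not raise the degree against a column operation that lowers it. If neither \<open>u\<close> nor \<open>h\<close>
  is a polynomial in \<open>s i\<close> and neither \<open>s j\<close> nor \<open>s k\<close> has a degree that is a multiple of that of \<open>s i\<close>, the key
  inequality gives both that \<open>s j\<close> has larger degree than \<open>s k\<close> and the converse. In the other cases some
  polynomial in \<open>s i\<close> alone does the job of \<open>u\<close> or \<open>h\<close>, and the two operations commute.
\<close>

lemma reduces_estep_adjacent:
  assumes s: "admissible s" and sq: "square i j k l" and u: "u \<in> subalg {s i, s j}" "u \<noteq> 0"
    and h: "h \<in> subalg {s i, s k}"
    and s0: "reduces (estep i k j l h s)" "sdeg (estep i k j l h s) < sdeg s"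
    and le: "ldeg (s i) + ldeg u \<le> ldeg (s k)"
    and IH: "\<And>t i j k l u. admissible t \<Longrightarrow> reduces t \<Longrightarrow> sdeg t < sdeg s \<Longrightarrow> square i j k l \<Longrightarrow>
      u \<in> subalg {t i, t j} \<Longrightarrow> reduces (estep i j k l u t)"
  shows "reduces (estep i j k l u s)"
proof -
  note sq2 = square_sym(4)[OF sq]
  note simps = estep_simps[OF sq] estep_simps[OF sq2]
  let ?s0 = "estep i k j l h s"
  note pos = admissible_pos[OF s]
  have v0: "admissible ?s0" by (rule admissible_estep[OF s sq2 h])
  have diamond: "reduces (estep i j k l u' s)"
    if "u' \<in> subalg {s i, s j}" "h' \<in> subalg {s i, s k}" "u' \<in> subalg {s i} \<or> h' \<in> subalg {s i}"
      "sdeg (estep i k j l h' s) < sdeg s" "reduces (estep i k j l h' s)" for u' h'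
    using that(4,5) admissible_estep[OF s sq2 that(2)]
    by (intro reduces_estep_diamond[OF s sq that(1-4)] IH[OF _ _ _ sq]) (simp_all add: simps)
  have nonneg: "0 \<le> ldeg f" if "f \<in> subalg {s i, s j} \<or> f \<in> subalg {s i, s k}" "f \<noteq> 0" for f
    using regular_ldeg_nonneg subalg_in_regular[OF s] that by blast
  have s0j: "ldeg (s j + s i * h) < ldeg (s j)" "s j + s i * h \<noteq> 0"
    using s0(2) sdeg_less_iff[OF s v0 sq2] admissible_pos(1)[OF v0, of j] by (simp_all add: simps)
  note hdeg = ldeg_eq_of_cancellation[OF s0j(2,1) pos(1) pos(1)]
  have Pk: "ldeg (s i) \<le> ldeg (s k)" using le nonneg[of u] u by simp
  have Pj: "ldeg (s i) \<le> ldeg (s j)" using hdeg(2) nonneg[of h] h hdeg(1) by simp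
  have mono: "subalg {s i} \<subseteq> subalg {s i, x}" for x
    by (intro subalg_subset) auto
  \<comment> \<open>An entry whose degree is a multiple of that of \<open>s i\<close> has the leading term of a power of \<open>s i\<close>.\<close>
  have cancel: "\<exists>w\<in>subalg {s i}. s x + s i * w = 0 \<or> ldeg (s x + s i * w) < ldeg (s x)"
    if n: "ldeg (s x) = of_nat n * ldeg (s i)" for x n
  proof -
    have "n \<noteq> 0" using n pos(2)[of x] by (cases n) auto
    then obtain m where m: "n = Suc m" by (cases n) auto
    have "ldeg (s x) = ldeg (s i ^ n)" using n pos(1) by (simp add: ldeg_power)
    then obtain c where c: "s x - const c * s i ^ n = 0 \<or> ldeg (s x - const c * s i ^ n) < ldeg (s x)"
      using ldeg_cancel[of "s x" "s i ^ n"] pos(1) by auto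
    have "s x + s i * (const (- c) * s i ^ m) = s x - const c * s i ^ n"
      by (simp add: m algebra_simps)
    then have "s x + s i * (const (- c) * s i ^ m) = 0 \<or> ldeg (s x + s i * (const (- c) * s i ^ m)) < ldeg (s x)"
      using c by metis
    moreover have "const (- c) * s i ^ m \<in> subalg {s i}" by (intro subalg.mult subalg.const subalg_power) auto
    ultimately show ?thesis by blast
  qed
  consider "u \<in> subalg {s i} \<or> h \<in> subalg {s i}" | n where "ldeg (s k) = of_nat n * ldeg (s i)"
    | n where "ldeg (s j) = of_nat n * ldeg (s i)"
    | "u \<notin> subalg {s i}" "h \<notin> subalg {s i}" "\<And>n. ldeg (s k) \<noteq> of_nat n * ldeg (s i)"
      "\<And>n. ldeg (s j) \<noteq> of_nat n * ldeg (s i)"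
    by blast
  then show ?thesis
  proof cases
    case 1
    then show ?thesis using diamond[OF u(1) h] s0 by blast
  next
    case (2 n)
    then obtain w where w: "w \<in> subalg {s i}" "s k + s i * w = 0 \<or> ldeg (s k + s i * w) < ldeg (s k)"
      using cancel by blast
    let ?t = "estep i j k l w s"
    have w': "w \<in> subalg {s i, s j}" using w(1) mono by blast
    have vt: "admissible ?t" by (rule admissible_estep[OF s sq w'])
    then have "ldeg (?t k) < ldeg (s k)" using w(2) admissible_pos(1)[OF vt, of k] by (simp add: simps)
    then have "sdeg ?t < sdeg s" using sdeg_less_iff[OF s vt sq] by (simp add: simps)
    moreover have "reduces ?t" using diamond[OF w' h] w(1) s0 by blast
    moreover have "u - w \<in> subalg {?t i, ?t j}" using u(1) w' by (auto simp: simps)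
    ultimately have "reduces (estep i j k l (u - w) ?t)" by (intro IH[OF vt _ _ sq])
    then show ?thesis by (simp add: estep_estep[OF sq])
  next
    case (3 n)
    then obtain w where w: "w \<in> subalg {s i}" "s j + s i * w = 0 \<or> ldeg (s j + s i * w) < ldeg (s j)"
      using cancel by blast
    let ?t = "estep i k j l w s"
    have w': "w \<in> subalg {s i, s k}" using w(1) mono by blast
    have vt: "admissible ?t" by (rule admissible_estep[OF s sq2 w'])
    then have "ldeg (?t j) < ldeg (s j)" using w(2) admissible_pos(1)[OF vt, of j] by (simp add: simps)
    then have "sdeg ?t < sdeg s" using sdeg_less_iff[OF s vt sq2] by (simp add: simps)
    moreover have "w - h \<in> subalg {?s0 i, ?s0 k}" using h w' by (auto simp: simps)
    then have "reduces (estep i k j l (w - h) ?s0)" by (intro IH[OF v0 s0 sq2])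
    then have "reduces ?t" by (simp add: estep_estep[OF sq2])
    ultimately show ?thesis using diamond[OF u(1) w'] w(1) by blast
  next
    case 4
    have "vol (s i) (s k) (s j) \<noteq> 0" "vol (s i) (s j) (s k) \<noteq> 0" using s sq sq2 by (auto simp: admissible_def)
    then have "ldeg (s k) < ldeg (s i) + ldeg h" "ldeg (s j) < ldeg (s i) + ldeg u"
      using ldeg_subalg_gt[of "s i" "s k" "s j" h] ldeg_subalg_gt[of "s i" "s j" "s k" u]
        s Pk Pj 4 u h by auto
    then show ?thesis using hdeg(2) le by simp
  qed
qed

text \<open>
  Two row operations in opposite directions, or two column operations. Comparing degrees forces \<open>u\<close> and \<open>v\<close> to be
  nonzero constants \<open>b\<close> and \<open>c\<close>, and the rows \<open>r\<^sub>1\<close>, \<open>r\<^sub>2\<close> to have equal degrees, while \<open>r\<^sub>1 + c r\<^sub>2\<close> has smaller degree. If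
  \<open>b c = 1\<close>, the new second row is a multiple of \<open>r\<^sub>1 + c r\<^sub>2\<close> and the new matrix is, up to exchanging and rescaling
  the rows, obtained from the reduced one. Otherwise a multiple of the new second row can be added to the first
  to make it proportional to \<open>r\<^sub>1 + c r\<^sub>2\<close>.
\<close>

lemma reduces_estep_opposite:
  assumes s: "admissible s" and sq: "square i j k l" and u: "u \<in> subalg {s i, s j}" "u \<noteq> 0"
    and v: "v \<in> subalg {s k, s l}"
    and s0: "reduces (estep k l i j v s)" "sdeg (estep k l i j v s) < sdeg s"
    and le: "ldeg (s i) + ldeg u \<le> ldeg (s k)"
    and IH: "\<And>t i j k l u. admissible t \<Longrightarrow> reduces t \<Longrightarrow> sdeg t < sdeg s \<Longrightarrow> square i j k l \<Longrightarrow>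
      u \<in> subalg {t i, t j} \<Longrightarrow> reduces (estep i j k l u t)"
  shows "reduces (estep i j k l u s)"
proof -
  note sq2 = square_sym(2)[OF sq]
  note simps = estep_simps[OF sq] estep_simps[OF sq2]
  let ?s0 = "estep k l i j v s" and ?s1 = "estep i j k l u s"
  note pos = admissible_pos[OF s]
  have v0: "admissible ?s0" by (rule admissible_estep[OF s sq2 v])
  have v1: "admissible ?s1" by (rule admissible_estep[OF s sq u(1)])
  have s0i: "ldeg (s i + s k * v) < ldeg (s i)" "s i + s k * v \<noteq> 0"
    using s0(2) sdeg_less_iff[OF s v0 sq2] admissible_pos(1)[OF v0, of i] by (simp_all add: simps)
  note vdeg = ldeg_eq_of_cancellation[OF s0i(2,1) pos(1) pos(1)]
  have nn: "0 \<le> ldeg u" "0 \<le> ldeg v"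
    using regular_ldeg_nonneg subalg_in_regular[OF s] u v vdeg(1) by blast+
  then have "ldeg u \<le> 0" "ldeg v \<le> 0" using vdeg(2) le by simp_all
  then obtain b c where bc: "u = const b" "v = const c"
    using regular_ldeg_0 subalg_in_regular[OF s] u(1) v by metis
  have b: "b \<noteq> 0" and c: "c \<noteq> 0" using u(2) vdeg(1) bc by auto
  have step: "reduces (rescale d (estep i j k l (const e) ?s0))" if "scaling d" for d e
    using IH[OF v0 s0 sq, of "const e"] that by (intro reduces_rescale) auto
  show ?thesis
  proof (cases "b * c = 1")
    case True
    define p where "p x = (if x = i then k else if x = k then i else if x = j then l else j)" for x
    have p: "p i = k" "p k = i" "p j = l" "p l = j"
      using square_distinct[OF sq] by (auto simp: p_def)
    have pp: "p (p x) = x" for x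
    proof -
      have "x \<in> {i, j, k, l}" using square_distinct(7)[OF sq] by blast
      then show ?thesis by (elim insertE emptyE) (simp_all add: p)
    qed
    have psq: "square (p i') (p j') (p k') (p l')" if "square i' j' k' l'" for i' j' k' l'
      using square_orbit[OF sq that] square_sym[OF sq] sq by (elim insertE emptyE) (simp_all add: p)
    define d where "d x = (if x = i \<or> x = j then b else - c)" for x
    have d: "d i = b" "d j = b" "d k = - c" "d l = - c"
      using square_distinct[OF sq] by (auto simp: d_def)
    have sc: "scaling d" by (rule scalingI[OF sq]) (use b c in \<open>simp_all add: d\<close>)
    have bc1: "const b * const c = (1 :: laurent)" using True by (simp add: const_mult_eq_iff)
    have e1: "const b * (x + y * const c) = y + x * const b" for x y :: laurent
    proof -
      have "const b * (x + y * const c) = (const b * const c) * y + x * const b" by (simp only: algebra_simps)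
      then show ?thesis unfolding bc1 by (simp add: add.commute)
    qed
    have e2: "const (- c) * (y + (x + y * const c) * const (- b)) = x" for x y :: laurent
    proof -
      have "const (- c) * (y + (x + y * const c) * const (- b))
        = (const b * const c) * x + const c * y * (const b * const c - 1)"
        by (simp add: algebra_simps)
      then show ?thesis unfolding bc1 by simp
    qed
    have eq: "?s1 = rescale d (estep i j k l (const (- b)) ?s0) \<circ> p"
      by (rule square_eqI[OF sq]) (simp_all only: o_def p rescale_def simps d bc e1 e2)
    show ?thesis unfolding eq by (rule reduces_perm[OF step[OF sc] pp psq])
  next
    case False
    \<comment> \<open>The factor that makes \<open>(1 + c m b) r\<^sub>1 + c m r\<^sub>2\<close> proportional to \<open>r\<^sub>1 + c r\<^sub>2\<close>.\<close>
    define m where "m = 1 / (1 - b * c)"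
    have m: "m \<noteq> 0" "(1 - b * c) * m = 1" using False by (simp_all add: m_def)
    define d where "d x = (if x = i \<or> x = j then m else 1 - b * c)" for x
    have d: "d i = m" "d j = m" "d k = 1 - b * c" "d l = 1 - b * c"
      using square_distinct[OF sq] by (auto simp: d_def)
    have sc: "scaling d" by (rule scalingI[OF sq]) (use m False in \<open>simp_all add: d\<close>)
    let ?t = "estep k l i j (const (c * m)) ?s1"
    have m1: "m = 1 + b * c * m" using m(2) by (simp add: algebra_simps)
    have cm: "const m = (1 + const b * const c * const m :: laurent)"
      using arg_cong[OF m1, of "const :: complex \<Rightarrow> laurent"] by simp
    have e1: "x + (y + x * const b) * const (c * m) = const m * (x + y * const c)" for x y :: laurent
    proof -
      have "x + (y + x * const b) * const (c * m) = x * (1 + const b * const c * const m) + y * const c * const m"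
        by (simp add: algebra_simps)
      then show ?thesis unfolding cm[symmetric] by (simp add: algebra_simps)
    qed
    have e2: "const (1 - b * c) * (y + (x + y * const c) * const (b * m)) = y + x * const b" for x y :: laurent
    proof -
      have mm: "const (1 - b * c) * const m = (1 :: laurent)" using m(2) by (simp only: const_mult_eq_iff)
      have "e * (y + (x + y * c') * (b' * m')) = e * y + (e * m') * (x * b' + y * c' * b')" for e b' c' m' :: laurent
        by (simp add: algebra_simps)
      then have "const (1 - b * c) * (y + (x + y * const c) * (const b * const m))
        = const (1 - b * c) * y + (x * const b + y * const c * const b)"
        by (metis mm mult_1)
      also have "\<dots> = y + x * const b" by (simp add: algebra_simps)
      finally show ?thesis by (simp only: const_simps(6))
    qed
    have eqt: "?t = rescale d (estep i j k l (const (b * m)) ?s0)"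
      by (rule square_eqI[OF sq]) (simp_all only: rescale_def simps d bc e1 e2)
    have gt: "reduces ?t" unfolding eqt by (rule step[OF sc])
    have vt: "admissible ?t" by (rule admissible_estep[OF v1 sq2 subalg.const])
    have "ldeg (?t i) = ldeg (?s0 i)"
      using m(1) by (simp only: simps bc e1) simp
    then have "ldeg (?t i) < ldeg (?s1 i)" using s0i by (simp add: simps)
    then have "sdeg ?t < sdeg ?s1" using sdeg_less_iff[OF v1 vt sq2] by (simp add: simps)
    then show ?thesis using gt by - (rule reduces.reduction[OF sq2, of "const (c * m)"], simp_all only: subalg.const)
  qed
qed

lemma lookup_linear_form:
  assumes "f = (\<Sum>j\<in>UNIV. const (c j) * xi j)" "i \<noteq> 4 \<or> True"
  shows "Poly_Mapping.lookup f (xdeg i) = c i"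
proof -
  have "Poly_Mapping.lookup (xi j) (xdeg i) = (if i = j then 1 else 0)" for j
  proof -
    have "\<forall>i j. Poly_Mapping.lookup (xi j) (xdeg i) = (if i = j then 1 else 0)"
      unfolding forall_4 xi_simps xdeg_simps by (simp add: lookup_add lookup_single when_def)
    then show ?thesis by blast
  qed
  then have "Poly_Mapping.lookup (const (c j) * xi j) (xdeg i) = (if i = j then c j else 0)" for j
    by simp
  then show ?thesis unfolding assms(1) by (simp add: lookup_sum)
qed

lemma linear_form_ldeg_le:
  assumes "f \<in> linear_forms" "f \<noteq> 0"
  shows "ldeg f \<le> xdeg 3"
proof -
  obtain c where c: "f = (\<Sum>j\<in>UNIV. const (c j) * xi j)" using assms(1) by (auto simp: linear_forms_def)
  have "\<forall>i. xdeg i \<le> xdeg 3" unfolding forall_4 xdeg_simps by (simp add: pCons3_le_iff)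
  then have "below (const (c j) * xi j) (xdeg 3)" for j
    by (intro below_const_mult below_mono[OF xi_top(1)]) blast
  then have "below f (xdeg 3)" unfolding c sum_4 by (intro below_add)
  then show ?thesis using assms(2) by (rule below_imp_ldeg_le)
qed

lemma linear_form_ldeg_less:
  assumes "f \<in> linear_forms" "ldeg f < xdeg 1"
  shows "\<exists>c. f = const c * xi 2"
proof -
  obtain c where c: "f = (\<Sum>j\<in>UNIV. const (c j) * xi j)" using assms(1) by (auto simp: linear_forms_def)
  have "c i = 0" if "xdeg 1 \<le> xdeg i" for i
  proof (rule ccontr)
    assume "c i \<noteq> 0"
    then have "xdeg i \<le> ldeg f" using lookup_linear_form[OF c] by (intro ldeg_ge) simp
    then show False using assms(2) that by simp
  qed
  then have "c 1 = 0" "c 3 = 0" "c 4 = 0" by (simp_all add: xdeg_simps pCons3_le_iff)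
  then show ?thesis unfolding c sum_4 by auto
qed

text \<open>
  A nonconstant \<open>u\<close> has degree at least the weight of \<open>x\<^sub>2\<close>, and two independent linear forms cannot both have
  degree below the weight of \<open>x\<^sub>1\<close>. The sum of these two weights exceeds the weight of \<open>x\<^sub>3\<close>, the largest degree of a
  linear form.
\<close>

lemma reduces_estep_linear:
  assumes s: "admissible s" "\<And>x. s x \<in> linear_forms" and sq: "square i j k l" and u: "u \<in> subalg {s i, s j}" "u \<noteq> 0"
    and le: "ldeg (s i) + ldeg u \<le> ldeg (s k)" "ldeg (s j) + ldeg u \<le> ldeg (s l)"
  shows "reduces (estep i j k l u s)"
proof (cases "ldeg u < xdeg 2")
  case True
  then obtain a where a: "u = const a"
    using regular_le_xdeg2[OF subalg_in_regular[OF s(1) u(1)]] by fastforce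
  have "estep i j k l u s x \<in> linear_forms" for x
    using s(2) by (auto simp: estep_def a mult.commute[of _ "const a"] intro!: linear_forms_add linear_forms_const_mult)
  then show ?thesis by (rule reduces.linear)
next
  case False
  have "vol (s i) (s j) (s k) \<noteq> 0" using s sq by (auto simp: admissible_def)
  have "\<not> (ldeg (s i) < xdeg 1 \<and> ldeg (s j) < xdeg 1)"
  proof
    assume "ldeg (s i) < xdeg 1 \<and> ldeg (s j) < xdeg 1"
    then obtain a b where ab: "s i = const a * xi 2" "s j = const b * xi 2"
      using linear_form_ldeg_less s(2) by meson
    have "vol (s i) (s j) (s k) = 0"
      unfolding ab vol_def by (simp add: lder_simps algebra_simps)
    then show False using \<open>vol (s i) (s j) (s k) \<noteq> 0\<close> by simp
  qed
  moreover have "\<not> xdeg 1 + xdeg 2 \<le> xdeg 3" by (simp add: xdeg_simps pCons3_le_iff)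
  moreover have "ldeg (s k) \<le> xdeg 3" "ldeg (s l) \<le> xdeg 3"
    using linear_form_ldeg_le s admissible_pos(1) by auto
  ultimately show ?thesis using le False by (smt (verit) add_mono not_less order_trans)
qed

text \<open>
  Induction on the degree. An operation that raises the degree is undone by a reduction. Otherwise it is compared
  with the first step of a given sequence of reductions, which is of the same, opposite or adjacent type.
\<close>

theorem reduces_estep:
  assumes "admissible s" "reduces s" "square i j k l" "u \<in> subalg {s i, s j}"
  shows "reduces (estep i j k l u s)"
proof -
  obtain d where "mdeg_poly d = sdeg s" using admissible_sdeg[OF assms(1)] by blast
  then show ?thesis
    using assms
  proof (induction d arbitrary: s i j k l u rule: less_induct)
    case (less d)
    note s = less.prems(2) and sq = less.prems(4) and u = less.prems(5)
    have IH: "reduces (estep i j k l u t)"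
      if t: "admissible t" "reduces t" "sdeg t < sdeg s" "square i j k l" "u \<in> subalg {t i, t j}" for t i j k l u
    proof -
      obtain e where e: "mdeg_poly e = sdeg t" using admissible_sdeg[OF t(1)] by blast
      then have "e < d" using t(3) less.prems(1) by (simp add: mdeg_poly_less_iff[symmetric])
      then show ?thesis using less.IH[OF _ e t(1,2,4,5)] by blast
    qed
    let ?s' = "estep i j k l u s"
    have v': "admissible ?s'" by (rule admissible_estep[OF s sq u])
    note simps = estep_simps[OF sq]
    consider "u = 0" | "sdeg s < sdeg ?s'" | "u \<noteq> 0" "\<not> sdeg s < sdeg ?s'" by blast
    then show ?case
    proof cases
      case 1
      then show ?thesis using less.prems(3) by simp
    next
      case 2
      have "estep i j k l (- u) ?s' = s" by (simp add: estep_estep[OF sq])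
      then show ?thesis
        using 2 less.prems(3) subalg_uminus[OF u] by - (rule reduces.reduction[OF sq, of "- u"], simp_all add: simps)
    next
      case 3
      have "ldeg (?s' k) \<le> ldeg (s k)" using 3(2) sdeg_less_iff[OF v' s sq] by (simp add: simps)
      then have lek: "ldeg (s i) + ldeg u \<le> ldeg (s k)"
        using ldeg_increment_le[of "s k" "s i" u] admissible_pos(1)[OF s] 3(1) by (simp add: simps)
      have "ldeg (?s' l) \<le> ldeg (s l)"
        using 3(2) sdeg_less_iff[OF v' s square_sym(1)[OF sq]] by (simp add: simps)
      then have lel: "ldeg (s j) + ldeg u \<le> ldeg (s l)"
        using ldeg_increment_le[of "s l" "s j" u] admissible_pos(1)[OF s] 3(1) by (simp add: simps)
      show ?thesis
        using less.prems(3)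
      proof cases
        case linear
        then show ?thesis using reduces_estep_linear[OF s _ sq u 3(1) lek lel] by blast
      next
        case (reduction i0 j0 k0 l0 v)
        note red = reduction
        have same: ?thesis if "v' \<in> subalg {s i, s j}" "reduces (estep i j k l v' s)" "sdeg (estep i j k l v' s) < sdeg s" for v'
        proof -
          have "u - v' \<in> subalg {estep i j k l v' s i, estep i j k l v' s j}"
            using u that(1) by (auto simp: simps)
          then have "reduces (estep i j k l (u - v') (estep i j k l v' s))"
            using IH[OF admissible_estep[OF s sq that(1)] that(2,3) sq] by blast
          then show ?thesis by (simp add: estep_estep[OF sq])
        qed
        note sym = square_sym[OF sq]
        have u': "u \<in> subalg {s j, s i}" using u by (simp add: insert_commute)
        have opp: ?thesis if "v' \<in> subalg {s k, s l}" "reduces (estep k l i j v' s)" "sdeg (estep k l i j v' s) < sdeg s" for v'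
          by (rule reduces_estep_opposite[OF s sq u 3(1) that lek]) (rule IH)
        have adj1: ?thesis if "v' \<in> subalg {s i, s k}" "reduces (estep i k j l v' s)" "sdeg (estep i k j l v' s) < sdeg s" for v'
          by (rule reduces_estep_adjacent[OF s sq u 3(1) that lek]) (rule IH)
        have "reduces (estep j i l k u s)"
          if "v' \<in> subalg {s j, s l}" "reduces (estep j l i k v' s)" "sdeg (estep j l i k v' s) < sdeg s" for v'
          by (rule reduces_estep_adjacent[OF s sym(1) u' 3(1) that lel]) (rule IH)
        then have adj2: ?thesis
          if "v' \<in> subalg {s j, s l}" "reduces (estep j l i k v' s)" "sdeg (estep j l i k v' s) < sdeg s" for v'
          using that by (simp only: estep_swap[OF sq])
        note ins = insert_commute[of "s j" "s i"] insert_commute[of "s l" "s k"] insert_commute[of "s k" "s i"] insert_commute[of "s l" "s j"]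
        from square_orbit[OF sq red(1)] show ?thesis
        proof (elim insertE emptyE)
          assume "(i0, j0, k0, l0) = (i, j, k, l)"
          then show ?thesis using red(2-4) by (intro same[of v]) (simp_all only: prod.inject ins)
        next
          assume "(i0, j0, k0, l0) = (j, i, l, k)"
          then show ?thesis using red(2-4) by (intro same[of v]) (simp_all only: prod.inject ins estep_swap[OF sq])
        next
          assume "(i0, j0, k0, l0) = (k, l, i, j)"
          then show ?thesis using red(2-4) by (intro opp[of v]) (simp_all only: prod.inject ins)
        next
          assume "(i0, j0, k0, l0) = (l, k, j, i)"
          then show ?thesis using red(2-4) by (intro opp[of v]) (simp_all only: prod.inject ins estep_swap[OF sym(2)])
        next
          assume "(i0, j0, k0, l0) = (i, k, j, l)"
          then show ?thesis using red(2-4) by (intro adj1[of v]) (simp_all only: prod.inject ins)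
        next
          assume "(i0, j0, k0, l0) = (k, i, l, j)"
          then show ?thesis using red(2-4) by (intro adj1[of v]) (simp_all only: prod.inject ins estep_swap[OF sym(4)])
        next
          assume "(i0, j0, k0, l0) = (j, l, i, k)"
          then show ?thesis using red(2-4) by (intro adj2[of v]) (simp_all only: prod.inject ins)
        next
          assume "(i0, j0, k0, l0) = (l, j, k, i)"
          then show ?thesis using red(2-4) by (intro adj2[of v]) (simp_all only: prod.inject ins estep_swap[OF sym(6)])
        qed
      qed
    qed
  qed
qed

section \<open>Linear substitutions preserving the quadratic form\<close>

text \<open>
  Invariance under linear substitutions is deduced from invariance under elementary operations, rescalings and
  symmetries of the square, by Gaussian elimination on the coefficient matrix.
\<close>

definition reducing :: "laurent_matrix \<Rightarrow> bool" where
  "reducing s \<longleftrightarrow> admissible s \<and> reduces s"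

lemma reducing_estep:
  "reducing s \<Longrightarrow> square i j k l \<Longrightarrow> u \<in> subalg {s i, s j} \<Longrightarrow> reducing (estep i j k l u s)"
  by (simp add: reducing_def admissible_estep reduces_estep)

lemma reducing_rescale:
  assumes "reducing s" "scaling c"
  shows "reducing (rescale c s)"
proof -
  have s: "admissible s" using assms(1) by (simp add: reducing_def)
  have "(\<exists>d. d \<noteq> 0 \<and> rescale c s i * rescale c s l - rescale c s j * rescale c s k = const d)
      \<and> vol (rescale c s i) (rescale c s j) (rescale c s k) \<noteq> 0" if sq: "square i j k l" for i j k l
  proof -
    obtain d where d: "d \<noteq> 0" "s i * s l - s j * s k = const d" and v: "vol (s i) (s j) (s k) \<noteq> 0"
      using s sq unfolding admissible_def by blast
    have c: "c x \<noteq> 0" "c i * c l = c j * c k" for x using assms(2) sq by (auto simp: scaling_def)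
    have "const (c i) * s i * (const (c l) * s l) - const (c j) * s j * (const (c k) * s k)
      = const (c i * c l) * (s i * s l) - const (c j * c k) * (s j * s k)"
      by simp
    also have "\<dots> = const (c i * c l) * (s i * s l - s j * s k)"
      unfolding c(2) by (simp only: right_diff_distrib)
    finally have "rescale c s i * rescale c s l - rescale c s j * rescale c s k = const (c i * c l * d)"
      unfolding rescale_def d(2) by (simp only: const_simps(6))
    moreover have "vol (const a * f) (const b * g) (const e * h) = const (a * b * e) * vol f g h" for a b e f g h
      by (simp add: vol_def lder_simps algebra_simps)
    ultimately show ?thesis
      using c(1) d(1) v unfolding rescale_def by (intro conjI exI[of _ "c i * c l * d"]) simp_all
  qed
  then have "admissible (rescale c s)" using s unfolding admissible_def by (auto simp: rescale_def)
  then show ?thesis using assms reduces_rescale by (simp add: reducing_def)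
qed

definition square_perm :: "(4 \<Rightarrow> 4) \<Rightarrow> bool" where
  "square_perm p \<longleftrightarrow> (\<forall>x. p (p x) = x) \<and> (\<forall>i j k l. square i j k l \<longrightarrow> square (p i) (p j) (p k) (p l))"

lemma reducing_perm: "reducing s \<Longrightarrow> square_perm p \<Longrightarrow> reducing (s \<circ> p)"
proof -
  assume s: "reducing s" and p: "square_perm p"
  then have "reduces (s \<circ> p)" using reduces_perm[of s p] by (auto simp: reducing_def square_perm_def)
  moreover have "admissible (s \<circ> p)"
    unfolding admissible_def o_def
  proof (intro conjI allI impI)
    fix i j k l assume "square i j k l"
    then have "square (p i) (p j) (p k) (p l)" using p by (simp add: square_perm_def)
    then show "\<exists>c. c \<noteq> 0 \<and> s (p i) * s (p l) - s (p j) * s (p k) = const c" "vol (s (p i)) (s (p j)) (s (p k)) \<noteq> 0"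
      using s unfolding reducing_def admissible_def by blast+
  qed (use s in \<open>simp add: reducing_def\<close>)
  ultimately show ?thesis by (simp add: reducing_def)
qed

lemma square_permI:
  assumes inv: "\<And>x. p (p x) = x" and sq: "square i j k l" "square (p i) (p j) (p k) (p l)"
  shows "square_perm p"
  unfolding square_perm_def
proof (intro conjI allI impI)
  fix i' j' k' l' assume "square i' j' k' l'"
  from square_orbit[OF sq(1) this] show "square (p i') (p j') (p k') (p l')"
    using square_sym[OF sq(2)] sq(2) by (elim insertE emptyE) simp_all
qed (fact inv)

type_synonym coeffs = "4 \<Rightarrow> 4 \<Rightarrow> complex"

definition act :: "coeffs \<Rightarrow> laurent_matrix \<Rightarrow> laurent_matrix" where
  "act M s i = (\<Sum>j\<in>UNIV. const (M i j) * s j)"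

definition row_step :: "4 \<Rightarrow> 4 \<Rightarrow> 4 \<Rightarrow> 4 \<Rightarrow> complex \<Rightarrow> coeffs \<Rightarrow> coeffs" where
  "row_step i j k l c M = M(k := \<lambda>x. M k x + c * M i x, l := \<lambda>x. M l x + c * M j x)"

text \<open>
  The polar form of \<open>q\<close> evaluated at the columns \<open>a\<close> and \<open>b\<close> of the coefficient matrix.
\<close>

definition pairing :: "coeffs \<Rightarrow> 4 \<Rightarrow> 4 \<Rightarrow> complex" where
  "pairing M a b = M 1 a * M 4 b + M 4 a * M 1 b - M 2 a * M 3 b - M 3 a * M 2 b"

definition pairing0 :: "4 \<Rightarrow> 4 \<Rightarrow> complex" where
  "pairing0 a b = (if (a, b) \<in> {(1, 4), (4, 1)} then 1 else if (a, b) \<in> {(2, 3), (3, 2)} then -1 else 0)"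

definition similitude :: "coeffs \<Rightarrow> bool" where
  "similitude M \<longleftrightarrow> (\<exists>c. c \<noteq> 0 \<and> (\<forall>a b. pairing M a b = c * pairing0 a b))"

definition preserves_reducing :: "coeffs \<Rightarrow> bool" where
  "preserves_reducing M \<longleftrightarrow> (\<forall>s. reducing s \<longrightarrow> reducing (act M s))"

lemma pairing_square:
  assumes "square i j k l"
  shows "\<exists>e. e \<noteq> 0 \<and> (\<forall>M a b. M i a * M l b + M l a * M i b - M j a * M k b - M k a * M j b = e * pairing M a b)"
proof -
  have "(\<forall>M a b. M i a * M l b + M l a * M i b - M j a * M k b - M k a * M j b = 1 * pairing M a b) \<or>
    (\<forall>M a b. M i a * M l b + M l a * M i b - M j a * M k b - M k a * M j b = (-1) * pairing M a b)"
    using assms unfolding square_def insert_iff empty_iff prod.inject pairing_def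
    by (elim disjE conjE FalseE) (simp_all add: algebra_simps)
  then show ?thesis by (metis one_neq_zero neg_equal_0_iff_equal)
qed

lemma row_step_simps:
  assumes "square i j k l"
  shows "row_step i j k l c M i = M i" "row_step i j k l c M j = M j"
    "row_step i j k l c M k = (\<lambda>x. M k x + c * M i x)" "row_step i j k l c M l = (\<lambda>x. M l x + c * M j x)"
  using square_distinct[OF assms] by (auto simp: row_step_def)

lemma similitude_row_step:
  assumes "similitude M" "square i j k l"
  shows "similitude (row_step i j k l c M)"
proof -
  obtain e where e: "e \<noteq> 0" "\<And>M a b. M i a * M l b + M l a * M i b - M j a * M k b - M k a * M j b = e * pairing M a b"
    using pairing_square[OF assms(2)] by blast
  have "e * pairing (row_step i j k l c M) a b = e * pairing M a b" for a b
    unfolding e(2)[symmetric] row_step_simps[OF assms(2)] by (simp add: algebra_simps)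
  then have "pairing (row_step i j k l c M) = pairing M" using e(1) by (simp add: fun_eq_iff)
  then show ?thesis using assms(1) by (simp add: similitude_def)
qed

lemma preserves_reducing_row_step:
  assumes "square i j k l" "preserves_reducing (row_step i j k l c M)"
  shows "preserves_reducing M"
  unfolding preserves_reducing_def
proof (intro allI impI)
  fix s assume s: "reducing s"
  let ?t = "act (row_step i j k l c M) s"
  have eq: "?t = estep i j k l (const c) (act M s)"
    by (rule square_eqI[OF assms(1)])
      (simp_all add: act_def row_step_simps[OF assms(1)] estep_simps[OF assms(1)] sum.distrib sum_distrib_left algebra_simps)
  have "reducing ?t" using assms(2) s by (simp add: preserves_reducing_def)
  then have "reducing (estep i j k l (const (- c)) ?t)" by (rule reducing_estep[OF _ assms(1)]) (rule subalg.const)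
  then show "reducing (act M s)" unfolding eq estep_estep[OF assms(1)] by simp
qed

lemma similitude_perm:
  assumes "similitude M" "square_perm p"
  shows "similitude (M \<circ> p)"
proof -
  have "square 1 2 3 4" by (simp add: square_def)
  then have "square (p 1) (p 2) (p 3) (p 4)" using assms(2) by (simp add: square_perm_def)
  from pairing_square[OF this] obtain e where e: "e \<noteq> 0" "\<And>M a b. M (p 1) a * M (p 4) b + M (p 4) a * M (p 1) b
      - M (p 2) a * M (p 3) b - M (p 3) a * M (p 2) b = e * pairing M a b" by blast
  then have "pairing (M \<circ> p) a b = e * pairing M a b" for a b by (simp add: pairing_def[of "M \<circ> p"])
  then show ?thesis using assms(1) e(1) unfolding similitude_def by (metis mult.assoc mult_eq_0_iff)
qed

lemma preserves_reducing_perm: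
  assumes "square_perm p" "preserves_reducing (M \<circ> p)"
  shows "preserves_reducing M"
  unfolding preserves_reducing_def
proof (intro allI impI)
  fix s assume "reducing s"
  then have "reducing (act (M \<circ> p) s)" using assms(2) by (simp add: preserves_reducing_def)
  then have "reducing (act (M \<circ> p) s \<circ> p)" by (rule reducing_perm) (rule assms(1))
  moreover have "act (M \<circ> p) s \<circ> p = act M s"
    using assms(1) by (auto simp: act_def square_perm_def)
  ultimately show "reducing (act M s)" by simp
qed

lemma preserves_reducing_diagonal:
  assumes "\<And>i j. i \<noteq> j \<Longrightarrow> M i j = 0" "M 1 1 \<noteq> 0" "M 2 2 \<noteq> 0" "M 3 3 \<noteq> 0" "M 4 4 \<noteq> 0"
    "M 1 1 * M 4 4 = M 2 2 * M 3 3"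
  shows "preserves_reducing M"
proof -
  have "scaling (\<lambda>i. M i i)"
    using assms by (intro scalingI[of 1 2 3 4]) (simp_all add: square_def)
  moreover have "act M s = rescale (\<lambda>i. M i i) s" for s
  proof
    fix i
    have "const (M i j) * s j = (if i = j then const (M i i) * s i else 0)" for j using assms(1) by auto
    then have "act M s i = (\<Sum>j\<in>UNIV. if i = j then const (M i i) * s i else 0)"
      unfolding act_def by (rule sum.cong[OF refl])
    then show "act M s i = rescale (\<lambda>i. M i i) s i" by (simp add: rescale_def)
  qed
  ultimately show ?thesis unfolding preserves_reducing_def using reducing_rescale by metis
qed

lemma square_perm_corner: "\<exists>p. square_perm p \<and> p 1 = i"
proof -
  define p2 p3 p4 :: "4 \<Rightarrow> 4"
    where "p2 x = (if x = 1 then 2 else if x = 2 then 1 else if x = 3 then 4 else 3)"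
      and "p3 x = (if x = 1 then 3 else if x = 3 then 1 else if x = 2 then 4 else 2)"
      and "p4 x = (if x = 1 then 4 else if x = 4 then 1 else if x = 2 then 3 else 2)" for x
  have v: "p2 1 = 2" "p2 2 = 1" "p2 3 = 4" "p2 4 = 3" "p3 1 = 3" "p3 2 = 4" "p3 3 = 1" "p3 4 = 2"
    "p4 1 = 4" "p4 2 = 3" "p4 3 = 2" "p4 4 = 1"
    by (simp_all add: p2_def p3_def p4_def)
  have inv: "\<forall>x. p2 (p2 x) = x" "\<forall>x. p3 (p3 x) = x" "\<forall>x. p4 (p4 x) = x"
    unfolding forall_4 by (simp_all add: v)
  have "square_perm id" "square_perm p2" "square_perm p3" "square_perm p4"
    by (rule square_permI[of _ 1 2 3 4]; use inv in \<open>simp add: v square_def\<close>)+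
  moreover have "id 1 = (1::4)" by simp
  ultimately have "\<forall>i. \<exists>p. square_perm p \<and> p 1 = i" unfolding forall_4 using v by metis
  then show ?thesis by blast
qed

text \<open>
  The first column is an isotropic vector, that is a 2 by 2 matrix of rank one, and operations reduce it to its corner
  entry. Its pairing with the last column is nonzero, so the last column can be reduced to the opposite corner
  by operations fixing the first. The middle columns then span isotropic lines in the plane orthogonal to
  both, and up to transposition the matrix is diagonal.
\<close>

theorem similitude_preserves_reducing:
  assumes "similitude M"
  shows "preserves_reducing M"
proof -
  have sq: "square 1 2 3 4" "square 1 3 2 4" "square 4 3 2 1" "square 4 2 3 1" by (simp_all add: square_def)
  have zero: "pairing N 1 1 = 0" "pairing N 4 4 = 0" "pairing N 1 2 = 0" "pairing N 1 3 = 0"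
    "pairing N 4 2 = 0" "pairing N 4 3 = 0" "pairing N 2 2 = 0" "pairing N 3 3 = 0"
    and nz: "pairing N 1 4 \<noteq> 0" "pairing N 2 3 = - pairing N 1 4" if "similitude N" for N
    using that by (auto simp: similitude_def pairing0_def)
  have stage3: "preserves_reducing N"
    if N: "similitude N" "N 2 1 = 0" "N 3 1 = 0" "N 4 1 = 0" "N 2 4 = 0" "N 3 4 = 0" for N
  proof -
    note z = zero[OF N(1), unfolded pairing_def] and n = nz[OF N(1), unfolded pairing_def]
    have d: "N 1 1 \<noteq> 0" "N 4 4 \<noteq> 0" using n(1) N by auto
    have c: "N 1 4 = 0" "N 4 2 = 0" "N 4 3 = 0" "N 1 2 = 0" "N 1 3 = 0" using z N d by auto
    have q: "N 2 2 * N 3 2 = 0" "N 2 3 * N 3 3 = 0" "N 2 2 * N 3 3 + N 3 2 * N 2 3 = N 1 1 * N 4 4"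
      using z(7,8) n(2) N c by (auto simp: algebra_simps)
    show ?thesis
    proof (cases "N 3 2 = 0")
      case True
      then have "N 2 2 \<noteq> 0" "N 3 3 \<noteq> 0" using q(3) d by auto
      then have "N 2 3 = 0" using q(2) by simp
      have "\<forall>i j. i \<noteq> j \<longrightarrow> N i j = 0" unfolding forall_4 using N c True \<open>N 2 3 = 0\<close> by simp
      then show ?thesis using q(3) True d \<open>N 2 2 \<noteq> 0\<close> \<open>N 3 3 \<noteq> 0\<close>
        by (intro preserves_reducing_diagonal) auto
    next
      case False
      then have "N 2 2 = 0" using q(1) by simp
      then have "N 2 3 \<noteq> 0" using q(3) d by auto
      then have "N 3 3 = 0" using q(2) by simp
      define p :: "4 \<Rightarrow> 4" where "p x = (if x = 2 then 3 else if x = 3 then 2 else x)" for x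
      have p: "p 1 = 1" "p 2 = 3" "p 3 = 2" "p 4 = 4" by (simp_all add: p_def)
      have "\<forall>x. p (p x) = x" unfolding forall_4 by (simp add: p)
      then have "square_perm p" by (intro square_permI[OF _ sq(1)]) (simp_all add: p sq)
      moreover have "\<forall>i j. i \<noteq> j \<longrightarrow> (N \<circ> p) i j = 0"
        unfolding forall_4 using N c \<open>N 2 2 = 0\<close> \<open>N 3 3 = 0\<close> by (simp add: p)
      then have "preserves_reducing (N \<circ> p)"
        using q(3) d False \<open>N 2 2 = 0\<close> \<open>N 2 3 \<noteq> 0\<close>
        by (intro preserves_reducing_diagonal) (auto simp: p mult.commute)
      ultimately show ?thesis by (rule preserves_reducing_perm)
    qed
  qed
  have stage2: "preserves_reducing N"
    if N: "similitude N" "N 2 1 = 0" "N 3 1 = 0" "N 4 1 = 0" for N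
  proof -
    have d: "N 4 4 \<noteq> 0" using nz(1)[OF N(1)] N by (auto simp: pairing_def)
    define N1 where "N1 = row_step 4 3 2 1 (- N 2 4 / N 4 4) N"
    define N2 where "N2 = row_step 4 2 3 1 (- N1 3 4 / N 4 4) N1"
    note r1 = row_step_simps[OF sq(3), of "- N 2 4 / N 4 4" N, folded N1_def]
    note r2 = row_step_simps[OF sq(4), of "- N1 3 4 / N 4 4" N1, folded N2_def]
    have "similitude N2" unfolding N2_def N1_def by (intro similitude_row_step N sq)
    then have "preserves_reducing N2" by (rule stage3) (use N d in \<open>simp_all add: r1 r2\<close>)
    then show ?thesis unfolding N2_def N1_def using preserves_reducing_row_step sq by blast
  qed
  have stage1: "preserves_reducing N"
    if N: "similitude N" "N 1 1 \<noteq> 0" for N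
  proof -
    define N1 where "N1 = row_step 1 2 3 4 (- N 3 1 / N 1 1) N"
    define N2 where "N2 = row_step 1 3 2 4 (- N1 2 1 / N 1 1) N1"
    note r1 = row_step_simps[OF sq(1), of "- N 3 1 / N 1 1" N, folded N1_def]
    note r2 = row_step_simps[OF sq(2), of "- N1 2 1 / N 1 1" N1, folded N2_def]
    have s2: "similitude N2" unfolding N2_def N1_def by (intro similitude_row_step N sq)
    have e: "N2 2 1 = 0" "N2 3 1 = 0" "N2 1 1 \<noteq> 0" using N(2) by (simp_all add: r1 r2)
    then have "N2 4 1 = 0" using zero(1)[OF s2] by (auto simp: pairing_def)
    then have "preserves_reducing N2" using stage2[OF s2] e by blast
    then show ?thesis unfolding N2_def N1_def using preserves_reducing_row_step sq by blast
  qed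
  have "\<exists>i. M i 1 \<noteq> 0"
  proof (rule ccontr)
    assume "\<not> ?thesis"
    then have "M i 1 = 0" for i by blast
    then show False using nz(1)[OF assms] by (simp add: pairing_def)
  qed
  then obtain i where "M i 1 \<noteq> 0" by blast
  moreover obtain p where p: "square_perm p" "p 1 = i" using square_perm_corner by blast
  ultimately have "preserves_reducing (M \<circ> p)" using similitude_perm[OF assms p(1)] by (intro stage1) auto
  then show ?thesis by (rule preserves_reducing_perm[OF p(1)])
qed

section \<open>Automorphisms and their matrices of Laurent polynomials\<close>

definition represents_map :: "(complex ^ 4 \<Rightarrow> complex ^ 4) \<Rightarrow> laurent_matrix \<Rightarrow> bool" where
  "represents_map F s \<longleftrightarrow> (\<forall>i. represents (\<lambda>x. F x $ i) (s i))"

lemma represents_cong: "(\<And>x. x \<in> SL2 \<Longrightarrow> \<phi> x = \<psi> x) \<Longrightarrow> represents \<phi> f \<longleftrightarrow> represents \<psi> f"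
  by (simp add: represents_def)

lemma deg_aut_eq_sdeg:
  assumes "represents_map F s" "admissible s"
  shows "mdeg_poly (deg_aut F) = sdeg s"
proof -
  have d: "mdeg_poly (deg_SL2 (coord F i)) = ldeg (s i)" "deg_SL2 (coord F i) \<noteq> MInf" for i
    using assms deg_SL2_eq_ldeg[of "\<lambda>x. F x $ i" "s i"] admissible_pos(1)[OF assms(2)]
    by (simp_all add: represents_map_def coord_def)
  have ni: "x + y \<noteq> MInf" if "x \<noteq> MInf" "y \<noteq> MInf" for x y using that by (cases x; cases y) auto
  show ?thesis unfolding deg_aut_def sdeg_def sum_4 by (simp add: mdeg_poly_add ni d)
qed

definition elem_map :: "4 \<Rightarrow> 4 \<Rightarrow> 4 \<Rightarrow> 4 \<Rightarrow> complex \<Rightarrow> complex \<Rightarrow> 2 cpoly \<Rightarrow> complex ^ 4 \<Rightarrow> complex ^ 4" where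
  "elem_map i j k l a b h = (\<lambda>x\<in>SL2. \<chi> m.
     if m = i then x $ i / a else if m = j then x $ j / b
     else if m = k then b * x $ k + b * x $ i * cpoly_eval h (vector [x $ i, x $ j])
     else a * x $ l + a * x $ j * cpoly_eval h (vector [x $ i, x $ j]))"

text \<open>
  Each elementary operation is described by two quadruples of \<open>square\<close>; one of them is chosen.
\<close>

definition canonical :: "4 \<Rightarrow> 4 \<Rightarrow> 4 \<Rightarrow> 4 \<Rightarrow> bool" where
  "canonical i j k l \<longleftrightarrow> (i, j, k, l) \<in> {(1, 2, 3, 4), (3, 4, 1, 2), (1, 3, 2, 4), (2, 4, 1, 3)}"

lemma canonical_square: "canonical i j k l \<Longrightarrow> square i j k l"
  by (auto simp: canonical_def square_def)

lemma square_canonical: "square i j k l \<Longrightarrow> canonical i j k l \<or> canonical j i l k"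
  by (auto simp: canonical_def square_def)

text \<open>
  The four families are the same map with relabelled positions; for two of them the scalars trade places.
\<close>

lemma elementary_eq:
  "elementary = {elem_map i j k l a b h | i j k l a b h. canonical i j k l \<and> a \<noteq> 0 \<and> b \<noteq> 0}"
proof -
  have E34: "E34 = {elem_map 1 2 3 4 a b h | a b h. a \<noteq> 0 \<and> b \<noteq> 0}"
    and E24: "E24 = {elem_map 1 3 2 4 a b h | a b h. a \<noteq> 0 \<and> b \<noteq> 0}"
    unfolding E34_def E24_def elem_map_def
    by (intro Collect_cong ex_cong1 conj_cong arg_cong2[where f = "(=)"] refl restrict_ext, simp add: vec_eq_iff forall_4)+
  have E12: "E12 = {elem_map 3 4 1 2 b a h | a b h. a \<noteq> 0 \<and> b \<noteq> 0}"
    and E13: "E13 = {elem_map 2 4 1 3 b a h | a b h. a \<noteq> 0 \<and> b \<noteq> 0}"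
    unfolding E12_def E13_def elem_map_def
    by (intro Collect_cong ex_cong1 conj_cong arg_cong2[where f = "(=)"] refl restrict_ext, simp add: vec_eq_iff forall_4)+
  have can: "canonical 1 2 3 4" "canonical 3 4 1 2" "canonical 1 3 2 4" "canonical 2 4 1 3"
    by (simp_all add: canonical_def)
  let ?R = "{elem_map i j k l a b h | i j k l a b h. canonical i j k l \<and> a \<noteq> 0 \<and> b \<noteq> 0}"
  have R: "elem_map i j k l a b h \<in> ?R" if "canonical i j k l" "a \<noteq> 0" "b \<noteq> 0" for i j k l a b h
    using that by blast
  have sub: "elementary \<subseteq> ?R"
  proof
    fix f assume "f \<in> elementary"
    then consider "f \<in> E12" | "f \<in> E34" | "f \<in> E24" | "f \<in> E13" unfolding elementary_def by blast
    then show "f \<in> ?R"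
    proof cases
      case 1
      then obtain a b h where "f = elem_map 3 4 1 2 b a h" "a \<noteq> 0" "b \<noteq> 0" unfolding E12 by blast
      then show ?thesis using R[OF can(2), of b a h] by simp
    next
      case 2
      then obtain a b h where "f = elem_map 1 2 3 4 a b h" "a \<noteq> 0" "b \<noteq> 0" unfolding E34 by blast
      then show ?thesis using R[OF can(1), of a b h] by simp
    next
      case 3
      then obtain a b h where "f = elem_map 1 3 2 4 a b h" "a \<noteq> 0" "b \<noteq> 0" unfolding E24 by blast
      then show ?thesis using R[OF can(3), of a b h] by simp
    next
      case 4
      then obtain a b h where "f = elem_map 2 4 1 3 b a h" "a \<noteq> 0" "b \<noteq> 0" unfolding E13 by blast
      then show ?thesis using R[OF can(4), of b a h] by simp
    qed
  qed
  have "f \<in> elementary" if f: "f \<in> ?R" for f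
  proof -
    obtain i j k l a b h where c: "canonical i j k l" and f: "f = elem_map i j k l a b h" "a \<noteq> 0" "b \<noteq> 0"
      using f by blast
    from c consider "i = 1" "j = 2" "k = 3" "l = 4" | "i = 3" "j = 4" "k = 1" "l = 2"
      | "i = 1" "j = 3" "k = 2" "l = 4" | "i = 2" "j = 4" "k = 1" "l = 3"
      unfolding canonical_def insert_iff empty_iff prod.inject by argo
    then have "f \<in> E34 \<or> f \<in> E12 \<or> f \<in> E24 \<or> f \<in> E13"
      unfolding E34 E12 E24 E13 mem_Collect_eq by cases (use f in blast)+
    then show ?thesis unfolding elementary_def by blast
  qed
  then show ?thesis using sub by blast
qed

lemma elem_map_simps:
  assumes "square i j k l" "x \<in> SL2"
  shows "elem_map i j k l a b h x $ i = x $ i / a" "elem_map i j k l a b h x $ j = x $ j / b"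
    "elem_map i j k l a b h x $ k = b * x $ k + b * x $ i * cpoly_eval h (vector [x $ i, x $ j])"
    "elem_map i j k l a b h x $ l = a * x $ l + a * x $ j * cpoly_eval h (vector [x $ i, x $ j])"
  using square_distinct[OF assms(1)] assms(2) by (auto simp: elem_map_def)

lemma vec_eqI_square:
  assumes "square i j k l" "x $ i = y $ i" "x $ j = y $ j" "x $ k = y $ k" "x $ l = y $ l"
  shows "x = (y :: complex ^ 4)"
  using square_eqI[of i j k l "($) x" "($) y"] assms by (simp add: vec_eq_iff fun_eq_iff)

lemma qform_square:
  assumes "square i j k l"
  shows "(\<forall>x. qform x = x $ i * x $ l - x $ j * x $ k) \<or> (\<forall>x. qform x = x $ j * x $ k - x $ i * x $ l)"
  using assms unfolding square_def qform_def by auto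

lemma elem_map_SL2:
  assumes sq: "square i j k l" and ab: "a \<noteq> 0" "b \<noteq> 0" and x: "x \<in> SL2"
  shows "elem_map i j k l a b h x \<in> SL2"
proof -
  let ?y = "elem_map i j k l a b h x"
  have "?y $ i * ?y $ l - ?y $ j * ?y $ k = x $ i * x $ l - x $ j * x $ k"
    unfolding elem_map_simps[OF sq x] using ab by (simp add: field_simps)
  then have "qform ?y = qform x" using qform_square[OF sq] by (metis minus_diff_eq)
  then show ?thesis using x by (simp add: SL2_def)
qed

definition two_gens :: "4 \<Rightarrow> 4 \<Rightarrow> laurent_matrix \<Rightarrow> 2 \<Rightarrow> laurent" where
  "two_gens i j s m = (if m = 1 then s i else s j)"

lemma range_two_gens: "range (two_gens i j s) = {s i, s j}"
proof -
  have "range (two_gens i j s) = two_gens i j s ` {1, 2}" by (simp only: UNIV_2)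
  also have "\<dots> = {s i, s j}" by (simp add: two_gens_def insert_commute)
  finally show ?thesis .
qed

lemma represents_elem_map:
  assumes sq: "square i j k l" and F: "represents_map F s" "F \<in> SL2 \<rightarrow> SL2"
  shows "represents_map (compose SL2 (elem_map i j k l a b h) F)
    (rescale (\<lambda>m. if m = i then 1 / a else if m = j then 1 / b else if m = k then b else a)
      (estep i j k l (psub (two_gens i j s) h) s))"
proof -
  let ?c = "\<lambda>m. if m = i then 1 / a else if m = j then 1 / b else if m = k then b else a"
  let ?u = "psub (two_gens i j s) h"
  let ?t = "rescale ?c (estep i j k l ?u s)"
  let ?G = "compose SL2 (elem_map i j k l a b h) F"
  note d = square_distinct[OF sq]
  note r = F(1)[unfolded represents_map_def, rule_format]
  have u: "represents (\<lambda>x. cpoly_eval h (vector [F x $ i, F x $ j])) ?u"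
  proof (rule represents_poly)
    have "\<forall>m. represents (\<lambda>x. (vector [F x $ i, F x $ j] :: complex ^ 2) $ m) (two_gens i j s m)"
      unfolding forall_2 by (simp add: two_gens_def r)
    then show "represents (\<lambda>x. (vector [F x $ i, F x $ j] :: complex ^ 2) $ m) (two_gens i j s m)" for m
      by blast
  qed
  have Gx: "?G x = elem_map i j k l a b h (F x)" "F x \<in> SL2" if "x \<in> SL2" for x
    using that F(2) by (auto simp: compose_def)
  have "represents (\<lambda>x. ?G x $ i) (?t i)"
    using represents_mult[OF represents_const[of "1 / a"] r[of i]] d
    by (subst represents_cong[where \<psi> = "\<lambda>x. 1 / a * F x $ i"])
       (simp_all add: Gx elem_map_simps[OF sq] rescale_def estep_simps[OF sq])
  moreover have "represents (\<lambda>x. ?G x $ j) (?t j)"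
    using represents_mult[OF represents_const[of "1 / b"] r[of j]] d
    by (subst represents_cong[where \<psi> = "\<lambda>x. 1 / b * F x $ j"])
       (simp_all add: Gx elem_map_simps[OF sq] rescale_def estep_simps[OF sq])
  moreover have "represents (\<lambda>x. ?G x $ k) (?t k)"
    using represents_mult[OF represents_const[of b] represents_add[OF r[of k] represents_mult[OF r[of i] u]]] d
    by (subst represents_cong[where \<psi> = "\<lambda>x. b * (F x $ k + F x $ i * cpoly_eval h (vector [F x $ i, F x $ j]))"])
       (simp_all add: Gx elem_map_simps[OF sq] rescale_def estep_simps[OF sq] algebra_simps)
  moreover have "represents (\<lambda>x. ?G x $ l) (?t l)"
    using represents_mult[OF represents_const[of a] represents_add[OF r[of l] represents_mult[OF r[of j] u]]] d
    by (subst represents_cong[where \<psi> = "\<lambda>x. a * (F x $ l + F x $ j * cpoly_eval h (vector [F x $ i, F x $ j]))"])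
       (simp_all add: Gx elem_map_simps[OF sq] rescale_def estep_simps[OF sq] algebra_simps)
  ultimately have all: "\<forall>m\<in>{i, j, k, l}. represents (\<lambda>x. ?G x $ m) (?t m)" by blast
  then show ?thesis unfolding represents_map_def square_distinct(7)[OF sq, symmetric] by blast
qed

lemma represents_id: "represents_map (\<lambda>x\<in>SL2. x) xi"
  unfolding represents_map_def
proof
  fix i
  show "represents (\<lambda>x. (\<lambda>x\<in>SL2. x) x $ i) (xi i)"
    using represents_coord[of i] by (subst represents_cong[where \<psi> = "\<lambda>x. x $ i"]) auto
qed

lemma represents_map_regular:
  assumes "represents_map F s" "F \<in> SL2 \<rightarrow>\<^sub>E SL2"
  shows "F \<in> regular_maps"
  using assms unfolding regular_maps_def coord_def represents_map_def
  by (auto simp: represents_coord_ring)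

lemma elem_map_regular:
  assumes sq: "square i j k l" and ab: "a \<noteq> 0" "b \<noteq> 0"
  shows "elem_map i j k l a b h \<in> regular_maps"
proof (rule represents_map_regular)
  show ext: "elem_map i j k l a b h \<in> SL2 \<rightarrow>\<^sub>E SL2"
    using elem_map_SL2[OF assms] by (auto simp: PiE_def extensional_def elem_map_def)
  have "compose SL2 (elem_map i j k l a b h) (\<lambda>x\<in>SL2. x) = elem_map i j k l a b h"
    by (auto simp: compose_def fun_eq_iff elem_map_def)
  then show "represents_map (elem_map i j k l a b h)
    (rescale (\<lambda>m. if m = i then 1 / a else if m = j then 1 / b else if m = k then b else a)
      (estep i j k l (psub (two_gens i j xi) h) xi))"
    using represents_elem_map[OF sq represents_id, of a b h] by simp
qed

lemma elem_map_inverse: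
  fixes h h' :: "2 cpoly"
  assumes sq: "square i j k l" and ab: "a \<noteq> 0" "b \<noteq> 0"
    and h': "\<And>p q. cpoly_eval h' (vector [p, q]) = - (a * b) * cpoly_eval h (vector [a * p, b * q])"
  shows "compose SL2 (elem_map i j k l (1 / a) (1 / b) h') (elem_map i j k l a b h) = (\<lambda>x\<in>SL2. x)"
proof
  fix x
  show "compose SL2 (elem_map i j k l (1 / a) (1 / b) h') (elem_map i j k l a b h) x = (\<lambda>x\<in>SL2. x) x"
  proof (cases "x \<in> SL2")
    case True
    note y = elem_map_SL2[OF sq ab True, of h]
    have "elem_map i j k l (1 / a) (1 / b) h' (elem_map i j k l a b h x) = x"
      using ab by (intro vec_eqI_square[OF sq])
        (simp_all add: elem_map_simps[OF sq y] elem_map_simps[OF sq True] h' field_simps)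
    then show ?thesis using True by (simp add: compose_def)
  qed (simp add: compose_def)
qed

lemma ex_elem_map_inverse:
  assumes sq: "square i j k l" and ab: "a \<noteq> 0" "b \<noteq> 0"
  obtains h' where
    "compose SL2 (elem_map i j k l (1 / a) (1 / b) h') (elem_map i j k l a b h) = (\<lambda>x\<in>SL2. x)"
    "compose SL2 (elem_map i j k l a b h) (elem_map i j k l (1 / a) (1 / b) h') = (\<lambda>x\<in>SL2. x)"
proof -
  define r :: "2 \<Rightarrow> 2 cpoly" where "r m = (if m = 1 then const a * Var 1 else const b * Var 2)" for m
  define h' where "h' = const (- (a * b)) * subst_poly r h"
  have h': "cpoly_eval h' (vector [p, q]) = - (a * b) * cpoly_eval h (vector [a * p, b * q])" for p q
  proof -
    have "(\<chi> m. cpoly_eval (r m) (vector [p, q])) = vector [a * p, b * q]"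
      by (simp add: r_def vec_eq_iff forall_2)
    then show ?thesis by (simp only: h'_def cpoly_eval_mult cpoly_eval_subst cpoly_eval_const)
  qed
  have h'': "cpoly_eval h (vector [p, q]) = - (1 / a * (1 / b)) * cpoly_eval h' (vector [1 / a * p, 1 / b * q])" for p q
    using ab by (simp add: h')
  have "compose SL2 (elem_map i j k l (1 / (1 / a)) (1 / (1 / b)) h) (elem_map i j k l (1 / a) (1 / b) h') = (\<lambda>x\<in>SL2. x)"
    by (rule elem_map_inverse[OF sq]) (use ab h'' in simp_all)
  then show ?thesis using elem_map_inverse[OF sq ab h'] that by simp
qed

lemma elementary_Aut:
  assumes "E \<in> elementary"
  shows "E \<in> Aut_SL2" "inv\<^bsub>Aut_group\<^esub> E \<in> elementary"
proof -
  obtain i j k l a b h where c: "canonical i j k l" and ab: "a \<noteq> 0" "b \<noteq> 0" and E: "E = elem_map i j k l a b h"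
    using assms unfolding elementary_eq by auto
  note sq = canonical_square[OF c]
  obtain h' where h': "compose SL2 (elem_map i j k l (1 / a) (1 / b) h') E = (\<lambda>x\<in>SL2. x)"
    "compose SL2 E (elem_map i j k l (1 / a) (1 / b) h') = (\<lambda>x\<in>SL2. x)"
    using ex_elem_map_inverse[OF sq ab, of h] unfolding E by metis
  let ?E' = "elem_map i j k l (1 / a) (1 / b) h'"
  have r: "E \<in> regular_maps" "?E' \<in> regular_maps" using elem_map_regular[OF sq] ab by (auto simp: E)
  have A: "E \<in> Aut_SL2" "?E' \<in> Aut_SL2" using r h' by (auto simp: Aut_SL2_def)
  then show "E \<in> Aut_SL2" by simp
  have "inv\<^bsub>Aut_group\<^esub> E = ?E'"
    using A h'(1) by (intro group.inv_equality[OF group_Aut_group]) (simp_all add: Aut_group_def)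
  then show "inv\<^bsub>Aut_group\<^esub> E \<in> elementary"
    using c ab unfolding elementary_eq by force
qed

definition polar :: "complex ^ 4 \<Rightarrow> complex ^ 4 \<Rightarrow> complex" where
  "polar x y = x $ 1 * y $ 4 + x $ 4 * y $ 1 - x $ 2 * y $ 3 - x $ 3 * y $ 2"

lemma polar_eq: "polar x y = qform (x + y) - qform x - qform y"
  by (simp add: polar_def qform_def algebra_simps)

lemma polar_preserved:
  fixes A :: "complex ^ 4 ^ 4"
  assumes "\<And>x. qform (A *v x) = qform x"
  shows "polar (A *v x) (A *v y) = polar x y"
  unfolding polar_eq by (simp add: assms flip: matrix_vector_right_distrib)

lemma represents_linear:
  fixes A :: "complex ^ 4 ^ 4"
  assumes "represents_map F s" "F \<in> SL2 \<rightarrow> SL2"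
  shows "represents_map (compose SL2 (restrict ((*v) A) SL2) F) (act (\<lambda>i j. A $ i $ j) s)"
  unfolding represents_map_def
proof
  fix i
  have "represents (\<lambda>x. \<Sum>j\<in>UNIV. A $ i $ j * F x $ j) (act (\<lambda>i j. A $ i $ j) s i)"
    unfolding act_def sum_4 using assms(1)
    by (intro represents_add represents_mult represents_const) (simp_all add: represents_map_def)
  moreover have "compose SL2 (restrict ((*v) A) SL2) F x $ i = (\<Sum>j\<in>UNIV. A $ i $ j * F x $ j)" if "x \<in> SL2" for x
    using that assms(2) by (auto simp: compose_def matrix_vector_mult_def)
  ultimately show "represents (\<lambda>x. compose SL2 (restrict ((*v) A) SL2) F x $ i) (act (\<lambda>i j. A $ i $ j) s i)"
    by (subst represents_cong) auto
qed

lemma O4_regular: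
  fixes A :: "complex ^ 4 ^ 4"
  assumes "\<And>x. qform (A *v x) = qform x"
  shows "restrict ((*v) A) SL2 \<in> regular_maps"
proof (rule represents_map_regular)
  show "restrict ((*v) A) SL2 \<in> SL2 \<rightarrow>\<^sub>E SL2" using assms by (auto simp: SL2_def)
  have "compose SL2 (restrict ((*v) A) SL2) (\<lambda>x\<in>SL2. x) = restrict ((*v) A) SL2"
    by (auto simp: compose_def fun_eq_iff)
  then show "represents_map (restrict ((*v) A) SL2) (act (\<lambda>i j. A $ i $ j) xi)"
    using represents_linear[OF represents_id, of A] by simp
qed

lemma O4_Aut:
  assumes "G \<in> O4"
  shows "G \<in> Aut_SL2" "inv\<^bsub>Aut_group\<^esub> G \<in> O4"
proof -
  obtain A :: "complex ^ 4 ^ 4" where A: "G = restrict ((*v) A) SL2" "\<And>x. qform (A *v x) = qform x"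
    using assms by (auto simp: O4_def)
  have "x = 0" if "A *v x = 0" for x
  proof -
    have "polar x y = 0" for y
      using polar_preserved[OF A(2), of x y] that by (simp add: polar_def)
    from this[of "axis 1 1"] this[of "axis 2 1"] this[of "axis 3 1"] this[of "axis 4 1"] show "x = 0"
      by (simp add: polar_def axis_def vec_eq_iff forall_4)
  qed
  then have "invertible A"
    using matrix_left_invertible_ker[of A] invertible_left_inverse[of A] by blast
  then obtain B where B: "A ** B = mat 1" "B ** A = mat 1" by (auto simp: invertible_def)
  have AB: "A *v (B *v x) = x" "B *v (A *v x) = x" for x
    by (simp_all add: matrix_vector_mul_assoc B)
  have qB: "qform (B *v x) = qform x" for x using A(2)[of "B *v x"] AB by simp
  let ?H = "restrict ((*v) B) SL2"
  have c: "compose SL2 G ?H = (\<lambda>x\<in>SL2. x)" "compose SL2 ?H G = (\<lambda>x\<in>SL2. x)"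
    using AB A(2) qB by (auto simp: compose_def fun_eq_iff A(1) SL2_def)
  have r: "G \<in> regular_maps" "?H \<in> regular_maps" using O4_regular A qB by auto
  have au: "G \<in> Aut_SL2" "?H \<in> Aut_SL2" using r c by (auto simp: Aut_SL2_def)
  then show "G \<in> Aut_SL2" by simp
  have "inv\<^bsub>Aut_group\<^esub> G = ?H"
    using au c by (intro group.inv_equality[OF group_Aut_group]) (simp_all add: Aut_group_def)
  then show "inv\<^bsub>Aut_group\<^esub> G \<in> O4" using qB by (auto simp: O4_def)
qed

lemma similitude_of_isometry:
  fixes A :: "complex ^ 4 ^ 4"
  assumes "\<And>x. qform (A *v x) = qform x"
  shows "similitude (\<lambda>i j. A $ i $ j)"
proof -
  have col: "(A *v axis a 1) $ i = A $ i $ a" for a i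
    by (simp add: matrix_vector_mult_def axis_def if_distrib cong: if_cong)
  have "pairing (\<lambda>i j. A $ i $ j) a b = polar (A *v axis a 1) (A *v axis b 1)" for a b
    by (simp add: polar_def pairing_def col)
  then have "pairing (\<lambda>i j. A $ i $ j) a b = polar (axis a 1) (axis b 1)" for a b
    by (simp only: polar_preserved[OF assms])
  moreover have "\<forall>a b. polar (axis a 1) (axis b 1) = pairing0 a b"
    unfolding forall_4 by (simp add: polar_def pairing0_def axis_def)
  ultimately show ?thesis unfolding similitude_def by (intro exI[of _ 1]) simp
qed

definition reducing_map :: "(complex ^ 4 \<Rightarrow> complex ^ 4) \<Rightarrow> bool" where
  "reducing_map F \<longleftrightarrow> F \<in> SL2 \<rightarrow>\<^sub>E SL2 \<and> (\<exists>s. represents_map F s \<and> reducing s)"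

lemma reducing_map_elementary:
  assumes "E \<in> elementary" "reducing_map F"
  shows "reducing_map (compose SL2 E F)"
proof -
  obtain i j k l a b h where c: "canonical i j k l" and ab: "a \<noteq> 0" "b \<noteq> 0" and E: "E = elem_map i j k l a b h"
    using assms(1) unfolding elementary_eq by auto
  note sq = canonical_square[OF c]
  obtain s where s: "represents_map F s" "reducing s" and F: "F \<in> SL2 \<rightarrow>\<^sub>E SL2"
    using assms(2) by (auto simp: reducing_map_def)
  have "psub (two_gens i j s) h \<in> subalg {s i, s j}"
    using subalg_psub[of "two_gens i j s" h] unfolding range_two_gens .
  then have "reducing (estep i j k l (psub (two_gens i j s) h) s)" by (rule reducing_estep[OF s(2) sq])
  moreover have "scaling (\<lambda>m. if m = i then 1 / a else if m = j then 1 / b else if m = k then b else a)"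
    using square_distinct[OF sq] ab by (intro scalingI[OF sq]) (auto simp: field_simps)
  ultimately have v: "reducing (rescale (\<lambda>m. if m = i then 1 / a else if m = j then 1 / b else if m = k then b else a)
      (estep i j k l (psub (two_gens i j s) h) s))" by (rule reducing_rescale)
  moreover have "represents_map (compose SL2 E F) (rescale (\<lambda>m. if m = i then 1 / a else if m = j then 1 / b else if m = k then b else a)
      (estep i j k l (psub (two_gens i j s) h) s))"
    unfolding E using F by (intro represents_elem_map[OF sq s(1)]) auto
  moreover have "compose SL2 E F \<in> SL2 \<rightarrow>\<^sub>E SL2"
    using F elem_map_SL2[OF sq ab] unfolding E by (auto simp: compose_def)
  ultimately show ?thesis unfolding reducing_map_def by blast
qed

lemma reducing_map_O4:
  assumes "G \<in> O4" "reducing_map F"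
  shows "reducing_map (compose SL2 G F)"
proof -
  obtain A :: "complex ^ 4 ^ 4" where A: "G = restrict ((*v) A) SL2" "\<And>x. qform (A *v x) = qform x"
    using assms by (auto simp: O4_def)
  obtain s where s: "represents_map F s" "reducing s" and F: "F \<in> SL2 \<rightarrow>\<^sub>E SL2"
    using assms(2) by (auto simp: reducing_map_def)
  have "reducing (act (\<lambda>i j. A $ i $ j) s)"
    using similitude_preserves_reducing[OF similitude_of_isometry[OF A(2)]] s(2) by (simp add: preserves_reducing_def)
  moreover have "represents_map (compose SL2 G F) (act (\<lambda>i j. A $ i $ j) s)"
    unfolding A(1) using F by (intro represents_linear[OF s(1)]) auto
  moreover have "compose SL2 G F \<in> SL2 \<rightarrow>\<^sub>E SL2"
    using F A(2) unfolding A(1) by (auto simp: compose_def SL2_def)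
  ultimately show ?thesis unfolding reducing_map_def by blast
qed

lemma reducing_map_id: "reducing_map (\<lambda>x\<in>SL2. x)"
proof -
  have "xi i \<in> linear_forms" for i
    unfolding linear_forms_def
    by (auto intro!: exI[of _ "\<lambda>j. if j = i then 1 else 0"] simp: if_distrib[of const] if_distrib[of "\<lambda>c. c * _"] cong: if_cong)
  then have "reduces xi" by (rule reduces.linear)
  moreover have "admissible xi"
    by (rule admissibleI[of xi 1 2 3 4 1]) (use vol_xi xi_det in \<open>simp_all add: square_def\<close>)
  ultimately show ?thesis using represents_id unfolding reducing_map_def reducing_def by auto
qed

lemma tame_Aut:
  assumes "F \<in> tame"
  shows "F \<in> Aut_SL2"
proof -
  have "elementary \<union> O4 \<subseteq> carrier Aut_group"
    using elementary_Aut(1) O4_Aut(1) by (auto simp: Aut_group_def)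
  then have "F \<in> carrier Aut_group"
    by (rule group.generate_in_carrier[OF group_Aut_group _ assms[unfolded tame_def]])
  then show ?thesis by (simp add: Aut_group_def)
qed

lemma reducing_map_tame:
  assumes "G \<in> tame" "reducing_map F"
  shows "reducing_map (compose SL2 G F)"
  using assms unfolding tame_def
proof (induction arbitrary: F rule: generate.induct)
  case one
  have "compose SL2 (\<lambda>x\<in>SL2. x) F = F"
    using one by (auto simp: reducing_map_def compose_def fun_eq_iff PiE_def extensional_def)
  then show ?case using one by (simp only: Aut_group_def monoid.select_convs)
next
  case (incl h)
  then show ?case using reducing_map_elementary reducing_map_O4 by auto
next
  case (inv h)
  then show ?case using reducing_map_elementary reducing_map_O4 elementary_Aut(2) O4_Aut(2) by auto
next
  case (eng h1 h2)
  have "compose SL2 (compose SL2 h1 h2) F = compose SL2 h1 (compose SL2 h2 F)"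
    using eng.prems by (intro compose_assoc[symmetric]) (auto simp: reducing_map_def)
  then show ?case using eng.IH eng.prems by (simp add: Aut_group_def)
qed

text \<open>
  A linear map preserving \<open>q = 1\<close> preserves \<open>q\<close> by homogeneity wherever \<open>q \<noteq> 0\<close>, hence everywhere because a
  polynomial vanishing there is zero.
\<close>

lemma isometry_of_SL2:
  fixes A :: "complex ^ 4 ^ 4"
  assumes "\<And>x. x \<in> SL2 \<Longrightarrow> A *v x \<in> SL2"
  shows "qform (A *v x) = qform x"
proof -
  define L where "L i = (\<Sum>j\<in>UNIV. const (A $ i $ j) * Var j :: 4 cpoly)" for i
  define g where "g = L 1 * L 4 - L 2 * L 3 - q_poly"
  have L: "cpoly_eval (L i) x = (A *v x) $ i" for i x
    by (simp add: L_def matrix_vector_mult_def)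
  have g: "cpoly_eval g x = qform (A *v x) - qform x" for x
    by (simp add: g_def L qform_def)
  have "cpoly_eval (q_poly * g) x = cpoly_eval 0 x" for x
  proof (cases "qform x = 0")
    case False
    define r where "r = csqrt (qform x)"
    have r: "r ^ 2 = qform x" "r \<noteq> 0" using False by (simp_all add: r_def)
    define y where "y = (1 / r) *s x"
    have xy: "x = r *s y" using r(2) by (simp add: y_def vec_eq_iff)
    have sc: "qform (c *s z) = c ^ 2 * qform z" for c z
      by (simp add: qform_def power2_eq_square algebra_simps)
    have "qform y = 1" using r False unfolding y_def sc by (simp add: power_divide)
    then have "qform (A *v y) = 1" using assms[of y] by (simp add: SL2_def)
    then have "qform (A *v x) = qform x"
      unfolding xy vector_scalar_commute sc using \<open>qform y = 1\<close> by simp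
    then show ?thesis by (simp add: g)
  qed simp
  then have "q_poly * g = 0" by (rule cpoly_eqI)
  moreover have "cpoly_eval q_poly (vector [1, 0, 0, 1]) \<noteq> cpoly_eval 0 (vector [1, 0, 0, 1])"
    by (simp add: qform_def)
  then have "q_poly \<noteq> 0" by metis
  ultimately have "g = 0" using cpoly_no_zero_divisors by blast
  then show ?thesis using g[of x] by simp
qed

text \<open>
  The steps of the matrix are lifted one by one to compositions with elementary automorphisms whose scalars are 1.
\<close>

lemma reduces_imp_reductions:
  assumes "reduces s" "admissible s" "represents_map F s" "F \<in> SL2 \<rightarrow>\<^sub>E SL2"
  shows "\<exists>F'\<in>O4. elem_reduction\<^sup>*\<^sup>* F F'"
  using assms
proof (induction arbitrary: F)
  case (linear s)
  then have "\<forall>i. \<exists>c. s i = (\<Sum>j\<in>UNIV. const (c j) * xi j)"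
    by (simp add: linear_forms_def)
  then obtain c where c: "\<And>i. s i = (\<Sum>j\<in>UNIV. const (c i j) * xi j)" by metis
  define A :: "complex ^ 4 ^ 4" where "A = (\<chi> i j. c i j)"
  have Fx: "F x = A *v x" if "x \<in> SL2" for x
  proof -
    have "represents (\<lambda>x. \<Sum>j\<in>UNIV. c i j * x $ j) (s i)" for i
      unfolding c sum_4 by (intro represents_add represents_mult represents_const represents_coord)
    then have "F x $ i = (\<Sum>j\<in>UNIV. c i j * x $ j)" for i
      using represents_unique[of "\<lambda>x. F x $ i" "s i" "\<lambda>x. \<Sum>j\<in>UNIV. c i j * x $ j" "s i"] linear.prems(2) that
      by (simp add: represents_map_def)
    then show ?thesis by (simp add: vec_eq_iff matrix_vector_mult_def A_def)
  qed
  have "F = restrict ((*v) A) SL2"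
    using linear.prems(3) by (auto simp: fun_eq_iff Fx PiE_def extensional_def)
  moreover have "qform (A *v x) = qform x" for x
    by (rule isometry_of_SL2) (simp add: Fx[symmetric] PiE_mem[OF linear.prems(3)])
  ultimately have "F \<in> O4" by (auto simp: O4_def)
  then show ?case by blast
next
  case (reduction i j k l u s)
  have main: "\<exists>F'\<in>O4. elem_reduction\<^sup>*\<^sup>* F F'"
    if can: "canonical i' j' k' l'" and eq: "estep i' j' k' l' u s = estep i j k l u s" and u: "u \<in> subalg {s i', s j'}"
    for i' j' k' l'
  proof -
    note sq = canonical_square[OF can]
    obtain h where h: "u = psub (two_gens i' j' s) h"
      using subalg_range[of u "two_gens i' j' s"] u unfolding range_two_gens by blast
    let ?E = "elem_map i' j' k' l' 1 1 h" and ?t = "estep i j k l u s"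
    have Fm: "F \<in> SL2 \<rightarrow> SL2" using reduction.prems(3) by auto
    have "(\<lambda>m. if m = i' then 1 / 1 else if m = j' then 1 / 1 else if m = k' then 1 else 1) = (\<lambda>m :: 4. 1 :: complex)"
      by (simp add: fun_eq_iff)
    then have "represents_map (compose SL2 ?E F) (rescale (\<lambda>m. 1) (estep i' j' k' l' u s))"
      using represents_elem_map[OF sq reduction.prems(2) Fm, of 1 1 h] unfolding h[symmetric] by (simp only:)
    moreover have "rescale (\<lambda>m. 1) t = t" for t by (simp add: rescale_def)
    ultimately have r: "represents_map (compose SL2 ?E F) ?t" by (simp only: eq)
    have vt: "admissible ?t" by (rule admissible_estep) (fact reduction.prems(1) reduction.hyps)+
    have "compose SL2 ?E F \<in> SL2 \<rightarrow>\<^sub>E SL2"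
      using Fm elem_map_SL2[OF sq, of 1 1] by (auto simp: compose_def)
    then obtain F' where F': "F' \<in> O4" "elem_reduction\<^sup>*\<^sup>* (compose SL2 ?E F) F'"
      using reduction.IH[OF vt r] by blast
    have "mdeg_poly (deg_aut (compose SL2 ?E F)) < mdeg_poly (deg_aut F)"
      unfolding deg_aut_eq_sdeg[OF r vt] deg_aut_eq_sdeg[OF reduction.prems(2,1)] by (rule reduction.hyps)
    then have "deg_aut (compose SL2 ?E F) < deg_aut F" by (simp only: mdeg_poly_less_iff)
    moreover have "?E \<in> elementary" using can unfolding elementary_eq by force
    ultimately have "elem_reduction F (compose SL2 ?E F)" by (auto simp: elem_reduction_def)
    then show ?thesis using F' by (meson converse_rtranclp_into_rtranclp)
  qed
  show ?case
    using square_canonical[OF reduction.hyps(1)]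
  proof
    assume "canonical i j k l"
    then show ?thesis using main reduction.hyps(2) by blast
  next
    assume "canonical j i l k"
    then show ?thesis
      using main[of j i l k] estep_swap[OF reduction.hyps(1)] reduction.hyps(2) by (simp add: insert_commute)
  qed
qed

theorem theorem1:
  assumes "F \<in> tame"
  shows "F \<in> reducible"
proof -
  have F: "F \<in> SL2 \<rightarrow>\<^sub>E SL2" using tame_Aut[OF assms] by (auto simp: Aut_SL2_def regular_maps_def)
  have "compose SL2 F (\<lambda>x\<in>SL2. x) = F"
    using F by (auto simp: compose_def fun_eq_iff PiE_def extensional_def)
  then have "reducing_map F" using reducing_map_tame[OF assms reducing_map_id] by simp
  then obtain s where "represents_map F s" "admissible s" "reduces s" by (auto simp: reducing_map_def reducing_def)
  then show ?thesis using reduces_imp_reductions F assms by (auto simp: reducible_def)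
qed

end
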